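(* Let $p$ and $q$ be split monic polynomials with degree $2$ in $\mathbb{F}[t]$, with $p(0)q(0)\neq 0$, and set $\delta:=p(0)q(0)^{-1}$. Assume that $p$ has two simple roots $x_1$ and $x_2$ and that $q$ has a double root $y$. Let $u$ be an endomorphism of a finite-dimensional vector space $V$ over $\mathbb{F}$. Then, the following conditions are equivalent: (i) $u$ is a q-exceptional $(p,q)$-quotient. (ii) $u$ is triangularizable with eigenvalues in $\{x_1y^{-1},x_2y^{-1}\}$, and the sequences $\bigl(n_k(u,x_1y^{-1})\bigr)_{k\geq 1}$ and $\bigl(n_k(u,x_2y^{-1})\bigr)_{k\geq 1}$ are $2$-intertwined. (iii) Every invariant factor $r$ of $u$ is split with its roots in $\{x_1y^{-1},x_2y^{-1}\}$, and the respective multiplicities $m$ and $n$ of $x_1y^{-1}$ and $x_2y^{-1}$ as roots of $r$ satisfy $|m-n|\leq 2$. (iv) In some basis of $V$, the endomorphism $u$ is represented by a block-diagonal matrix in which every diagonal block equals $C\bigl((t-z)^{n+\epsilon}\bigr)\oplus C\bigl((t-\delta z^{-1})^n\bigr)$ for some integer $n\geq 0$, some $\epsilon\in\{0,1,2\}$ and some $z\in\operatorname{Root}(p)\operatorname{Root}(q)^{-1}$.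
   Context: $\mathbb{F}$ is an arbitrary field with algebraic closure $\overline{\mathbb{F}}$. $\operatorname{Root}(p)$ is the set of roots of $p$ in $\overline{\mathbb{F}}$, and $\operatorname{Root}(p)\operatorname{Root}(q)^{-1}=\{xy^{-1}: x\in\operatorname{Root}(p),\,y\in\operatorname{Root}(q)\}$. An endomorphism $u$ of $V$ is a $(p,q)$-quotient if $u=ab^{-1}$ for some automorphisms $a,b$ of $V$ with $p(a)=0$ and $q(b)=0$. It is q-exceptional with respect to $(p,q)$ if all its eigenvalues in $\overline{\mathbb{F}}$ belong to $\operatorname{Root}(p)\operatorname{Root}(q)^{-1}$; a q-exceptional $(p,q)$-quotient is a $(p,q)$-quotient that is q-exceptional with respect to $(p,q)$. For $\lambda\in\mathbb{F}$ and a positive integer $k$, $n_k(u,\lambda):=\dim\ker(u-\lambda\,\mathrm{id}_V)^k-\dim\ker(u-\lambda\,\mathrm{id}_V)^{k-1}$. For a positive integer $s$, two non-increasing sequences $(a_n)_{n\geq1}$ and $(b_n)_{n\geq 1}$ of non-negative integers are $s$-intertwined if $a_{n+s}\leq b_n$ and $b_{n+s}\leq a_n$ for all $n\geq 1$. $C(r)$ is the companion matrix of the monic polynomial $r$ ($C(1)$ is the $0\times0$ matrix), and $\oplus$ is block-diagonal sum. The invariant factors of $u$ are the monic polynomials $r_1,r_2,\dots$ with $r_{i+1}\mid r_i$ such that $u$ is represented in some basis by $C(r_1)\oplus C(r_2)\oplus\cdots$; the finite list of nonconstant ones is extended to an infinite sequence by $r_i=1$. *)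

theory Defs
  imports
    "HOL-Algebra.Algebraic_Closure_Type"
    "Jordan_Normal_Form.Char_Poly"
begin

definition split_poly :: "'a::field poly \<Rightarrow> bool" where
  "split_poly p \<longleftrightarrow> (\<exists>xs. p = smult (lead_coeff p) (\<Prod>x\<leftarrow>xs. [:- x, 1:]))"

definition Root :: "'a::field poly \<Rightarrow> 'a alg_closure set" where
  "Root p = {x. poly (map_poly to_ac p) x = 0}"

definition root_quotients :: "'a::field poly \<Rightarrow> 'a poly \<Rightarrow> 'a alg_closure set" where
  "root_quotients p q = {x * inverse y | x y. x \<in> Root p \<and> y \<in> Root q}"

(* For r = t^n + c_(n-1) t^(n-1) + ... + c_0: ones on the subdiagonal, last column -c_0, ..., -c_(n-1). *)
definition companion_mat :: "'a::field poly \<Rightarrow> 'a mat" where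
  "companion_mat r = mat (degree r) (degree r)
     (\<lambda>(i, j). if j = degree r - 1 then - poly.coeff r i else if i = Suc j then 1 else 0)"

(* Used for non-increasing sequences; only the values at indices >= 1 are relevant. *)
definition intertwined :: "nat \<Rightarrow> (nat \<Rightarrow> nat) \<Rightarrow> (nat \<Rightarrow> nat) \<Rightarrow> bool" where
  "intertwined s a b \<longleftrightarrow> (\<forall>n\<ge>1. a (n + s) \<le> b n \<and> b (n + s) \<le> a n)"

(* Below, sc is the scalar multiplication of a vector space whose vectors form the whole type 'b. *)

definition endomorphism :: "('a::field \<Rightarrow> 'b::ab_group_add \<Rightarrow> 'b) \<Rightarrow> ('b \<Rightarrow> 'b) \<Rightarrow> bool" where
  "endomorphism sc u \<longleftrightarrow> Vector_Spaces.linear sc sc u"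

definition automorphism :: "('a::field \<Rightarrow> 'b::ab_group_add \<Rightarrow> 'b) \<Rightarrow> ('b \<Rightarrow> 'b) \<Rightarrow> bool" where
  "automorphism sc u \<longleftrightarrow> endomorphism sc u \<and> bij u"

definition poly_endo ::
  "('a::field \<Rightarrow> 'b::ab_group_add \<Rightarrow> 'b) \<Rightarrow> 'a poly \<Rightarrow> ('b \<Rightarrow> 'b) \<Rightarrow> 'b \<Rightarrow> 'b" where
  "poly_endo sc p u v = (\<Sum>i\<le>degree p. sc (poly.coeff p i) ((u ^^ i) v))"

definition pq_quotient ::
  "('a::field \<Rightarrow> 'b::ab_group_add \<Rightarrow> 'b) \<Rightarrow> 'a poly \<Rightarrow> 'a poly \<Rightarrow> ('b \<Rightarrow> 'b) \<Rightarrow> bool" where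
  "pq_quotient sc p q u \<longleftrightarrow>
     (\<exists>a b. automorphism sc a \<and> automorphism sc b \<and>
        (\<forall>v. poly_endo sc p a v = 0) \<and> (\<forall>v. poly_endo sc q b v = 0) \<and> u = a \<circ> inv_into UNIV b)"

(* Column j of M holds the coordinates of u (bs ! j) in the ordered basis bs. *)
definition represents ::
  "('a::field \<Rightarrow> 'b::ab_group_add \<Rightarrow> 'b) \<Rightarrow> 'b list \<Rightarrow> 'a mat \<Rightarrow> ('b \<Rightarrow> 'b) \<Rightarrow> bool" where
  "represents sc bs M u \<longleftrightarrow>
     distinct bs \<and> \<not> module.dependent sc (set bs) \<and> module.span sc (set bs) = UNIV \<and>
     M \<in> carrier_mat (length bs) (length bs) \<and>
     (\<forall>j<length bs. u (bs ! j) = (\<Sum>i<length bs. sc (M $$ (i, j)) (bs ! i)))"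

definition eigval :: "('a::field \<Rightarrow> 'b::ab_group_add \<Rightarrow> 'b) \<Rightarrow> ('b \<Rightarrow> 'b) \<Rightarrow> 'a \<Rightarrow> bool" where
  "eigval sc u c \<longleftrightarrow> (\<exists>v. v \<noteq> 0 \<and> u v = sc c v)"

(* Eigenvalues of u in the algebraic closure: those of a matrix of u after extending scalars. *)
definition ac_eigval ::
  "('a::field \<Rightarrow> 'b::ab_group_add \<Rightarrow> 'b) \<Rightarrow> ('b \<Rightarrow> 'b) \<Rightarrow> 'a alg_closure \<Rightarrow> bool" where
  "ac_eigval sc u c \<longleftrightarrow> (\<exists>bs M. represents sc bs M u \<and> eigenvalue (map_mat to_ac M) c)"

definition q_exceptional ::
  "('a::field \<Rightarrow> 'b::ab_group_add \<Rightarrow> 'b) \<Rightarrow> 'a poly \<Rightarrow> 'a poly \<Rightarrow> ('b \<Rightarrow> 'b) \<Rightarrow> bool" where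
  "q_exceptional sc p q u \<longleftrightarrow> (\<forall>c. ac_eigval sc u c \<longrightarrow> c \<in> root_quotients p q)"

definition triangularizable ::
  "('a::field \<Rightarrow> 'b::ab_group_add \<Rightarrow> 'b) \<Rightarrow> ('b \<Rightarrow> 'b) \<Rightarrow> bool" where
  "triangularizable sc u \<longleftrightarrow> (\<exists>bs M. represents sc bs M u \<and> upper_triangular M)"

definition ker_pow_dim ::
  "('a::field \<Rightarrow> 'b::ab_group_add \<Rightarrow> 'b) \<Rightarrow> ('b \<Rightarrow> 'b) \<Rightarrow> 'a \<Rightarrow> nat \<Rightarrow> nat" where
  "ker_pow_dim sc u c k = vector_space.dim sc {v. ((\<lambda>w. u w - sc c w) ^^ k) v = 0}"

(* n_k(u, c), meant for k >= 1; the kernels increase with k, so nothing is truncated. *)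
definition jordan_number ::
  "('a::field \<Rightarrow> 'b::ab_group_add \<Rightarrow> 'b) \<Rightarrow> ('b \<Rightarrow> 'b) \<Rightarrow> 'a \<Rightarrow> nat \<Rightarrow> nat" where
  "jordan_number sc u c k = ker_pow_dim sc u c k - ker_pow_dim sc u c (k - 1)"

(* r is the sequence of invariant factors of u, with r 0 the first one. Since C(1) is the
   0 x 0 matrix, the choice of the cut-off N is immaterial. *)
definition invariant_factors ::
  "('a::field \<Rightarrow> 'b::ab_group_add \<Rightarrow> 'b) \<Rightarrow> ('b \<Rightarrow> 'b) \<Rightarrow> (nat \<Rightarrow> 'a poly) \<Rightarrow> bool" where
  "invariant_factors sc u r \<longleftrightarrow>
     (\<forall>i. lead_coeff (r i) = 1) \<and> (\<forall>i. r (Suc i) dvd r i) \<and>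
     (\<exists>N. (\<forall>i\<ge>N. r i = 1) \<and>
        (\<exists>bs. represents sc bs (diag_block_mat (map (\<lambda>i. companion_mat (r i)) [0..<N])) u))"

end

theory Submission
  imports Defs "HOL-Library.Set_Algebras"
begin

text \<open>
  Put \<open>a = x1 / y\<close>, \<open>b = x2 / y\<close>, and regard the space as a \<open>K[t]\<close>-module through \<open>u\<close>. If
  \<open>u = A (1 - N)\<close> with \<open>(A - a) (A - b) = 0\<close> and \<open>N\<^sup>2 = 0\<close>, then
  \<open>w = (a + b) N - A N - N A\<close> commutes with \<open>A\<close>, \<open>N\<close> and \<open>u\<close>, and \<open>u w = (u - a) (u - b)\<close>.
  So the Jordan numbers of \<open>u\<close> at \<open>a\<close> and \<open>b\<close> are those, at \<open>0\<close>, of the restrictions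
  of \<open>w\<close> to the eigenspaces of \<open>A\<close>. The off-diagonal parts of \<open>N\<close> are module maps between
  these eigenspaces whose composites are multiples of \<open>w\<^sup>2\<close>; hence the shift by two.
  Conversely, on a cyclic module whose annihilator is \<open>(t - a)\<^sup>m (t - b)\<^sup>n\<close> with
  \<open>\<bar>m - n\<bar> \<le> 2\<close>, the linear factors can be ordered so that \<open>u\<close> becomes a product of two block
  diagonal maps with blocks of size at most two. Invariant factors link the two: since they
  divide one another, their multiplicities at \<open>a\<close> and at \<open>b\<close> are both sorted, and the
  intertwining condition compares them factor by factor.
\<close>

section \<open>Torsion modules over a polynomial ring\<close>

text \<open>Dividing both automorphisms by \<open>y\<close> leaves \<open>u\<close> unchanged and
  turns them into \<open>A\<close> and \<open>B = 1 + N\<close>, whence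
  \<open>u = A (1 - N)\<close>. Since \<open>(1 - N)^(-1) = 1 + N\<close> and
  \<open>a b A^(-1) = (a + b) - A\<close>, the map \<open>w\<close> equals
  \<open>u + a b u^(-1) - (a + b)\<close>. This explains its symmetry in \<open>a\<close> and
  \<open>b\<close> and the formula for \<open>u w\<close>; on the generalized eigenspace of
  \<open>u\<close> at \<open>a\<close> or \<open>b\<close>, it makes \<open>w\<close> equal to
  \<open>u - a\<close> or \<open>u - b\<close> up to an invertible factor. The obstacle is that in
  general neither the eigenspaces of \<open>A\<close> are stable under \<open>u\<close> nor the
  generalized eigenspaces of \<open>u\<close> under \<open>A\<close>. A shear
  \<open>1 - c N\<close>, which commutes with \<open>w\<close>, carries eigenvectors of
  \<open>u\<close> to eigenvectors of \<open>A\<close>. The number 2 arises twice. In block form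
  along the eigenspaces of \<open>A\<close>, \<open>w\<close> is on each of them a nonzero multiple
  of the diagonal block of \<open>N\<close>, and \<open>N^2 = 0\<close> makes the product of the
  off-diagonal blocks minus a square. Conversely, if the linear factors are arranged in adjacent
  pairs of an \<open>a\<close> and a \<open>b\<close>, one surplus factor fits before the pairs and
  one after them.\<close>

fun dsum :: "'b::monoid_add set \<Rightarrow> 'b set list \<Rightarrow> bool" where
  "dsum W [] \<longleftrightarrow> W = {0}"
| "dsum W (S # Ss) \<longleftrightarrow> (\<exists>W'. dsum W' Ss \<and> S \<inter> W' = {0} \<and> W = S + W')"

lemma plus_singleton_zero: "S + {0} = S" "{0} + S = S" for S :: "'b::monoid_add set"
  by (auto simp: set_plus_def)

locale poly_module = Modules.module scale
  for scale :: "'a::field poly \<Rightarrow> 'b::ab_group_add \<Rightarrow> 'b" (infixr \<open>\<star>\<close> 75)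
begin

lemma subspace_plus:
  assumes "subspace S" "subspace T"
  shows "subspace (S + T)"
proof -
  have sp: "span S = S" "span T = T" using assms by auto
  have "S + T = span (S \<union> T)" unfolding span_Un sp set_plus_def by auto
  then show ?thesis by simp
qed

lemma dsum_subspace:
  "dsum W Ss \<Longrightarrow> \<forall>S\<in>set Ss. subspace S \<Longrightarrow> subspace W"
  by (induction Ss arbitrary: W) (auto intro: subspace_plus)

text \<open>The rebracketing of a direct sum of three terms. It carries the induction in
  \<open>dsum_append\<close>, where the head is moved across a sum of two tails.\<close>

lemma plus_Int_assoc:
  assumes S: "subspace S" and A: "subspace A" and B: "subspace B"
  shows "A \<inter> B = {0} \<and> S \<inter> (A + B) = {0} \<longleftrightarrow> S \<inter> A = {0} \<and> (S + A) \<inter> B = {0}"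
    (is "?L \<longleftrightarrow> ?R")
proof
  assume L: ?L
  have "x \<in> S \<inter> A \<Longrightarrow> x = 0" for x
  proof -
    assume x: "x \<in> S \<inter> A"
    then have "x + 0 \<in> A + B" using subspace_0[OF B] by (intro set_plus_intro) auto
    then show "x = 0" using L x by auto
  qed
  moreover have "b = 0" if b: "b \<in> (S + A) \<inter> B" for b
  proof -
    obtain x a where xa: "x \<in> S" "a \<in> A" "b = x + a" using b by (auto elim: set_plus_elim)
    then have "x = (- a) + b" by simp
    moreover have "- a \<in> A" using xa A subspace_neg by auto
    ultimately have "x \<in> A + B" using b by (metis IntD2 set_plus_intro)
    then have "x = 0" using L xa by auto
    then show "b = 0" using xa L b by auto
  qed
  ultimately show ?R
    using subspace_0[OF S] subspace_0[OF A] subspace_0[OF B] subspace_0[OF subspace_plus[OF S A]]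
    by blast
next
  assume R: ?R
  have "a = 0" if "a \<in> A \<inter> B" for a
  proof -
    have "0 + a \<in> S + A" using subspace_0[OF S] that by (intro set_plus_intro) auto
    then show "a = 0" using R that by auto
  qed
  moreover have "x = 0" if x: "x \<in> S \<inter> (A + B)" for x
  proof -
    obtain a b where ab: "a \<in> A" "b \<in> B" "x = a + b" using x by (auto elim: set_plus_elim)
    then have "b = x + (- a)" by simp
    moreover have "- a \<in> A" using ab A subspace_neg by auto
    ultimately have "b \<in> S + A" using x by (metis IntD1 set_plus_intro)
    then have "b = 0" using R ab by auto
    then show "x = 0" using ab R x by auto
  qed
  ultimately show ?L
    using subspace_0[OF S] subspace_0[OF A] subspace_0[OF B] subspace_0[OF subspace_plus[OF A B]]
    by blast
qed

lemma dsum_append: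
  assumes "\<forall>S\<in>set Ss. subspace S" and "\<forall>S\<in>set Ts. subspace S"
  shows "dsum W (Ss @ Ts) \<longleftrightarrow>
    (\<exists>A B. dsum A Ss \<and> dsum B Ts \<and> A \<inter> B = {0} \<and> W = A + B)"
  using assms
proof (induction Ss arbitrary: W)
  case Nil
  have "dsum W Ts \<Longrightarrow> {0} \<inter> W = {0}" for W
    using dsum_subspace Nil subspace_0 by auto
  then show ?case by (metis append_Nil dsum.simps(1) plus_singleton_zero(2))
next
  case (Cons S Ss)
  have S: "subspace S" using Cons by simp
  have IH: "dsum W' (Ss @ Ts) \<longleftrightarrow>
    (\<exists>A B. dsum A Ss \<and> dsum B Ts \<and> A \<inter> B = {0} \<and> W' = A + B)" for W'
    using Cons by auto
  show ?case
  proof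
    assume "dsum W ((S # Ss) @ Ts)"
    then obtain A B where *: "dsum A Ss" "dsum B Ts" "A \<inter> B = {0}"
      "S \<inter> (A + B) = {0}" "W = S + (A + B)"
      using IH by auto
    moreover have "subspace A" "subspace B" using * dsum_subspace Cons.prems by auto
    ultimately have "S \<inter> A = {0}" "(S + A) \<inter> B = {0}" "W = (S + A) + B"
      using plus_Int_assoc[OF S, of A B] by (auto simp: add.assoc)
    then show "\<exists>A B. dsum A (S # Ss) \<and> dsum B Ts \<and> A \<inter> B = {0} \<and> W = A + B"
      using * by auto
  next
    assume "\<exists>A B. dsum A (S # Ss) \<and> dsum B Ts \<and> A \<inter> B = {0} \<and> W = A + B"
    then obtain A B where *: "dsum A Ss" "S \<inter> A = {0}" "dsum B Ts" "(S + A) \<inter> B = {0}"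
      "W = (S + A) + B" by auto
    moreover have "subspace A" "subspace B" using * dsum_subspace Cons.prems by auto
    ultimately have "A \<inter> B = {0}" "S \<inter> (A + B) = {0}" "W = S + (A + B)"
      using plus_Int_assoc[OF S, of A B] by (auto simp: add.assoc)
    then show "dsum W ((S # Ss) @ Ts)" using * IH by auto
  qed
qed

lemma dsum_single: "0 \<in> S \<Longrightarrow> dsum S [S]"
proof -
  assume "0 \<in> S"
  then have "S \<inter> {0} = {0}" by auto
  moreover have "S = S + {0}" by (rule plus_singleton_zero(1)[symmetric])
  ultimately show ?thesis unfolding dsum.simps by blast
qed

text \<open>Reconciles two conventions: \<open>cyclic_decomposition\<close> lists annihilators so
  that each divides the later ones, while invariant factors run the other way.\<close>

lemma dsum_rev: "\<forall>S\<in>set Ss. subspace S \<Longrightarrow> dsum W Ss \<Longrightarrow> dsum W (rev Ss)"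
proof (induction Ss arbitrary: W)
  case (Cons S Ss)
  then obtain W' where *: "dsum W' Ss" "S \<inter> W' = {0}" "W = S + W'" by auto
  then have "dsum W' (rev Ss)" using Cons by auto
  moreover have "dsum S [S]" using dsum_single Cons.prems subspace_0 by auto
  moreover have "W' \<inter> S = {0}" "W = W' + S"
    using * by (simp_all add: Int_commute add.commute)
  moreover have "dsum W (rev Ss @ [S]) \<longleftrightarrow>
    (\<exists>A B. dsum A (rev Ss) \<and> dsum B [S] \<and> A \<inter> B = {0} \<and> W = A + B)"
    using Cons.prems by (intro dsum_append) auto
  ultimately show ?case unfolding rev.simps by blast
qed simp

text \<open>That is, \<open>r\<close> generates the annihilator ideal of \<open>x\<close>, and the
  submodule spanned by \<open>x\<close> is a copy of the polynomial ring modulo \<open>r\<close>.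
  The value \<open>r = 1\<close> belongs to \<open>x = 0\<close>.\<close>

definition annihilator :: "'b \<Rightarrow> 'a poly \<Rightarrow> bool" where
  "annihilator x r \<longleftrightarrow> (\<forall>h. h \<star> x = 0 \<longleftrightarrow> r dvd h)"

lemma annihilatorD: "annihilator x r \<Longrightarrow> h \<star> x = 0 \<longleftrightarrow> r dvd h"
  unfolding annihilator_def by blast

fun lincomb :: "'a poly list \<Rightarrow> 'b list \<Rightarrow> 'b" where
  "lincomb (h # hs) (x # xs) = h \<star> x + lincomb hs xs"
| "lincomb _ _ = 0"

lemma lincomb_append:
  "length hs = length xs \<Longrightarrow> lincomb (hs @ hs') (xs @ xs') = lincomb hs xs + lincomb hs' xs'"
  by (induction hs xs rule: list_induct2) (auto simp: add.assoc)

lemma lincomb_zeros: "lincomb (replicate n 0) xs = 0"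
proof (induction n arbitrary: xs)
  case (Suc n) then show ?case by (cases xs) auto
qed simp

lemma lincomb_dvd:
  assumes "length hs = length xs" "\<forall>h\<in>set hs. c dvd h"
  shows "\<exists>z\<in>span (set xs). lincomb hs xs = c \<star> z"
  using assms
proof (induction hs xs rule: list_induct2)
  case Nil then show ?case by (auto intro!: bexI[of _ 0])
next
  case (Cons h hs x xs)
  then obtain z where z: "z \<in> span (set xs)" "lincomb hs xs = c \<star> z" by auto
  obtain g where "h = c * g" using Cons.prems by (auto elim!: dvdE)
  then have "lincomb (h # hs) (x # xs) = c \<star> (g \<star> x + z)" by (simp add: z scale_right_distrib)
  moreover have "g \<star> x + z \<in> span (set (x # xs))"
    using z span_mono[of "set xs" "set (x # xs)"] span_base[of x "set (x # xs)"]
    by (intro span_add span_scale) auto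
  ultimately show ?case by blast
qed

lemma span_lincomb: "z \<in> span (set xs) \<Longrightarrow> \<exists>hs. length hs = length xs \<and> lincomb hs xs = z"
proof (induction xs arbitrary: z)
  case (Cons x xs)
  then obtain k where "z - k \<star> x \<in> span (set xs)" by (auto simp: span_insert)
  then obtain hs where "length hs = length xs" "lincomb hs xs = z - k \<star> x" using Cons by blast
  then show ?case by (intro exI[of _ "k # hs"]) auto
qed simp

text \<open>The elementary change of generators by which \<open>cyclic_decomposition\<close> reduces
  one coefficient of a relation modulo another.\<close>

lemma span_insert_add: "z \<in> span S \<Longrightarrow> span (insert (x + z) S) = span (insert x S)"
proof -
  assume z: "z \<in> span S"
  have "x + z \<in> span (insert x S)"
    using z span_mono[of S "insert x S"] span_base[of x "insert x S"]
    by (intro span_add) auto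
  moreover have "(x + z) - z \<in> span (insert (x + z) S)"
    using z span_mono[of S "insert (x + z) S"] span_base[of "x + z" "insert (x + z) S"]
    by (intro span_diff) auto
  ultimately show ?thesis
    unfolding span_eq using span_superset[of "insert x S"] span_superset[of "insert (x + z) S"]
    by auto
qed

text \<open>Takes the place of a permutation of the generators: only their set and the value of the
  combination matter, so any chosen coefficient may be assumed to stand first.\<close>

lemma swap_to_front:
  assumes "length hs = length xs" "c \<in> set hs"
  shows "\<exists>x xs' hs'. length xs = Suc (length xs') \<and> length hs' = length xs' \<and>
    set xs = set (x # xs') \<and> lincomb (c # hs') (x # xs') = lincomb hs xs"
proof -
  obtain as bs where hs: "hs = as @ c # bs" using split_list[OF assms(2)] by (elim exE)
  define us x vs where "us = take (length as) xs" and "x = xs ! length as"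
    and "vs = drop (Suc (length as)) xs"
  have xs: "xs = us @ x # vs"
    unfolding us_def x_def vs_def using assms(1) hs by (intro id_take_nth_drop) simp
  have len: "length as = length us" "length bs = length vs" using assms hs by (auto simp: us_def vs_def)
  show ?thesis
    by (rule exI[of _ x], rule exI[of _ "us @ vs"], rule exI[of _ "as @ bs"])
      (auto simp: xs hs len lincomb_append)
qed

lemma scale_dvd_zero: "c \<star> x = 0 \<Longrightarrow> c dvd h \<Longrightarrow> h \<star> x = 0"
  by (metis dvd_def mult.commute scale_scale scale_zero_right)

lemma span_insert_plus: "span (insert x S) = span {x} + span S"
  using span_Un[of "{x}" S] unfolding set_plus_def by auto

text \<open>Induction on the number of generators. Among all relations between generating systems of
  the given length, a nonzero coefficient \<open>c\<close> of least degree divides the other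
  coefficients of its relation. The relation then reads \<open>c e = 0\<close> for a new generator
  \<open>e\<close>, and \<open>e\<close> splits off. Zero generators, with \<open>r = 1\<close>, are
  kept, so the length of the list never changes.\<close>

theorem cyclic_decomposition:
  assumes torsion: "\<And>x. \<exists>h. h \<noteq> 0 \<and> h \<star> x = 0"
  shows "\<exists>ers. length ers = length es \<and> span (set (map fst ers)) = span (set es) \<and>
    dsum (span (set es)) (map (\<lambda>(e, r). span {e}) ers) \<and>
    (\<forall>(e, r) \<in> set ers. annihilator e r \<and> lead_coeff r = 1) \<and>
    sorted_wrt (\<lambda>(e, r) (e', r'). r dvd r') ers"
proof (induction "length es" arbitrary: es)
  case 0
  then have "es = []" by simp
  then show ?case by (intro exI[of _ "[]"]) simp
next
  case (Suc n)
  let ?P = "\<lambda>c xs hs. length xs = Suc n \<and> length hs = Suc n \<and> span (set xs) = span (set es) \<and>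
    lincomb hs xs = 0 \<and> c \<in> set hs \<and> c \<noteq> 0"
  \<comment> \<open>Torsion provides a first relation: a nonzero polynomial kills the first
    generator, and the other coefficients are 0.\<close>
  have "\<exists>c xs hs. ?P c xs hs"
  proof -
    obtain x xs where es: "es = x # xs" using Suc by (cases es) auto
    obtain h where "h \<noteq> 0" "h \<star> x = 0" using torsion by blast
    then have "?P h es (h # replicate n 0)" using Suc by (simp add: es lincomb_zeros)
    then show ?thesis by blast
  qed
  moreover define Q where "Q c \<longleftrightarrow> (\<exists>xs hs. ?P c xs hs)" for c
  ultimately obtain c1 where "Q c1" by blast
  then obtain c0 where Q: "Q c0" and min': "\<And>c'. Q c' \<Longrightarrow> degree c0 \<le> degree c'"
    using ex_has_least_nat[of Q c1 degree] by blast
  have c0: "\<exists>xs hs. ?P c0 xs hs" using Q unfolding Q_def .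
  define c where "c = smult (inverse (lead_coeff c0)) c0"
  have c: "c \<noteq> 0" "lead_coeff c = 1" "degree c = degree c0" using c0 by (auto simp: c_def)
  \<comment> \<open>Minimality in the form in which it is used: a nonzero remainder modulo
    \<open>c\<close> has smaller degree than \<open>c\<close>, so it cannot occur as a coefficient
    of a relation.\<close>
  have rem: "h mod c = 0" if "\<And>r. h mod c = r \<Longrightarrow> r \<noteq> 0 \<Longrightarrow> \<exists>xs hs. ?P r xs hs" for h
  proof (rule ccontr)
    assume nz: "h mod c \<noteq> 0"
    have "Q (h mod c)" unfolding Q_def using that[OF refl nz] .
    then show False using min' degree_mod_less[of c h] c nz by force
  qed
  \<comment> \<open>Replacing \<open>e\<close> by \<open>e + (b div c) x\<close> changes the
    coefficient of \<open>x\<close> from \<open>b\<close> to \<open>b mod c\<close> and keeps the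
    span, so \<open>rem\<close> applies.\<close>
  have claim1: "c dvd b"
    if len: "length xs = n" "length hs = n" and sp: "span (set (e # xs)) = span (set es)"
      and rel: "lincomb (c # hs) (e # xs) = 0" and b: "b \<in> set hs" for e xs hs b
  proof -
    obtain x us as where *: "length xs = Suc (length us)" "length as = length us"
      "set xs = set (x # us)" "lincomb (b # as) (x # us) = lincomb hs xs"
      using swap_to_front[of hs xs b] len b by auto
    have "b mod c = 0"
    proof (rule rem)
      fix r assume r: "b mod c = r" "r \<noteq> 0"
      have "c \<star> (e + (b div c) \<star> x) + r \<star> x = c \<star> e + (c * (b div c) + r) \<star> x"
        by (simp add: scale_right_distrib scale_left_distrib add.assoc)
      also have "c * (b div c) + r = b" using r by auto
      finally have "lincomb (c # r # as) ((e + (b div c) \<star> x) # x # us)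
          = c \<star> e + (b \<star> x + lincomb as us)"
        by (simp add: add.assoc[symmetric])
      also have "\<dots> = 0" using rel * by simp
      finally have "lincomb (c # r # as) ((e + (b div c) \<star> x) # x # us) = 0" .
      moreover have "span (set ((e + (b div c) \<star> x) # x # us)) = span (set es)"
        using span_insert_add[of "(b div c) \<star> x" "set (x # us)" e] sp *(3)
          span_scale[OF span_base[of x "set (x # us)"]] by simp
      ultimately have "?P r ((e + (b div c) \<star> x) # x # us) (c # r # as)"
        using r len * by auto
      then show "\<exists>xs hs. ?P r xs hs" by blast
    qed
    then show "c dvd b" by auto
  qed
  obtain e2 es2 hs2 where len2: "length es2 = n" "length hs2 = n"
    and sp2: "span (set (e2 # es2)) = span (set es)" and rel2: "lincomb (c # hs2) (e2 # es2) = 0"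
  proof -
    obtain xs hs where xh: "?P c0 xs hs" using c0 by blast
    obtain e xs' hs' where *: "length xs = Suc (length xs')" "length hs' = length xs'"
      "set xs = set (e # xs')" "lincomb (c0 # hs') (e # xs') = lincomb hs xs"
      using swap_to_front[of hs xs c0] xh by auto
    let ?k = "[:inverse (lead_coeff c0):]"
    have "lincomb (map ((*) ?k) gs) ys = ?k \<star> lincomb gs ys" if "length gs = length ys" for gs ys
      using that by (induction gs ys rule: list_induct2) (auto simp: scale_right_distrib scale_scale)
    from this[of "c0 # hs'" "e # xs'"] have "lincomb (map ((*) ?k) (c0 # hs')) (e # xs') = 0"
      using * xh by simp
    then show ?thesis using that[of xs' "map ((*) ?k) hs'" e] * xh by (simp add: c_def)
  qed
  obtain z where z: "z \<in> span (set es2)" "lincomb hs2 es2 = c \<star> z"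
    using lincomb_dvd[of hs2 es2 c] claim1[OF len2 sp2 rel2] len2 by auto
  \<comment> \<open>All coefficients are multiples of \<open>c\<close>, so the relation reads
    \<open>c (e2 + z) = 0\<close> with \<open>z\<close> in the span of the remaining
    generators.\<close>
  define e where "e = e2 + z"
  have sp: "span (set (e # es2)) = span (set es)"
    using span_insert_add[OF z(1), of e2] sp2 by (simp add: e_def)
  have ce: "c \<star> e = 0" using rel2 z by (simp add: e_def scale_right_distrib)
  \<comment> \<open>A multiple of \<open>e\<close> in the span of the others is a relation with
    coefficient \<open>h\<close>, and \<open>h\<close> may be reduced modulo \<open>c\<close>
    because \<open>c e = 0\<close>. This gives both the annihilator of \<open>e\<close> and the
    directness of the sum.\<close>
  have claim3: "c dvd h" if "h \<star> e \<in> span (set es2)" for h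
  proof -
    have "h \<star> e = (h mod c) \<star> e"
      using scale_left_distrib[of "h div c * c" "h mod c" e] scale_dvd_zero[OF ce, of "h div c * c"]
      by simp
    moreover have "- (h \<star> e) \<in> span (set es2)" using that by (rule span_neg)
    ultimately obtain hs where hs: "length hs = length es2" "(h mod c) \<star> e + lincomb hs es2 = 0"
      using span_lincomb[of "- (h \<star> e)" es2] by auto
    have "h mod c = 0"
    proof (rule rem)
      fix r assume "h mod c = r" "r \<noteq> 0"
      then have "?P r (e # es2) (r # hs)" using hs sp len2 by simp
      then show "\<exists>xs hs. ?P r xs hs" by blast
    qed
    then show ?thesis by auto
  qed
  obtain ers where ers: "length ers = n" "span (set (map fst ers)) = span (set es2)"
    "dsum (span (set es2)) (map (\<lambda>(e, r). span {e}) ers)"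
    "\<forall>(e, r) \<in> set ers. annihilator e r \<and> lead_coeff r = 1"
    "sorted_wrt (\<lambda>(e, r) (e', r'). r dvd r') ers"
    using Suc(1)[of es2] len2 by auto
  have spe: "span (set (map fst ((e, c) # ers))) = span (set es)"
    using span_insert_plus[of e "set (map fst ers)"] span_insert_plus[of e "set es2"] ers(2) sp
    by simp
  have ann: "annihilator e c"
    unfolding annihilator_def using claim3 scale_dvd_zero[OF ce] by (auto simp: span_zero)
  have int: "span {e} \<inter> span (set es2) = {0}"
  proof -
    have "x = 0" if x: "x \<in> span {e}" "x \<in> span (set es2)" for x
    proof -
      obtain h where h: "x = h \<star> e" using x by (auto simp: span_singleton)
      then have "c dvd h" using claim3 x by auto
      then show "x = 0" using h scale_dvd_zero[OF ce] by simp
    qed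
    then show ?thesis using span_zero by auto
  qed
  have sum: "span (set es) = span {e} + span (set es2)"
    using span_insert_plus[of e "set es2"] sp by simp
  \<comment> \<open>\<open>c e\<close> and \<open>r x\<close> vanish separately. Read together as
    one relation with front coefficient \<open>c\<close>, they fall under
    \<open>claim1\<close>.\<close>
  have dvd: "c dvd r" if er: "(x, r) \<in> set ers" for x r
  proof -
    obtain us vs where ers': "ers = us @ (x, r) # vs" using split_list[OF er] by blast
    let ?hs = "replicate (length us) 0 @ r # replicate (length vs) 0"
    have "annihilator x r" using ers er by auto
    then have "r \<star> x = 0" using annihilatorD[of x r r] by simp
    then have "lincomb (c # ?hs) (map fst ((e, c) # ers)) = 0"
      using ce by (simp add: ers' lincomb_append lincomb_zeros)
    then show ?thesis
      using claim1[of "map fst ers" ?hs e r] ers(1) spe by (simp add: ers')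
  qed
  let ?ers = "(e, c) # ers"
  have "length ?ers = length es" using ers(1) Suc(2) by simp
  moreover have "dsum (span (set es)) (map (\<lambda>(e, r). span {e}) ?ers)"
    unfolding list.map prod.case dsum.simps using ers(3) int sum by blast
  moreover have "\<forall>(e, r) \<in> set ?ers. annihilator e r \<and> lead_coeff r = 1"
    using ers(4) ann c(2) by simp
  moreover have "sorted_wrt (\<lambda>(e, r) (e', r'). r dvd r') ?ers"
    using ers(5) dvd by auto
  ultimately show ?case using spe by (intro exI[of _ ?ers] conjI)
qed

end

section \<open>The action of polynomials and free families\<close>

locale fd_endo = finite_dimensional_vector_space sc Basis
  for sc :: "'a::field \<Rightarrow> 'b::ab_group_add \<Rightarrow> 'b" (infixr \<open>*s\<close> 75) and Basis :: "'b set" +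
  fixes u :: "'b \<Rightarrow> 'b"
  assumes linear_u: "Vector_Spaces.linear (*s) (*s) u"
begin

lemma u_add: "u (x + y) = u x + u y"
  and u_scale: "u (c *s x) = c *s u x"
  using linear_u unfolding Vector_Spaces.linear_iff by auto

lemma u_sum: "u (sum f A) = (\<Sum>i\<in>A. u (f i))"
proof -
  interpret Vector_Spaces.linear "(*s)" "(*s)" u by (rule linear_u)
  show ?thesis by (rule sum)
qed

lemma u_zero: "u 0 = 0"
  using u_scale[of 0 0] by simp

definition act :: "'a poly \<Rightarrow> 'b \<Rightarrow> 'b" where
  "act h v = poly_endo (*s) h u v"

lemma act_bound: "degree h \<le> n \<Longrightarrow> act h v = (\<Sum>i\<le>n. coeff h i *s (u ^^ i) v)"
  unfolding act_def poly_endo_def by (intro sum.mono_neutral_left) (auto simp: coeff_eq_0)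

lemma act_zero: "act 0 v = 0"
  by (simp add: act_def poly_endo_def)

lemma act_pCons: "act (pCons a h) v = a *s v + act h (u v)"
proof -
  have "act (pCons a h) v = (\<Sum>i\<le>Suc (degree h). coeff (pCons a h) i *s (u ^^ i) v)"
    by (rule act_bound) (rule degree_pCons_le)
  also have "\<dots> = a *s v + (\<Sum>i\<le>degree h. coeff h i *s (u ^^ Suc i) v)"
    by (subst sum.atMost_Suc_shift) simp
  finally show ?thesis by (simp add: act_def poly_endo_def funpow_swap1)
qed

lemma act_add_left: "act (g + h) v = act g v + act h v"
proof -
  let ?n = "max (degree g) (degree h)"
  have "act (g + h) v = (\<Sum>i\<le>?n. coeff (g + h) i *s (u ^^ i) v)"
    by (rule act_bound) (rule degree_add_le_max)
  then show ?thesis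
    using act_bound[of g ?n v] act_bound[of h ?n v] by (simp add: scale_left_distrib sum.distrib)
qed

lemma funpow_add: "(u ^^ i) (x + y) = (u ^^ i) x + (u ^^ i) y"
  by (induction i) (simp_all add: u_add)

lemma funpow_scale: "(u ^^ i) (c *s x) = c *s (u ^^ i) x"
  by (induction i) (simp_all add: u_scale)

lemma act_add_right: "act h (x + y) = act h x + act h y"
  by (simp add: act_def poly_endo_def funpow_add scale_right_distrib sum.distrib)

lemma act_smult: "act (smult c h) v = c *s act h v"
  using act_bound[of "smult c h" "degree h" v]
  by (simp add: act_def poly_endo_def scale_sum_right degree_smult_le)

lemma act_u: "act h (u v) = u (act h v)"
  by (simp add: act_def poly_endo_def u_sum u_scale funpow_swap1)

lemma act_scale_right: "act h (c *s v) = c *s act h v"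
  by (simp add: act_def poly_endo_def funpow_scale scale_sum_right mult.commute)

lemma act_mult: "act (g * h) v = act g (act h v)"
proof (induction g)
  case (pCons a g)
  have "act (pCons a g * h) v = a *s act h v + act (pCons 0 (g * h)) v"
    by (simp add: mult_pCons_left act_add_left act_smult)
  also have "act (pCons 0 (g * h)) v = act g (u (act h v))"
    by (simp add: act_pCons act_u pCons)
  finally show ?case by (simp add: act_pCons)
qed (simp add: act_zero)

lemma act_one: "act 1 v = v"
  by (simp add: one_pCons act_pCons act_zero)

lemma act_const: "act [:c:] v = c *s v"
  by (simp add: act_pCons act_zero)

lemma act_linear_factor: "act [:- c, 1:] v = u v - c *s v"
  by (simp add: act_pCons act_zero)

lemma funpow_linear_factor: "((\<lambda>w. u w - c *s w) ^^ k) v = act ([:- c, 1:] ^ k) v"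
  by (induction k) (simp_all add: act_one act_mult act_linear_factor del: mult_pCons_left)

sublocale pm: poly_module act
  by unfold_locales (simp_all add: act_add_left act_add_right act_mult act_one)

lemma pm_subspace_imp: "pm.subspace W \<Longrightarrow> subspace W"
  using pm.subspace_0 pm.subspace_add pm.subspace_scale[of W _ "[:_:]"]
  by (intro subspaceI) (auto simp: act_const)

lemma pm_span_eq_UNIV:
  assumes "span S = UNIV" shows "pm.span S = UNIV"
proof -
  have "span S \<subseteq> pm.span S"
    by (rule span_minimal) (auto intro: pm.span_base pm_subspace_imp)
  then show ?thesis using assms by auto
qed

lemma subspace_set_plus: "subspace S \<Longrightarrow> subspace T \<Longrightarrow> subspace (S + T)"
proof -
  assume "subspace S" "subspace T"
  then have sp: "span S = S" "span T = T" by auto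
  have "S + T = span (S \<union> T)" unfolding span_Un sp set_plus_def by auto
  then show ?thesis by simp
qed

lemma span_append_set: "span (S \<union> T) = span S + span T"
  unfolding span_Un set_plus_def by auto

text \<open>Coefficients are indexed by position in a list: a basis belonging to a matrix is
  ordered, and a column of the matrix can serve directly as coefficient function.\<close>

definition lc :: "'b list \<Rightarrow> (nat \<Rightarrow> 'a) \<Rightarrow> 'b" where
  "lc bs c = (\<Sum>i<length bs. c i *s bs ! i)"

definition free :: "'b list \<Rightarrow> bool" where
  "free bs \<longleftrightarrow> distinct bs \<and> independent (set bs)"

lemma lc_Cons: "lc (b # bs) c = c 0 *s b + lc bs (\<lambda>i. c (Suc i))"
  unfolding lc_def by (simp add: sum.lessThan_Suc_shift del: sum.lessThan_Suc)

lemma lc_append: "lc (bs @ cs) c = lc bs c + lc cs (\<lambda>i. c (i + length bs))"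
  by (induction bs arbitrary: c) (simp_all add: lc_Cons, simp_all add: lc_def algebra_simps)

lemma lc_cong: "(\<And>i. i < length bs \<Longrightarrow> c i = d i) \<Longrightarrow> lc bs c = lc bs d"
  unfolding lc_def by (intro sum.cong) auto

lemma span_list: "span (set bs) = range (lc bs)"
proof (induction bs)
  case Nil
  then show ?case by (auto simp: lc_def)
next
  case (Cons b bs)
  have "x \<in> span (set (b # bs)) \<longleftrightarrow> x \<in> range (lc (b # bs))" for x
  proof
    assume "x \<in> span (set (b # bs))"
    then obtain k where "x - k *s b \<in> span (set bs)" by (auto simp: span_insert)
    then obtain c where "x - k *s b = lc bs c" using Cons by auto
    then have "x = lc (b # bs) (case_nat k c)" by (simp add: lc_Cons algebra_simps)
    then show "x \<in> range (lc (b # bs))" by blast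
  next
    assume "x \<in> range (lc (b # bs))"
    then obtain c where "x = c 0 *s b + lc bs (\<lambda>i. c (Suc i))" by (auto simp: lc_Cons)
    then have "x - c 0 *s b \<in> span (set bs)" using Cons by auto
    then show "x \<in> span (set (b # bs))" by (auto simp: span_insert)
  qed
  then show ?case by blast
qed

lemma free_Cons: "free (b # bs) \<longleftrightarrow> b \<notin> span (set bs) \<and> free bs"
proof (cases "b \<in> set bs")
  case True
  then show ?thesis using span_base[of b "set bs"] by (auto simp: free_def)
next
  case False
  then show ?thesis by (auto simp: free_def independent_insert)
qed

lemma free_iff: "free bs \<longleftrightarrow> (\<forall>c. lc bs c = 0 \<longrightarrow> (\<forall>i<length bs. c i = 0))"
proof (induction bs)
  case Nil
  then show ?case using independent_empty by (auto simp: free_def)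
next
  case (Cons b bs)
  show ?case
  proof (intro iffI allI impI)
    fix c i assume f: "free (b # bs)" and c: "lc (b # bs) c = 0" and i: "i < length (b # bs)"
    have "c 0 = 0"
    proof (rule ccontr)
      assume n: "c 0 \<noteq> 0"
      have "lc bs (\<lambda>i. c (Suc i)) \<in> span (set bs)" using span_list by auto
      moreover have "b = (- inverse (c 0)) *s lc bs (\<lambda>i. c (Suc i))"
      proof -
        have "lc bs (\<lambda>i. c (Suc i)) = - (c 0 *s b)" using c
          by (simp add: lc_Cons eq_neg_iff_add_eq_0 add.commute)
        then show ?thesis using n by simp
      qed
      ultimately have "b \<in> span (set bs)" by (metis span_scale)
      then show False using f by (simp add: free_Cons)
    qed
    moreover have "\<forall>i<length bs. c (Suc i) = 0"
    proof -
      have "lc bs (\<lambda>i. c (Suc i)) = 0" using c \<open>c 0 = 0\<close> by (simp add: lc_Cons)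
      then show ?thesis using f Cons free_Cons by blast
    qed
    ultimately show "c i = 0" using i by (cases i) auto
  next
    assume *: "\<forall>c. lc (b # bs) c = 0 \<longrightarrow> (\<forall>i<length (b # bs). c i = 0)"
    have "b \<notin> span (set bs)"
    proof
      assume "b \<in> span (set bs)"
      then obtain c where "b = lc bs c" using span_list by auto
      moreover have "lc bs (\<lambda>i. - c i) = - lc bs c" by (simp add: lc_def sum_negf)
      ultimately have "lc (b # bs) (case_nat 1 (\<lambda>i. - c i)) = 0" by (simp add: lc_Cons)
      then have "(case_nat 1 (\<lambda>i. - c i) 0 :: 'a) = 0" using * by (metis length_Cons zero_less_Suc)
      then show False by simp
    qed
    moreover have "\<forall>c. lc bs c = 0 \<longrightarrow> (\<forall>i<length bs. c i = 0)"
    proof (intro allI impI)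
      fix c i assume "lc bs c = 0" "i < length bs"
      then have "lc (b # bs) (case_nat 0 c) = 0" by (simp add: lc_Cons)
      then have "case_nat 0 c (Suc i) = 0" using * \<open>i < length bs\<close> by (metis length_Cons Suc_less_eq)
      then show "c i = 0" by simp
    qed
    ultimately show "free (b # bs)" using Cons free_Cons by blast
  qed
qed

lemma free_append:
  "free (bs @ cs) \<longleftrightarrow> free bs \<and> free cs \<and> span (set bs) \<inter> span (set cs) = {0}"
proof (induction bs)
  case Nil
  then show ?case using independent_empty by (auto simp: free_def span_zero)
next
  case (Cons b bs)
  let ?B = "span (set bs)" and ?C = "span (set cs)"
  have eq: "b \<notin> ?B + ?C \<and> ?B \<inter> ?C = {0} \<longleftrightarrow> b \<notin> ?B \<and> span (set (b # bs)) \<inter> ?C = {0}"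
    (is "?L \<longleftrightarrow> ?R")
  proof
    assume L: ?L
    have "b \<notin> ?B" using L set_plus_intro[of b ?B 0 ?C] span_zero by auto
    moreover have "x = 0" if x: "x \<in> span (set (b # bs))" "x \<in> ?C" for x
    proof -
      obtain k where k: "x - k *s b \<in> ?B" using x by (auto simp: span_insert)
      have "k = 0"
      proof (rule ccontr)
        assume "k \<noteq> 0"
        then have "b = inverse k *s (- (x - k *s b)) + inverse k *s x"
          by (simp add: scale_right_diff_distrib)
        moreover have "inverse k *s (- (x - k *s b)) \<in> ?B" using k by (intro span_scale span_neg)
        moreover have "inverse k *s x \<in> ?C" using x by (intro span_scale)
        ultimately show False using L set_plus_intro by metis
      qed
      then show "x = 0" using k x L by auto
    qed
    ultimately show ?R using span_zero by auto
  next
    assume R: ?R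
    have sub: "?B \<subseteq> span (set (b # bs))" by (rule span_mono) auto
    then have "?B \<inter> ?C = {0}" using R span_zero by auto
    moreover have "b \<notin> ?B + ?C"
    proof
      assume "b \<in> ?B + ?C"
      then obtain x y where xy: "x \<in> ?B" "y \<in> ?C" "b = x + y" by (auto elim: set_plus_elim)
      then have "y = b - x" by simp
      moreover have "b - x \<in> span (set (b # bs))"
        using xy sub span_base[of b "set (b # bs)"] by (intro span_diff) auto
      ultimately have "y = 0" using R xy by auto
      then show False using xy R by auto
    qed
    ultimately show ?L by simp
  qed
  have "free ((b # bs) @ cs) \<longleftrightarrow> b \<notin> ?B + ?C \<and> ?B \<inter> ?C = {0} \<and> free bs \<and> free cs"
    using Cons by (auto simp: free_Cons span_append_set)
  then show ?case using eq unfolding free_Cons[of b bs] by blast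
qed

lemma dim_free: "free bs \<Longrightarrow> dim (span (set bs)) = length bs"
  by (auto simp: free_def dim_eq_card_independent distinct_card)

end

section \<open>Block matrices and direct sums\<close>

context fd_endo
begin

text \<open>This is \<open>represents\<close> with the whole space replaced by \<open>W\<close>,
  which allows induction over diagonal blocks. The condition on the columns implies that
  \<open>W\<close> is stable under \<open>u\<close>.\<close>

definition rep :: "'b set \<Rightarrow> 'b list \<Rightarrow> 'a mat \<Rightarrow> bool" where
  "rep W bs M \<longleftrightarrow> free bs \<and> span (set bs) = W \<and> M \<in> carrier_mat (length bs) (length bs) \<and>
    (\<forall>j<length bs. u (bs ! j) = lc bs (\<lambda>i. M $$ (i, j)))"

definition repr :: "'b set \<Rightarrow> 'a mat \<Rightarrow> bool" where
  "repr W M \<longleftrightarrow> (\<exists>bs. rep W bs M)"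

lemma represents_rep: "represents (*s) bs M u \<longleftrightarrow> rep UNIV bs M"
  by (auto simp: represents_def rep_def free_def lc_def)

lemma dim_rep: "rep W bs M \<Longrightarrow> dim W = length bs"
  using dim_free rep_def by auto

lemma columns_append_iff:
  assumes A: "A \<in> carrier_mat (length bs) (length bs)"
    and B: "B \<in> carrier_mat (length cs) (length cs)"
  defines "F \<equiv> four_block_mat A (0\<^sub>m (length bs) (length cs)) (0\<^sub>m (length cs) (length bs)) B"
  shows "(\<forall>j<length (bs @ cs). u ((bs @ cs) ! j) = lc (bs @ cs) (\<lambda>i. F $$ (i, j))) \<longleftrightarrow>
    (\<forall>j<length bs. u (bs ! j) = lc bs (\<lambda>i. A $$ (i, j))) \<and>
    (\<forall>j<length cs. u (cs ! j) = lc cs (\<lambda>i. B $$ (i, j)))"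
proof -
  let ?n = "length bs" and ?m = "length cs"
  have l0: "lc ds (\<lambda>i. 0) = 0" for ds by (simp add: lc_def)
  have F1: "lc (bs @ cs) (\<lambda>i. F $$ (i, j)) = lc bs (\<lambda>i. A $$ (i, j))" if "j < ?n" for j
  proof -
    have "lc bs (\<lambda>i. F $$ (i, j)) = lc bs (\<lambda>i. A $$ (i, j))"
      using A B that by (intro lc_cong) (simp add: F_def)
    moreover have "lc cs (\<lambda>i. F $$ (i + ?n, j)) = lc cs (\<lambda>i. 0)"
      using A B that by (intro lc_cong) (simp add: F_def)
    ultimately show ?thesis by (simp add: lc_append l0)
  qed
  have F2: "lc (bs @ cs) (\<lambda>i. F $$ (i, j + ?n)) = lc cs (\<lambda>i. B $$ (i, j))" if "j < ?m" for j
  proof -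
    have "lc bs (\<lambda>i. F $$ (i, j + ?n)) = lc bs (\<lambda>i. 0)"
      using A B that by (intro lc_cong) (simp add: F_def)
    moreover have "lc cs (\<lambda>i. F $$ (i + ?n, j + ?n)) = lc cs (\<lambda>i. B $$ (i, j))"
      using A B that by (intro lc_cong) (simp add: F_def)
    ultimately show ?thesis by (simp add: lc_append l0)
  qed
  have "(\<forall>j<?n + ?m. P j) \<longleftrightarrow> (\<forall>j<?n. P j) \<and> (\<forall>j<?m. P (j + ?n))" for P
  proof (intro iffI conjI allI impI)
    fix j assume P: "(\<forall>j<?n. P j) \<and> (\<forall>j<?m. P (j + ?n))" and j: "j < ?n + ?m"
    show "P j"
    proof (cases "j < ?n")
      case False
      then have "j - ?n < ?m" using j by simp
      then have "P ((j - ?n) + ?n)" using P by blast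
      then show ?thesis using False by simp
    qed (use P in auto)
  qed auto
  then show ?thesis using F1 F2 by (simp add: nth_append)
qed

text \<open>The basis is cut after \<open>dim_row M\<close> vectors. Squareness is stated on the
  left because a square block-diagonal matrix can have rectangular blocks, whereas
  \<open>repr\<close> on the right includes it.\<close>

lemma repr_diag_block_Cons:
  "repr W (diag_block_mat (M # Ms)) \<and> dim_row M = dim_col M \<and>
     dim_row (diag_block_mat Ms) = dim_col (diag_block_mat Ms) \<longleftrightarrow>
   (\<exists>W1 W2. repr W1 M \<and> repr W2 (diag_block_mat Ms) \<and> W1 \<inter> W2 = {0} \<and> W = W1 + W2)"
  (is "?L \<longleftrightarrow> ?R")
proof
  let ?D = "diag_block_mat Ms"
  assume L: ?L
  then obtain bs where bs: "rep W bs (diag_block_mat (M # Ms))" unfolding repr_def by auto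
  define xs ys where "xs = take (dim_row M) bs" and "ys = drop (dim_row M) bs"
  have len: "length bs = dim_row M + dim_row ?D"
    using bs L by (auto simp: rep_def Let_def)
  have xy: "bs = xs @ ys" "length xs = dim_row M" "length ys = dim_row ?D"
    using len by (auto simp: xs_def ys_def)
  have car: "M \<in> carrier_mat (length xs) (length xs)" "?D \<in> carrier_mat (length ys) (length ys)"
    using L xy by auto
  have D: "diag_block_mat (M # Ms) =
    four_block_mat M (0\<^sub>m (length xs) (length ys)) (0\<^sub>m (length ys) (length xs)) ?D"
    using L xy by (simp add: Let_def)
  have "rep (span (set xs)) xs M" "rep (span (set ys)) ys ?D"
    using bs columns_append_iff[OF car] car unfolding rep_def D xy(1) free_append by blast+
  moreover have "span (set xs) \<inter> span (set ys) = {0}" "W = span (set xs) + span (set ys)"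
    using bs unfolding rep_def xy(1) free_append set_append span_append_set by blast+
  ultimately show ?R unfolding repr_def by blast
next
  let ?D = "diag_block_mat Ms"
  assume ?R
  then obtain W1 W2 xs ys where *: "rep W1 xs M" "rep W2 ys ?D" "W1 \<inter> W2 = {0}" "W = W1 + W2"
    unfolding repr_def by blast
  have car: "M \<in> carrier_mat (length xs) (length xs)" "?D \<in> carrier_mat (length ys) (length ys)"
    using * by (auto simp: rep_def)
  have D: "diag_block_mat (M # Ms) =
    four_block_mat M (0\<^sub>m (length xs) (length ys)) (0\<^sub>m (length ys) (length xs)) ?D"
    using car by (auto simp: Let_def)
  have "free (xs @ ys)" "span (set (xs @ ys)) = W"
    using * unfolding rep_def free_append set_append span_append_set by auto
  moreover have "diag_block_mat (M # Ms) \<in> carrier_mat (length (xs @ ys)) (length (xs @ ys))"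
    using car unfolding D by simp
  moreover have "\<forall>j<length (xs @ ys).
    u ((xs @ ys) ! j) = lc (xs @ ys) (\<lambda>i. diag_block_mat (M # Ms) $$ (i, j))"
    using * columns_append_iff[OF car] unfolding D rep_def by blast
  ultimately have "rep W (xs @ ys) (diag_block_mat (M # Ms))" unfolding rep_def by blast
  then show ?L using car unfolding repr_def by auto
qed

lemma repr_empty: "repr W (0\<^sub>m 0 0) \<longleftrightarrow> W = {0}"
proof -
  have "free []" by (auto simp: free_iff)
  then show ?thesis by (auto simp: repr_def rep_def)
qed

lemma square_diag_block:
  "\<forall>M\<in>set Ms. dim_row M = dim_col M \<Longrightarrow> dim_row (diag_block_mat Ms) = dim_col (diag_block_mat Ms)"
  by (induction Ms) (auto simp: Let_def)

text \<open>\<open>dsum\<close> recurses in the same way as \<open>diag_block_mat\<close>, so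
  diagonal blocks and direct summands are matched one by one.\<close>

lemma repr_diag_block:
  assumes "\<forall>M\<in>set Ms. dim_row M = dim_col M"
  shows "repr W (diag_block_mat Ms) \<longleftrightarrow> (\<exists>Ws. dsum W Ws \<and> list_all2 repr Ws Ms)"
  using assms
proof (induction Ms arbitrary: W)
  case Nil
  then show ?case by (auto simp: repr_empty)
next
  case (Cons M Ms)
  have "repr W (diag_block_mat (M # Ms)) \<longleftrightarrow>
     (\<exists>W1 W2. repr W1 M \<and> repr W2 (diag_block_mat Ms) \<and> W1 \<inter> W2 = {0} \<and> W = W1 + W2)"
    using repr_diag_block_Cons[of W M Ms] Cons.prems square_diag_block[of Ms] by auto
  also have "\<dots> \<longleftrightarrow> (\<exists>W1 W2 Ws. repr W1 M \<and> dsum W2 Ws \<and> list_all2 repr Ws Ms \<and>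
      W1 \<inter> W2 = {0} \<and> W = W1 + W2)"
    using Cons by auto
  also have "\<dots> \<longleftrightarrow> (\<exists>Ws. dsum W Ws \<and> list_all2 repr Ws (M # Ms))"
    unfolding list_all2_Cons2
  proof (intro iffI; elim exE conjE)
    fix W1 W2 Ws
    assume "repr W1 M" "dsum W2 Ws" "list_all2 repr Ws Ms" "W1 \<inter> W2 = {0}" "W = W1 + W2"
    then have "dsum W (W1 # Ws)" by auto
    then show "\<exists>Vs. dsum W Vs \<and> (\<exists>z zs. Vs = z # zs \<and> repr z M \<and> list_all2 repr zs Ms)"
      using \<open>repr W1 M\<close> \<open>list_all2 repr Ws Ms\<close> by blast
  next
    fix Vs z zs
    assume *: "dsum W Vs" "Vs = z # zs" "repr z M" "list_all2 repr zs Ms"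
    then obtain W' where "dsum W' zs" "z \<inter> W' = {0}" "W = z + W'" by auto
    then show "\<exists>W1 W2 Ws. repr W1 M \<and> dsum W2 Ws \<and> list_all2 repr Ws Ms \<and>
      W1 \<inter> W2 = {0} \<and> W = W1 + W2"
      using * by blast
  qed
  finally show ?case .
qed

definition krylov :: "'b \<Rightarrow> nat \<Rightarrow> 'b list" where
  "krylov e n = map (\<lambda>j. (u ^^ j) e) [0..<n]"

lemma length_krylov: "length (krylov e n) = n"
  by (simp add: krylov_def)

lemma nth_krylov: "j < n \<Longrightarrow> krylov e n ! j = (u ^^ j) e"
  by (simp add: krylov_def)

lemma act_krylov: "h = 0 \<or> degree h < n \<Longrightarrow> act h e = lc (krylov e n) (coeff h)"
proof (cases n)
  case (Suc m)
  assume "h = 0 \<or> degree h < n"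
  then have "degree h \<le> m" using Suc by auto
  then show ?thesis
    using act_bound[of h m e] by (simp add: lc_def krylov_def Suc lessThan_Suc_atMost del: upt_Suc)
qed (simp add: lc_def krylov_def act_zero)

lemma lc_krylov:
  obtains h where "h = 0 \<or> degree h < n" "lc (krylov e n) c = act h e"
    "\<And>i. i < n \<Longrightarrow> coeff h i = c i"
proof -
  define h where "h = (\<Sum>i<n. monom (c i) i)"
  have co: "coeff h i = (if i < n then c i else 0)" for i
    by (simp add: h_def coeff_sum if_distrib cong: if_cong)
  have deg: "h = 0 \<or> degree h < n"
  proof (rule ccontr)
    assume "\<not> ?thesis"
    then show False using co[of "degree h"] by auto
  qed
  have "lc (krylov e n) (coeff h) = lc (krylov e n) c"
    by (intro lc_cong) (simp add: co length_krylov)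
  then show thesis using that[OF deg] act_krylov[OF deg, of e] co by simp
qed

lemma act_mod: "act r e = 0 \<Longrightarrow> act h e = act (h mod r) e"
  using act_add_left[of "h div r * r" "h mod r" e] pm.scale_dvd_zero[of r e "h div r * r"] by simp

lemma span_krylov:
  assumes "r \<noteq> 0" "act r e = 0"
  shows "span (set (krylov e (degree r))) = pm.span {e}"
proof -
  have "x \<in> range (lc (krylov e (degree r))) \<longleftrightarrow> x \<in> pm.span {e}" for x
  proof
    assume "x \<in> range (lc (krylov e (degree r)))"
    then obtain c where "x = lc (krylov e (degree r)) c" by auto
    then show "x \<in> pm.span {e}" using lc_krylov[of "degree r" e c] by (metis pm.span_singleton rangeI)
  next
    assume "x \<in> pm.span {e}"
    then obtain h where "x = act h e" by (auto simp: pm.span_singleton)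
    then have "x = act (h mod r) e" using act_mod[OF assms(2), of h] by simp
    then show "x \<in> range (lc (krylov e (degree r)))"
      using act_krylov[of "h mod r" "degree r" e] degree_mod_less[OF assms(1), of h] by blast
  qed
  then show ?thesis unfolding span_list by blast
qed

text \<open>A combination of the Krylov vectors is a polynomial of degree less than
  \<open>degree r\<close> applied to \<open>e\<close>, so independence says that none of these but 0
  kills \<open>e\<close>. Division by \<open>r\<close> reduces the other polynomials to this
  case.\<close>

lemma annihilator_iff_free:
  assumes r: "r \<noteq> 0"
  shows "pm.annihilator e r \<longleftrightarrow> act r e = 0 \<and> free (krylov e (degree r))"
proof (intro iffI conjI)
  assume ann: "pm.annihilator e r"
  then show "act r e = 0" using pm.annihilatorD by auto
  show "free (krylov e (degree r))"
    unfolding free_iff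
  proof (intro allI impI)
    fix c i assume z: "lc (krylov e (degree r)) c = 0" and i: "i < length (krylov e (degree r))"
    obtain h where h: "h = 0 \<or> degree h < degree r" "lc (krylov e (degree r)) c = act h e"
      "\<And>i. i < degree r \<Longrightarrow> coeff h i = c i"
      using lc_krylov by blast
    then have "r dvd h" using z pm.annihilatorD[OF ann] by simp
    then have "h = 0" using h(1) dvd_imp_degree_le[of r h] by linarith
    then show "c i = 0" using h(3)[of i] i by (simp add: length_krylov)
  qed
next
  assume a: "act r e = 0 \<and> free (krylov e (degree r))"
  show "pm.annihilator e r"
    unfolding pm.annihilator_def
  proof (intro allI iffI)
    fix h assume "act h e = 0"
    then have z: "act (h mod r) e = 0" using act_mod[of r e h] a by simp
    have d: "h mod r = 0 \<or> degree (h mod r) < degree r" using degree_mod_less[OF r] .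
    then have "\<forall>i<degree r. coeff (h mod r) i = 0"
      using a z act_krylov[OF d, of e] unfolding free_iff length_krylov by metis
    then have "h mod r = 0" using d by (metis leading_coeff_0_iff)
    then show "r dvd h" by auto
  next
    fix h assume "r dvd h"
    then show "act h e = 0" using a pm.scale_dvd_zero by blast
  qed
qed

text \<open>All columns but the last say that the basis is the Krylov sequence of its first vector.
  Given this, the last column says that \<open>r\<close> kills that vector.\<close>

lemma companion_columns_iff:
  assumes r: "lead_coeff r = 1" and len: "length bs = degree r" and n: "degree r > 0"
  shows "(\<forall>j<length bs. u (bs ! j) = lc bs (\<lambda>i. companion_mat r $$ (i, j))) \<longleftrightarrow>
    bs = krylov (bs ! 0) (degree r) \<and> act r (bs ! 0) = 0"
proof -
  let ?n = "degree r" and ?e = "bs ! 0"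
  have col: "lc bs (\<lambda>i. companion_mat r $$ (i, j)) = bs ! Suc j" if "Suc j < ?n" for j
  proof -
    have "lc bs (\<lambda>i. companion_mat r $$ (i, j)) = (\<Sum>i<?n. (if i = Suc j then 1 else 0) *s bs ! i)"
      unfolding lc_def len using that by (intro sum.cong) (auto simp: companion_mat_def)
    also have "\<dots> = bs ! Suc j"
      using that by (simp add: if_distrib[of "\<lambda>c. c *s _"] cong: if_cong)
    finally show ?thesis .
  qed
  have last: "lc bs (\<lambda>i. companion_mat r $$ (i, ?n - 1)) = - lc bs (coeff r)"
    unfolding lc_def len sum_negf[symmetric] using n
    by (intro sum.cong) (auto simp: companion_mat_def)
  have act: "act r ?e = lc bs (coeff r) + (u ^^ ?n) ?e" if "bs = krylov ?e ?n"
  proof -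
    have "act r ?e = (\<Sum>i<Suc ?n. coeff r i *s (u ^^ i) ?e)"
      unfolding act_def poly_endo_def lessThan_Suc_atMost ..
    also have "\<dots> = (\<Sum>i<?n. coeff r i *s (u ^^ i) ?e) + (u ^^ ?n) ?e" using r by simp
    also have "(\<Sum>i<?n. coeff r i *s (u ^^ i) ?e) = lc bs (coeff r)"
      unfolding lc_def len
    proof (intro sum.cong refl)
      fix i assume "i \<in> {..<?n}"
      then have "krylov ?e ?n ! i = (u ^^ i) ?e" by (simp add: krylov_def)
      then show "coeff r i *s (u ^^ i) ?e = coeff r i *s bs ! i" using that by metis
    qed
    finally show ?thesis .
  qed
  have kr: "bs = krylov ?e ?n \<longleftrightarrow> (\<forall>j. Suc j < ?n \<longrightarrow> u (bs ! j) = bs ! Suc j)"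
  proof
    assume k: "bs = krylov ?e ?n"
    have nth: "bs ! j = (u ^^ j) ?e" if "j < ?n" for j
    proof -
      have "krylov ?e ?n ! j = (u ^^ j) ?e" using that by (simp add: krylov_def)
      then show ?thesis using k by metis
    qed
    show "\<forall>j. Suc j < ?n \<longrightarrow> u (bs ! j) = bs ! Suc j"
    proof (intro allI impI)
      fix j assume "Suc j < ?n"
      then show "u (bs ! j) = bs ! Suc j" using nth[of "Suc j"] nth[of j]
        by (simp only: Suc_lessD funpow.simps o_apply)
    qed
  next
    assume s: "\<forall>j. Suc j < ?n \<longrightarrow> u (bs ! j) = bs ! Suc j"
    have nth: "j < ?n \<longrightarrow> bs ! j = (u ^^ j) ?e" for j
    proof (induction j)
      case (Suc j)
      show ?case
      proof
        assume j: "Suc j < ?n"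
        then have "bs ! Suc j = u (bs ! j)" using s by simp
        then show "bs ! Suc j = (u ^^ Suc j) ?e" using Suc j by simp
      qed
    qed simp
    show "bs = krylov ?e ?n"
    proof (rule nth_equalityI)
      fix j assume "j < length bs"
      then have "j < ?n" using len by simp
      then show "bs ! j = krylov ?e ?n ! j" by (intro trans[OF mp[OF nth] nth_krylov[symmetric]])
    qed (simp add: len length_krylov)
  qed
  have split: "(\<forall>j<?n. P j) \<longleftrightarrow> (\<forall>j. Suc j < ?n \<longrightarrow> P j) \<and> P (?n - 1)" for P
  proof (intro iffI conjI allI impI)
    fix j assume P: "(\<forall>j. Suc j < ?n \<longrightarrow> P j) \<and> P (?n - 1)" and j: "j < ?n"
    show "P j"
    proof (cases "Suc j < ?n")
      case False
      then have "j = ?n - 1" using j by simp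
      then show ?thesis using P by blast
    qed (use P in blast)
  qed (use n in auto)
  have "(\<forall>j<length bs. u (bs ! j) = lc bs (\<lambda>i. companion_mat r $$ (i, j))) \<longleftrightarrow>
    bs = krylov ?e ?n \<and> u (bs ! (?n - 1)) = - lc bs (coeff r)"
    unfolding len split kr using col last by auto
  also have "\<dots> \<longleftrightarrow> bs = krylov ?e ?n \<and> act r ?e = 0"
  proof (rule conj_cong[OF refl])
    assume k: "bs = krylov ?e ?n"
    have "krylov ?e ?n ! (?n - 1) = (u ^^ (?n - 1)) ?e" using n by (simp add: krylov_def)
    then have "bs ! (?n - 1) = (u ^^ (?n - 1)) ?e" using k by metis
    moreover have "u ((u ^^ (?n - 1)) ?e) = (u ^^ Suc (?n - 1)) ?e" by simp
    ultimately have "u (bs ! (?n - 1)) = (u ^^ ?n) ?e" using n by (metis Suc_diff_1)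
    then show "(u (bs ! (?n - 1)) = - lc bs (coeff r)) \<longleftrightarrow> act r ?e = 0"
      unfolding act[OF k] by (auto simp: eq_neg_iff_add_eq_0 add.commute)
  qed
  finally show ?thesis .
qed

lemma pm_span_zero: "pm.span {0} = {0}"
  by (auto simp: pm.span_singleton act_add_right pm.scale_zero_right)

lemma repr_companion:
  assumes r: "lead_coeff r = 1"
  shows "repr W (companion_mat r) \<longleftrightarrow> (\<exists>e. pm.annihilator e r \<and> W = pm.span {e})"
proof (cases "degree r = 0")
  \<comment> \<open>Degree 0 forces \<open>r = 1\<close>: the matrix is empty and the generator is
    the zero vector.\<close>
  case True
  then have r1: "r = 1" using r by (auto elim!: degree_eq_zeroE simp: one_pCons)
  have "companion_mat r = 0\<^sub>m 0 0" using True by (auto simp: companion_mat_def)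
  moreover have "pm.annihilator e 1 \<longleftrightarrow> e = 0" for e
    unfolding pm.annihilator_def by (auto simp: pm.scale_zero_right) (metis act_one)
  ultimately show ?thesis using pm_span_zero repr_empty[of W] r1 by metis
next
  case False
  then have n: "degree r > 0" and r0: "r \<noteq> 0" by auto
  have car: "companion_mat r \<in> carrier_mat (degree r) (degree r)" by (simp add: companion_mat_def)
  show ?thesis
  proof
    assume "repr W (companion_mat r)"
    then obtain bs where bs: "rep W bs (companion_mat r)" unfolding repr_def by blast
    then have len: "length bs = degree r" using car by (auto simp: rep_def)
    have k: "bs = krylov (bs ! 0) (degree r)" "act r (bs ! 0) = 0"
      using companion_columns_iff[OF r len n] bs unfolding rep_def by blast+
    have "pm.annihilator (bs ! 0) r" using annihilator_iff_free[OF r0] k bs rep_def by metis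
    moreover have "W = pm.span {bs ! 0}" using span_krylov[OF r0 k(2)] k(1) bs rep_def by metis
    ultimately show "\<exists>e. pm.annihilator e r \<and> W = pm.span {e}" by blast
  next
    assume "\<exists>e. pm.annihilator e r \<and> W = pm.span {e}"
    then obtain e where e: "act r e = 0" "free (krylov e (degree r))" "W = pm.span {e}"
      using annihilator_iff_free[OF r0] by blast
    let ?bs = "krylov e (degree r)"
    have 0: "?bs ! 0 = e" using n by (simp add: krylov_def)
    have "\<forall>j<length ?bs. u (?bs ! j) = lc ?bs (\<lambda>i. companion_mat r $$ (i, j))"
      using companion_columns_iff[OF r length_krylov n, of e] 0 e by simp
    then have "rep W ?bs (companion_mat r)"
      using e span_krylov[OF r0] car by (simp add: rep_def length_krylov)
    then show "repr W (companion_mat r)" unfolding repr_def by blast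
  qed
qed

lemma dim_cyclic:
  assumes "lead_coeff r = 1" "pm.annihilator e r"
  shows "dim (pm.span {e}) = degree r"
proof -
  obtain bs where bs: "rep (pm.span {e}) bs (companion_mat r)"
    using repr_companion[OF assms(1)] assms(2) repr_def by blast
  then have "length bs = degree r" by (auto simp: rep_def companion_mat_def)
  then show ?thesis using dim_rep[OF bs] by simp
qed

text \<open>A Krylov sequence longer than the dimension is dependent, and a dependence relation is a
  polynomial that kills \<open>v\<close>.\<close>

lemma torsion: "\<exists>h. h \<noteq> 0 \<and> act h v = 0"
proof -
  let ?n = "Suc dimension"
  have "\<not> free (krylov v ?n)"
  proof
    assume "free (krylov v ?n)"
    then have "dim (span (set (krylov v ?n))) = ?n" using dim_free length_krylov by simp
    then show False using dim_subset_UNIV[of "span (set (krylov v ?n))"] by simp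
  qed
  then obtain c i where c: "lc (krylov v ?n) c = 0" "i < ?n" "c i \<noteq> 0"
    unfolding free_iff length_krylov by blast
  obtain h where "lc (krylov v ?n) c = act h v" "\<And>i. i < ?n \<Longrightarrow> coeff h i = c i"
    using lc_krylov by blast
  then have "act h v = 0" "coeff h i \<noteq> 0" using c by auto
  then show ?thesis by (metis coeff_0)
qed

end

section \<open>Jordan numbers and invariant factors\<close>

text \<open>Since \<open>q\<close> does not vanish at \<open>c\<close>, it is coprime to
  \<open>[:- c, 1:]\<close>; the linear factors are cancelled one at a time.\<close>

lemma dvd_linear_power_mult_cancel:
  fixes q g :: "'a::field poly"
  assumes "poly q c \<noteq> 0" "q dvd [:- c, 1:] ^ k * g"
  shows "q dvd g"
  using assms(2)
proof (induction k)
  case (Suc k)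
  define l where "l = [:- c, 1:]"
  have l: "l \<noteq> 0" "poly l c = 0" by (simp_all add: l_def)
  have "q dvd l * (l ^ k * g)" using Suc.prems by (simp only: l_def power_Suc mult.assoc)
  then obtain s where s: "l * (l ^ k * g) = q * s" by (elim dvdE)
  have "poly (l * (l ^ k * g)) c = 0" using l by simp
  then have "poly s c = 0" using assms(1) unfolding s by simp
  then have "l dvd s" by (simp add: poly_eq_0_iff_dvd l_def)
  then obtain t where "s = l * t" by (elim dvdE)
  then have "l * (l ^ k * g) = l * (q * t)" using s by (simp add: mult.left_commute)
  then have "l ^ k * g = q * t" using l by simp
  then show ?case using Suc.IH unfolding l_def by simp
qed simp

lemma order_factorization:
  fixes r :: "'a::field poly"
  assumes "r \<noteq> 0"
  obtains q where "r = [:- c, 1:] ^ order c r * q" "poly q c \<noteq> 0"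
  using order_decomp[OF assms, of c] by (auto simp: poly_eq_0_iff_dvd)

text \<open>After the powers of both linear factors are split off from \<open>r\<close>, the rest
  \<open>s\<close> is coprime to them and divides their product, hence is constant, and comparison
  of leading coefficients gives \<open>s = 1\<close>.\<close>

lemma monic_dvd_linear_powers:
  fixes r :: "'a::field poly"
  assumes r: "lead_coeff r = 1" and dvd: "r dvd [:- a, 1:] ^ k * [:- b, 1:] ^ l"
  shows "\<exists>m n. r = [:- a, 1:] ^ m * [:- b, 1:] ^ n"
proof -
  have r0: "r \<noteq> 0" using r by auto
  obtain q where q: "r = [:- a, 1:] ^ order a r * q" "poly q a \<noteq> 0"
    using order_factorization[OF r0] .
  then have q0: "q \<noteq> 0" by auto
  obtain s where s: "q = [:- b, 1:] ^ order b q * s" "poly s b \<noteq> 0"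
    using order_factorization[OF q0] .
  have "q dvd r" using q(1) by (metis dvd_triv_right)
  then have "q dvd [:- a, 1:] ^ k * [:- b, 1:] ^ l" using dvd dvd_trans by blast
  then have "q dvd [:- b, 1:] ^ l" by (rule dvd_linear_power_mult_cancel[OF q(2)])
  moreover have "s dvd q" using s(1) by (metis dvd_triv_right)
  ultimately have "s dvd [:- b, 1:] ^ l * 1" using dvd_trans by simp
  then have "s dvd 1" by (rule dvd_linear_power_mult_cancel[OF s(2)])
  then have "degree s = 0" by (auto simp: is_unit_iff_degree)
  then obtain c where c: "s = [:c:]" by (rule degree_eq_zeroE)
  have lead: "lead_coeff ([:- x, 1:] ^ i * p) = lead_coeff p" for x :: 'a and i p
    by (simp add: lead_coeff_mult lead_coeff_power)
  have "lead_coeff r = lead_coeff q" using lead[of a "order a r" q] q(1) by simp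
  also have "\<dots> = lead_coeff s" using lead[of b "order b q" s] s(1) by simp
  finally have "s = 1" using r c by (simp add: one_pCons)
  then show ?thesis using q(1) s(1) by (metis mult.right_neutral)
qed

lemma order_linear_powers:
  fixes a b :: "'a::field"
  assumes "a \<noteq> b"
  shows "order a ([:- a, 1:] ^ m * [:- b, 1:] ^ n) = m"
    and "order b ([:- a, 1:] ^ m * [:- b, 1:] ^ n) = n"
proof -
  have nz: "[:- a, 1:] ^ m * [:- b, 1:] ^ n \<noteq> 0" by simp
  have "order a ([:- b, 1:] ^ n) = 0" "order b ([:- a, 1:] ^ m) = 0"
    using assms by (auto intro!: order_0I)
  then show "order a ([:- a, 1:] ^ m * [:- b, 1:] ^ n) = m"
    "order b ([:- a, 1:] ^ m * [:- b, 1:] ^ n) = n"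
    unfolding order_mult[OF nz] by (simp_all add: order_power_n_n)
qed

text \<open>\<open>[:- c, 1:] ^ j\<close> is the greatest common divisor of \<open>r\<close> and
  \<open>[:- c, 1:] ^ k\<close>. Once it is cancelled, what remains of \<open>r\<close> is coprime
  to what remains of the power.\<close>

lemma dvd_linear_power_mult_iff:
  fixes r :: "'a::field poly" and c :: 'a and k :: nat
  assumes r: "r \<noteq> 0"
  defines "j \<equiv> min k (order c r)"
  shows "r = [:- c, 1:] ^ j * (r div [:- c, 1:] ^ j)"
    and "r dvd [:- c, 1:] ^ k * g \<longleftrightarrow> r div [:- c, 1:] ^ j dvd g"
proof -
  define l m where "l = [:- c, 1:]" and "m = order c r"
  have l0: "l \<noteq> 0" by (simp add: l_def)
  obtain q where q: "r = l ^ m * q" "poly q c \<noteq> 0"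
    using order_factorization[OF r] unfolding l_def m_def .
  have jm: "j \<le> m" "j \<le> k" by (simp_all add: j_def m_def)
  have r_eq: "r = l ^ j * (l ^ (m - j) * q)"
    using jm q(1) by (simp add: power_add[symmetric] mult.assoc[symmetric])
  then have div: "r div l ^ j = l ^ (m - j) * q" using l0 by simp
  show "r = [:- c, 1:] ^ j * (r div [:- c, 1:] ^ j)"
    using r_eq div unfolding l_def by simp
  have "l ^ k = l ^ j * l ^ (k - j)" using jm by (simp add: power_add[symmetric])
  then have "r dvd l ^ k * g \<longleftrightarrow> l ^ j * (l ^ (m - j) * q) dvd l ^ j * (l ^ (k - j) * g)"
    using r_eq by (simp add: mult.assoc)
  also have "\<dots> \<longleftrightarrow> l ^ (m - j) * q dvd l ^ (k - j) * g" using l0 by simp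
  also have "\<dots> \<longleftrightarrow> l ^ (m - j) * q dvd g"
  proof (cases "k \<le> m")
    case True
    then show ?thesis by (simp add: j_def m_def)
  next
    case False
    then have "m - j = 0" by (simp add: j_def m_def)
    then show ?thesis using dvd_linear_power_mult_cancel[OF q(2), of "k - j" g] by (auto simp: l_def)
  qed
  finally show "r dvd [:- c, 1:] ^ k * g \<longleftrightarrow> r div [:- c, 1:] ^ j dvd g"
    unfolding div[unfolded l_def] l_def .
qed

context fd_endo
begin

definition kernel :: "'a poly \<Rightarrow> 'b set" where
  "kernel h = {v. act h v = 0}"

lemma pm_subspace_kernel: "pm.subspace (kernel h)"
  unfolding kernel_def
  by (rule pm.subspaceI)
    (simp_all add: act_add_right act_mult[symmetric] mult.commute[of h] del: mult_pCons_left,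
      simp_all add: act_mult pm.scale_zero_right)

text \<open>In the polynomial ring modulo \<open>r\<close>, the kernel of multiplication by a
  polynomial is generated by \<open>r\<close> divided by the greatest common divisor of the two, and
  that divisor annihilates the generator. Here the divisor is \<open>[:- c, 1:] ^ j\<close>.\<close>

lemma kernel_cyclic:
  fixes c :: 'a and k :: nat
  assumes r: "r \<noteq> 0" and e: "pm.annihilator e r"
  defines "j \<equiv> min k (order c r)"
  shows "pm.annihilator (act (r div [:- c, 1:] ^ j) e) ([:- c, 1:] ^ j)"
    and "pm.span {e} \<inter> kernel ([:- c, 1:] ^ k) = pm.span {act (r div [:- c, 1:] ^ j) e}"
proof -
  define l s where "l = [:- c, 1:]" and "s = r div l ^ j"
  have r': "r = l ^ j * s"
    using dvd_linear_power_mult_iff(1)[OF r, where k = k and c = c] unfolding l_def s_def j_def .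
  then have s0: "s \<noteq> 0" using r by auto
  have "act h (act s e) = 0 \<longleftrightarrow> l ^ j dvd h" for h
  proof -
    have "act h (act s e) = 0 \<longleftrightarrow> l ^ j * s dvd h * s"
      using pm.annihilatorD[OF e, of "h * s"] r' by simp
    also have "\<dots> \<longleftrightarrow> l ^ j dvd h" using s0 by simp
    finally show ?thesis .
  qed
  then show "pm.annihilator (act (r div [:- c, 1:] ^ j) e) ([:- c, 1:] ^ j)"
    unfolding pm.annihilator_def s_def l_def by blast
  have "act g e \<in> kernel (l ^ k) \<longleftrightarrow> s dvd g" for g
  proof -
    have "act g e \<in> kernel (l ^ k) \<longleftrightarrow> r dvd l ^ k * g"
      using pm.annihilatorD[OF e, of "l ^ k * g"] by (simp add: kernel_def)
    then show ?thesis
      using dvd_linear_power_mult_iff(2)[OF r, where k = k and c = c and g = g]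
      unfolding s_def j_def l_def by blast
  qed
  then have *: "x \<in> pm.span {e} \<inter> kernel (l ^ k) \<longleftrightarrow> (\<exists>g. x = act g e \<and> s dvd g)" for x
    unfolding pm.span_singleton by blast
  have **: "(\<exists>g. x = act g e \<and> s dvd g) \<longleftrightarrow> x \<in> pm.span {act s e}" for x
  proof
    assume "\<exists>g. x = act g e \<and> s dvd g"
    then obtain g where g: "x = act g e" "s dvd g" by blast
    then obtain h where "g = s * h" by (elim dvdE)
    then have "x = act h (act s e)" using g(1) by (simp add: mult.commute)
    then show "x \<in> pm.span {act s e}" unfolding pm.span_singleton by blast
  next
    assume "x \<in> pm.span {act s e}"
    then obtain h where "x = act h (act s e)" unfolding pm.span_singleton by blast
    then have "x = act (h * s) e" by simp
    then show "\<exists>g. x = act g e \<and> s dvd g" using dvd_triv_right by blast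
  qed
  have "pm.span {e} \<inter> kernel (l ^ k) = pm.span {act s e}"
    by (rule Set.set_eqI) (simp only: * **)
  then show "pm.span {e} \<inter> kernel ([:- c, 1:] ^ k) = pm.span {act (r div [:- c, 1:] ^ j) e}"
    unfolding s_def l_def .
qed

lemma free_extend:
  assumes S: "subspace S" and bs: "free bs" and sub: "span (set bs) \<subseteq> S"
  shows "\<exists>cs. free (bs @ cs) \<and> span (set (bs @ cs)) = S"
proof -
  have "set bs \<subseteq> S" using sub span_superset by blast
  moreover have "independent (set bs)" using bs free_def by blast
  ultimately obtain B where B: "set bs \<subseteq> B" "B \<subseteq> S" "independent B" "S \<subseteq> span B"
    using maximal_independent_subset_extend by blast
  have "finite (B - set bs)" using finiteI_independent[OF B(3)] by blast
  then obtain cs where cs: "set cs = B - set bs" "distinct cs"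
    using finite_distinct_list by blast
  have set: "set (bs @ cs) = B" using cs B by auto
  have "distinct (bs @ cs)" using cs bs free_def by auto
  then have "free (bs @ cs)" unfolding free_def set using B by blast
  moreover have "span B = S" using span_subspace[OF B(2) B(4) S] .
  ultimately show ?thesis using set by metis
qed

lemma subspace_free_basis:
  assumes "subspace S" shows "\<exists>bs. free bs \<and> span (set bs) = S"
proof -
  have "free []" "span (set []) \<subseteq> S" using assms by (auto simp: free_iff subspace_0)
  then show ?thesis using free_extend[OF assms] by (metis append_Nil)
qed

lemma dim_set_plus:
  assumes "subspace S" "subspace T" "S \<inter> T = {0}"
  shows "dim (S + T) = dim S + dim T"
proof -
  obtain bs cs where bs: "free bs" "span (set bs) = S" and cs: "free cs" "span (set cs) = T"
    using subspace_free_basis assms by metis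
  have "free (bs @ cs)" using bs cs assms(3) free_append by blast
  then have "dim (span (set (bs @ cs))) = length (bs @ cs)" by (rule dim_free)
  moreover have "span (set (bs @ cs)) = S + T" using bs cs by (simp only: set_append span_append_set)
  ultimately show ?thesis using dim_free[OF bs(1)] dim_free[OF cs(1)] bs(2) cs(2)
    by (simp only: length_append)
qed

lemma dsum_subspaceI: "\<forall>S\<in>set Ss. subspace S \<Longrightarrow> dsum W Ss \<Longrightarrow> subspace W"
proof (induction Ss arbitrary: W)
  case (Cons S Ss)
  then obtain W' where "dsum W' Ss" "W = S + W'" by auto
  then show ?case using Cons subspace_set_plus by auto
qed (simp add: subspace_single_0)

lemma dim_dsum: "\<forall>S\<in>set Ss. subspace S \<Longrightarrow> dsum W Ss \<Longrightarrow> dim W = sum_list (map dim Ss)"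
proof (induction Ss arbitrary: W)
  case Nil
  then show ?case by simp
next
  case (Cons S Ss)
  then obtain W' where *: "dsum W' Ss" "S \<inter> W' = {0}" "W = S + W'" by auto
  then have "subspace W'" using dsum_subspaceI Cons.prems by auto
  then have "dim W = dim S + dim W'" using * dim_set_plus Cons.prems by auto
  then show ?case using * Cons by auto
qed

lemma dsum_kernel:
  assumes "\<forall>S\<in>set Ss. pm.subspace S" "dsum W Ss"
  shows "dsum (W \<inter> kernel h) (map (\<lambda>S. S \<inter> kernel h) Ss)"
  using assms
proof (induction Ss arbitrary: W)
  case Nil
  have "0 \<in> kernel h" using pm.subspace_0[OF pm_subspace_kernel] .
  then show ?case using Nil by auto
next
  case (Cons S Ss)
  then obtain W' where *: "dsum W' Ss" "S \<inter> W' = {0}" "W = S + W'" by auto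
  have S: "pm.subspace S" and W': "pm.subspace W'"
    using Cons.prems * pm.dsum_subspace[of W' Ss] by auto
  have K: "pm.subspace (kernel h)" by (rule pm_subspace_kernel)
  have "W \<inter> kernel h = S \<inter> kernel h + W' \<inter> kernel h"
  proof (intro equalityI subsetI)
    fix x assume x: "x \<in> W \<inter> kernel h"
    then obtain s w where sw: "s \<in> S" "w \<in> W'" "x = s + w" using * by (auto elim: set_plus_elim)
    have neg: "act h s = - act h w"
      using x sw by (simp add: kernel_def act_add_right add_eq_0_iff2)
    have "act h s \<in> S" using pm.subspace_scale[OF S sw(1)] .
    moreover have "act h s \<in> W'"
      unfolding neg by (rule pm.subspace_neg[OF W' pm.subspace_scale[OF W' sw(2)]])
    ultimately have "act h s \<in> S \<inter> W'" by (rule IntI)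
    then have "act h s = 0" unfolding *(2) by (rule singletonD)
    moreover have "act h w = 0" using neg calculation by simp
    ultimately have "s \<in> kernel h" "w \<in> kernel h" by (simp_all add: kernel_def)
    then show "x \<in> S \<inter> kernel h + W' \<inter> kernel h" using sw by (auto intro: set_plus_intro)
  next
    fix x assume "x \<in> S \<inter> kernel h + W' \<inter> kernel h"
    then obtain s w where "s \<in> S" "w \<in> W'" "x = s + w" "s \<in> kernel h" "w \<in> kernel h"
      by (auto elim: set_plus_elim)
    then show "x \<in> W \<inter> kernel h" using * pm.subspace_add[OF K] by (auto intro: set_plus_intro)
  qed
  moreover have "(S \<inter> kernel h) \<inter> (W' \<inter> kernel h) = {0}"
    using * pm.subspace_0[OF K] by auto
  moreover have "dsum (W' \<inter> kernel h) (map (\<lambda>S. S \<inter> kernel h) Ss)"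
    using Cons.IH * Cons.prems by auto
  ultimately show ?case unfolding list.map dsum.simps by blast
qed

lemma ker_pow_dim_cyclic_dsum:
  assumes ds: "dsum UNIV (map (\<lambda>i. pm.span {e i}) [0..<N])"
    and ann: "\<And>i. i < N \<Longrightarrow> pm.annihilator (e i) (r i) \<and> lead_coeff (r i) = 1"
  shows "ker_pow_dim (*s) u c k = (\<Sum>i<N. min k (order c (r i)))"
proof -
  let ?K = "kernel ([:- c, 1:] ^ k)"
  have "ker_pow_dim (*s) u c k = dim (UNIV \<inter> ?K)"
    unfolding ker_pow_dim_def kernel_def funpow_linear_factor by simp
  also have "\<dots> = sum_list (map dim (map (\<lambda>S. S \<inter> ?K) (map (\<lambda>i. pm.span {e i}) [0..<N])))"
  proof (rule dim_dsum)
    show "dsum (UNIV \<inter> ?K) (map (\<lambda>S. S \<inter> ?K) (map (\<lambda>i. pm.span {e i}) [0..<N]))"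
      by (rule dsum_kernel[OF _ ds]) auto
    show "\<forall>S\<in>set (map (\<lambda>S. S \<inter> ?K) (map (\<lambda>i. pm.span {e i}) [0..<N])). subspace S"
      using pm_subspace_kernel by (auto intro!: pm_subspace_imp pm.subspace_inter)
  qed
  also have "\<dots> = (\<Sum>i<N. dim (pm.span {e i} \<inter> ?K))"
    by (simp add: o_def interv_sum_list_conv_sum_set_nat atLeast0LessThan)
  also have "\<dots> = (\<Sum>i<N. min k (order c (r i)))"
  proof (intro sum.cong refl)
    fix i assume "i \<in> {..<N}"
    then have a: "pm.annihilator (e i) (r i)" and m: "lead_coeff (r i) = 1" using ann by auto
    then have r0: "r i \<noteq> 0" by auto
    let ?j = "min k (order c (r i))"
    have "lead_coeff ([:- c, 1:] ^ ?j) = 1" by (simp add: lead_coeff_power)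
    then have "dim (pm.span {act (r i div [:- c, 1:] ^ ?j) (e i)}) = degree ([:- c, 1:] ^ ?j)"
      by (rule dim_cyclic) (rule kernel_cyclic(1)[OF r0 a])
    then show "dim (pm.span {e i} \<inter> ?K) = ?j"
      unfolding kernel_cyclic(2)[OF r0 a] by (simp add: degree_linear_power)
  qed
  finally show ?thesis .
qed

text \<open>Each summand contributes \<open>min k (order c (r i))\<close> to the kernel dimension,
  which grows by one from \<open>k - 1\<close> to \<open>k\<close> exactly if the order is at least
  \<open>k\<close>. In terms of Jordan forms, blocks at \<open>c\<close> of size at least
  \<open>k\<close> are counted.\<close>

lemma jordan_number_cyclic_dsum:
  assumes ds: "dsum UNIV (map (\<lambda>i. pm.span {e i}) [0..<N])"
    and ann: "\<And>i. i < N \<Longrightarrow> pm.annihilator (e i) (r i) \<and> lead_coeff (r i) = 1"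
    and k: "k \<ge> 1"
  shows "jordan_number (*s) u c k = card {i. i < N \<and> k \<le> order c (r i)}"
proof -
  have "(\<Sum>i<N. min k (order c (r i))) =
      (\<Sum>i<N. min (k - 1) (order c (r i)) + (if k \<le> order c (r i) then 1 else 0))"
    using k by (intro sum.cong) auto
  also have "\<dots> = (\<Sum>i<N. min (k - 1) (order c (r i))) + card {i. i < N \<and> k \<le> order c (r i)}"
    by (simp add: sum.distrib sum.If_cases lessThan_def Collect_conj_eq)
  finally have sum: "(\<Sum>i<N. min k (order c (r i))) =
    (\<Sum>i<N. min (k - 1) (order c (r i))) + card {i. i < N \<and> k \<le> order c (r i)}" .
  have dims: "ker_pow_dim (*s) u c l = (\<Sum>i<N. min l (order c (r i)))" for l
    by (rule ker_pow_dim_cyclic_dsum[OF ds]) (rule ann)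
  show ?thesis unfolding jordan_number_def dims sum by simp
qed

text \<open>Turns the definition by companion matrices into one by cyclic summands, the form in
  which invariant factors are used below.\<close>

lemma invariant_factors_iff:
  "invariant_factors (*s) u r \<longleftrightarrow> (\<forall>i. lead_coeff (r i) = 1) \<and> (\<forall>i. r (Suc i) dvd r i) \<and>
    (\<exists>N. (\<forall>i\<ge>N. r i = 1) \<and> (\<exists>e. dsum UNIV (map (\<lambda>i. pm.span {e i}) [0..<N]) \<and>
      (\<forall>i<N. pm.annihilator (e i) (r i))))"
proof -
  have key: "(\<exists>bs. represents (*s) bs (diag_block_mat (map (\<lambda>i. companion_mat (r i)) [0..<N])) u) \<longleftrightarrow>
    (\<exists>e. dsum UNIV (map (\<lambda>i. pm.span {e i}) [0..<N]) \<and> (\<forall>i<N. pm.annihilator (e i) (r i)))"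
    (is "?L \<longleftrightarrow> ?R") if m: "\<forall>i. lead_coeff (r i) = 1" for N
  proof -
    have "?L \<longleftrightarrow> repr UNIV (diag_block_mat (map (\<lambda>i. companion_mat (r i)) [0..<N]))"
      unfolding represents_rep repr_def ..
    also have "\<dots> \<longleftrightarrow> (\<exists>Ws. dsum UNIV Ws \<and> list_all2 repr Ws (map (\<lambda>i. companion_mat (r i)) [0..<N]))"
      by (rule repr_diag_block) (auto simp: companion_mat_def)
    also have "\<dots> \<longleftrightarrow> ?R"
    proof
      assume "\<exists>Ws. dsum UNIV Ws \<and> list_all2 repr Ws (map (\<lambda>i. companion_mat (r i)) [0..<N])"
      then obtain Ws where ds: "dsum UNIV Ws"
        and la: "list_all2 repr Ws (map (\<lambda>i. companion_mat (r i)) [0..<N])" by blast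
      have len: "length Ws = N" using list_all2_lengthD[OF la] by simp
      have "\<forall>i\<in>{..<N}. \<exists>e. pm.annihilator e (r i) \<and> Ws ! i = pm.span {e}"
      proof
        fix i assume i: "i \<in> {..<N}"
        then have "repr (Ws ! i) (companion_mat (r i))" using list_all2_nthD[OF la, of i] len by simp
        then show "\<exists>e. pm.annihilator e (r i) \<and> Ws ! i = pm.span {e}"
          using repr_companion m by blast
      qed
      from bchoice[OF this] obtain e where
        e: "\<forall>i\<in>{..<N}. pm.annihilator (e i) (r i) \<and> Ws ! i = pm.span {e i}" by blast
      then have "Ws = map (\<lambda>i. pm.span {e i}) [0..<N]" using len by (intro nth_equalityI) auto
      then have "dsum UNIV (map (\<lambda>i. pm.span {e i}) [0..<N])" using ds by simp
      then show ?R using e by blast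
    next
      assume ?R
      then obtain e where e: "dsum UNIV (map (\<lambda>i. pm.span {e i}) [0..<N])"
        "\<forall>i<N. pm.annihilator (e i) (r i)" by blast
      have "list_all2 repr (map (\<lambda>i. pm.span {e i}) [0..<N]) (map (\<lambda>i. companion_mat (r i)) [0..<N])"
        unfolding list_all2_conv_all_nth using e(2) m repr_companion by auto
      then show "\<exists>Ws. dsum UNIV Ws \<and> list_all2 repr Ws (map (\<lambda>i. companion_mat (r i)) [0..<N])"
        using e by blast
    qed
    finally show ?thesis .
  qed
  show ?thesis unfolding invariant_factors_def
    by (rule conj_cong[OF refl], rule conj_cong[OF refl], rule ex_cong1, rule conj_cong[OF refl],
        rule key, assumption)
qed

theorem invariant_factors_exist: "\<exists>r. invariant_factors (*s) u r"
proof -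
  obtain es where es: "set es = Basis" using finite_Basis finite_list by blast
  then have U: "pm.span (set es) = UNIV" using pm_span_eq_UNIV span_Basis by simp
  obtain ers where ers: "dsum UNIV (map (\<lambda>(e, r). pm.span {e}) ers)"
    "\<forall>(e, r) \<in> set ers. pm.annihilator e r \<and> lead_coeff r = 1"
    "sorted_wrt (\<lambda>(e, r) (e', r'). r dvd r') ers"
    using pm.cyclic_decomposition[OF torsion, of es] unfolding U by blast
  define N where "N = length ers"
  define xs where "xs = rev ers"
  define r where "r i = (if i < N then snd (xs ! i) else 1)" for i
  define e where "e i = fst (xs ! i)" for i
  have len: "length xs = N" by (simp add: xs_def N_def)
  have in_set: "(e i, r i) \<in> set ers" if "i < N" for i
    using nth_mem[of i xs] that len by (simp add: e_def r_def xs_def del: nth_mem)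
  have "dsum UNIV (rev (map (\<lambda>(e, r). pm.span {e}) ers))"
    by (rule pm.dsum_rev[OF _ ers(1)]) (auto simp: case_prod_unfold)
  also have "rev (map (\<lambda>(e, r). pm.span {e}) ers) = map (\<lambda>i. pm.span {e i}) [0..<N]"
    using len unfolding rev_map xs_def[symmetric]
    by (intro nth_equalityI) (auto simp: e_def case_prod_unfold)
  finally have ds: "dsum UNIV (map (\<lambda>i. pm.span {e i}) [0..<N])" .
  have ann: "\<forall>i<N. pm.annihilator (e i) (r i)" using in_set ers(2) by fastforce
  have monic: "\<forall>i. lead_coeff (r i) = 1"
  proof
    fix i show "lead_coeff (r i) = 1"
      using in_set[of i] ers(2) by (cases "i < N") (auto simp: r_def)
  qed
  have "\<forall>i. r (Suc i) dvd r i"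
  proof
    fix i
    show "r (Suc i) dvd r i"
    proof (cases "Suc i < N")
      case True
      have "sorted_wrt (\<lambda>p q. snd q dvd snd p) xs"
        unfolding xs_def sorted_wrt_rev using ers(3) by (simp add: case_prod_unfold)
      then have "snd (xs ! Suc i) dvd snd (xs ! i)"
        using sorted_wrt_nth_less[of "\<lambda>p q. snd q dvd snd p" xs i "Suc i"] True len by simp
      then show ?thesis using True by (simp add: r_def)
    qed (auto simp: r_def)
  qed
  moreover have "\<forall>i\<ge>N. r i = 1" by (simp add: r_def)
  ultimately show ?thesis unfolding invariant_factors_iff using monic ds ann by blast
qed

end

section \<open>Triangularizability\<close>

declare mult_pCons_left [simp del] mult_pCons_right [simp del]

context fd_endo
begin

text \<open>The minimal polynomial of \<open>u\<close> has no irreducible factors besides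
  \<open>[:- a, 1:]\<close> and \<open>[:- b, 1:]\<close>. Triangularizability, eigenvalues in the
  algebraic closure and invariant factors are all compared through this condition.\<close>

definition split_by :: "'a \<Rightarrow> 'a \<Rightarrow> bool" where
  "split_by a b \<longleftrightarrow> (\<exists>k l. \<forall>v. act ([:- a, 1:] ^ k * [:- b, 1:] ^ l) v = 0)"

lemma u_diff: "u (x - y) = u x - u y"
  using u_add[of "x - y" y] by simp

lemma act_eigenvector: "u v = c *s v \<Longrightarrow> act h v = poly h c *s v"
proof (induction h)
  case 0
  then show ?case by (simp add: act_zero)
next
  case (pCons a h)
  then show ?case by (simp add: act_pCons act_scale_right scale_left_distrib)
qed

lemma eigval_split_by:
  assumes "split_by a b" "eigval (*s) u c"
  shows "c \<in> {a, b}"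
proof -
  obtain k l where kl: "\<forall>v. act ([:- a, 1:] ^ k * [:- b, 1:] ^ l) v = 0"
    using assms(1) unfolding split_by_def by blast
  obtain v where v: "v \<noteq> 0" "u v = c *s v" using assms(2) unfolding eigval_def by blast
  have "poly ([:- a, 1:] ^ k * [:- b, 1:] ^ l) c *s v = 0"
    using kl act_eigenvector[OF v(2)] by metis
  then show ?thesis using v(1) by (auto simp del: mult_pCons_left)
qed

text \<open>If \<open>[:- d, 1:] * p\<close> kills \<open>W\<close>, then \<open>[:- d, 1:]\<close>
  maps \<open>W\<close> into the kernel of \<open>p\<close>. So every vector that extends a basis of
  this kernel to one of \<open>W\<close> is multiplied by \<open>d\<close> up to the span of earlier
  vectors. The list \<open>cs\<close> holds the future diagonal entries.\<close>

lemma flag_basis: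
  assumes "pm.subspace W" "\<forall>v\<in>W. act (\<Prod>d\<leftarrow>ds. [:- d, 1:]) v = 0"
  shows "\<exists>bs cs. free bs \<and> span (set bs) = W \<and> length cs = length bs \<and>
    (\<forall>j<length bs. u (bs ! j) - cs ! j *s bs ! j \<in> span (set (take j bs)))"
  using assms
proof (induction ds arbitrary: W)
  case Nil
  then have "\<forall>v\<in>W. v = 0" by (simp add: act_one)
  then have "W = {0}" using pm.subspace_0[OF Nil(1)] by blast
  moreover have "free []" by (simp add: free_iff)
  ultimately show ?case by (intro exI[of _ "[]"]) simp
next
  case (Cons d ds)
  define p where "p = (\<Prod>d\<leftarrow>ds. [:- d, 1:])"
  define W' where "W' = W \<inter> kernel p"
  have "pm.subspace W'" unfolding W'_def using Cons.prems pm_subspace_kernel pm.subspace_inter by blast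
  moreover have "\<forall>v\<in>W'. act (\<Prod>d\<leftarrow>ds. [:- d, 1:]) v = 0"
    unfolding W'_def kernel_def p_def by blast
  ultimately obtain bs cs where bs: "free bs" "span (set bs) = W'" "length cs = length bs"
    "\<forall>j<length bs. u (bs ! j) - cs ! j *s bs ! j \<in> span (set (take j bs))"
    using Cons.IH by blast
  obtain xs where xs: "free (bs @ xs)" "span (set (bs @ xs)) = W"
    using free_extend[OF pm_subspace_imp[OF Cons.prems(1)] bs(1)] bs(2) unfolding W'_def by blast
  let ?cs = "cs @ replicate (length xs) d"
  have "u ((bs @ xs) ! j) - ?cs ! j *s (bs @ xs) ! j \<in> span (set (take j (bs @ xs)))"
    if j: "j < length (bs @ xs)" for j
  proof (cases "j < length bs")
    case True
    then show ?thesis using bs by (simp add: nth_append)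
  next
    case False
    define x where "x = (bs @ xs) ! j"
    have "x \<in> W" using xs(2) span_base nth_mem[OF j] unfolding x_def by blast
    then have "act [:- d, 1:] x \<in> W" using pm.subspace_scale[OF Cons.prems(1)] by blast
    moreover have "act p (act [:- d, 1:] x) = act ([:- d, 1:] * p) x"
      by (simp only: act_mult[symmetric] mult.commute)
    then have "act p (act [:- d, 1:] x) = 0"
      using Cons.prems(2) \<open>x \<in> W\<close> by (simp only: list.map prod_list.Cons p_def)
    ultimately have "act [:- d, 1:] x \<in> W'" unfolding W'_def kernel_def by blast
    then have "u x - d *s x \<in> span (set bs)" unfolding bs(2) act_linear_factor .
    moreover have "set bs \<subseteq> set (take j (bs @ xs))" using False by simp
    then have "span (set bs) \<subseteq> span (set (take j (bs @ xs)))" by (rule span_mono)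
    moreover have "?cs ! j = d" using False j bs(3) by (simp add: nth_append)
    ultimately show ?thesis unfolding x_def by auto
  qed
  then show ?case using xs bs(3) by (intro exI[of _ "bs @ xs"] exI[of _ ?cs]) simp
qed

text \<open>The Cayley-Hamilton theorem for a triangular basis: the factor belonging to the
  \<open>k\<close>-th diagonal entry pushes the span of the first \<open>k + 1\<close> vectors into
  that of the first \<open>k\<close>.\<close>

lemma flag_annihilated:
  assumes len: "length cs = length bs"
    and flag: "\<forall>j<length bs. u (bs ! j) - cs ! j *s bs ! j \<in> span (set (take j bs))"
  shows "k \<le> length bs \<Longrightarrow> v \<in> span (set (take k bs)) \<Longrightarrow> act (\<Prod>d\<leftarrow>take k cs. [:- d, 1:]) v = 0"
proof (induction k arbitrary: v)
  case 0
  then show ?case by (simp add: act_one)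
next
  case (Suc k)
  define p b where "p = (\<Prod>d\<leftarrow>take k cs. [:- d, 1:])" and "b = bs ! k"
  have k: "k < length bs" using Suc.prems by simp
  have IH: "w \<in> span (set (take k bs)) \<Longrightarrow> act p w = 0" for w
    using Suc.IH k unfolding p_def by simp
  have "(\<Prod>d\<leftarrow>take (Suc k) cs. [:- d, 1:]) = p * [:- (cs ! k), 1:]"
    using k len by (simp add: take_Suc_conv_app_nth p_def del: mult_pCons_right)
  moreover obtain a where a: "v - a *s b \<in> span (set (take k bs))"
    using Suc.prems k by (auto simp: take_Suc_conv_app_nth span_insert b_def)
  have "act (p * [:- (cs ! k), 1:]) v = 0"
  proof -
    define w where "w = v - a *s b"
    have v: "v = w + a *s b" by (simp add: w_def)
    have "act (p * [:- (cs ! k), 1:]) w = act [:- (cs ! k), 1:] (act p w)"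
      by (simp only: act_mult[symmetric] mult.commute)
    also have "\<dots> = 0" using IH[OF a] unfolding w_def[symmetric] by (simp only: pm.scale_zero_right)
    finally have 1: "act (p * [:- (cs ! k), 1:]) w = 0" .
    have "act [:- (cs ! k), 1:] b \<in> span (set (take k bs))"
      using flag k unfolding act_linear_factor b_def by blast
    then have 2: "act (p * [:- (cs ! k), 1:]) b = 0" unfolding act_mult by (rule IH)
    show ?thesis unfolding v act_add_right act_scale_right 1 2 by simp
  qed
  ultimately show ?case by simp
qed

lemma lc_triangular:
  assumes "j < length bs" "\<And>i. j < i \<Longrightarrow> i < length bs \<Longrightarrow> c i = 0"
  shows "lc bs c = lc (take j bs) c + c j *s bs ! j"
proof -
  have bs: "bs = take j bs @ bs ! j # drop (Suc j) bs" by (rule id_take_nth_drop[OF assms(1)])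
  have "lc (take j bs @ bs ! j # drop (Suc j) bs) c =
    lc (take j bs) c + (c j *s bs ! j + lc (drop (Suc j) bs) (\<lambda>i. c (Suc i + j)))"
    using assms(1) by (simp add: lc_append lc_Cons min_absorb2)
  moreover have "lc (drop (Suc j) bs) (\<lambda>i. c (Suc i + j)) = 0"
    unfolding lc_def by (intro sum.neutral ballI) (simp add: assms(2))
  ultimately show ?thesis using bs by simp
qed

lemma triangularizable_if_split_by:
  assumes "split_by a b" shows "triangularizable (*s) u"
proof -
  obtain k l where kl: "\<forall>v. act ([:- a, 1:] ^ k * [:- b, 1:] ^ l) v = 0"
    using assms unfolding split_by_def by blast
  have "(\<Prod>d\<leftarrow>replicate k a @ replicate l b. [:- d, 1:]) = [:- a, 1:] ^ k * [:- b, 1:] ^ l"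
    by simp
  then have "\<forall>v\<in>UNIV. act (\<Prod>d\<leftarrow>replicate k a @ replicate l b. [:- d, 1:]) v = 0"
    using kl by simp
  from flag_basis[OF pm.subspace_UNIV this] obtain bs cs where
    bs: "free bs" "span (set bs) = UNIV" "length cs = length bs"
    and flag: "\<forall>j<length bs. u (bs ! j) - cs ! j *s bs ! j \<in> span (set (take j bs))"
    by blast
  have "\<forall>j\<in>{..<length bs}. \<exists>f. u (bs ! j) - cs ! j *s bs ! j = lc (take j bs) f"
    using flag unfolding span_list by blast
  from bchoice[OF this] obtain f where
    f: "\<forall>j\<in>{..<length bs}. u (bs ! j) - cs ! j *s bs ! j = lc (take j bs) (f j)" by blast
  let ?n = "length bs"
  define M where "M = mat ?n ?n (\<lambda>(i, j). if i < j then f j i else if i = j then cs ! j else 0)"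
  have "u (bs ! j) = lc bs (\<lambda>i. M $$ (i, j))" if j: "j < ?n" for j
  proof -
    have "lc bs (\<lambda>i. M $$ (i, j)) = lc (take j bs) (\<lambda>i. M $$ (i, j)) + M $$ (j, j) *s bs ! j"
      by (rule lc_triangular[OF j]) (simp add: M_def)
    also have "lc (take j bs) (\<lambda>i. M $$ (i, j)) = lc (take j bs) (f j)"
      using j by (intro lc_cong) (simp add: M_def)
    also have "lc (take j bs) (f j) = u (bs ! j) - cs ! j *s bs ! j" using f j by simp
    also have "M $$ (j, j) = cs ! j" using j by (simp add: M_def)
    finally show ?thesis by simp
  qed
  then have "rep UNIV bs M" using bs by (simp add: rep_def M_def)
  moreover have "upper_triangular M" by (auto simp: M_def)
  ultimately show ?thesis unfolding triangularizable_def represents_rep by blast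
qed

text \<open>A linear factor at \<open>a\<close> or \<open>b\<close> is moved into the powers, which
  is why \<open>k\<close> and \<open>l\<close> are general. A factor at any other \<open>d\<close>
  acts injectively, \<open>d\<close> being no eigenvalue, and is cancelled.\<close>

lemma split_by_remove_factors:
  assumes ev: "\<And>c. eigval (*s) u c \<Longrightarrow> c \<in> {a, b}"
  shows "\<forall>v. act ((\<Prod>d\<leftarrow>ds. [:- d, 1:]) * ([:- a, 1:] ^ k * [:- b, 1:] ^ l)) v = 0 \<Longrightarrow> split_by a b"
proof (induction ds arbitrary: k l)
  case Nil
  then show ?case unfolding split_by_def by (auto simp del: mult_pCons_left)
next
  case (Cons d ds)
  define p where "p = (\<Prod>d\<leftarrow>ds. [:- d, 1:])"
  have *: "\<forall>v. act ([:- d, 1:] * p * ([:- a, 1:] ^ k * [:- b, 1:] ^ l)) v = 0"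
    using Cons.prems unfolding p_def list.map prod_list.Cons .
  consider "d = a" | "d = b" | "d \<notin> {a, b}" by blast
  then show ?case
  proof cases
    case 1
    have eq: "[:- d, 1:] * p * ([:- a, 1:] ^ k * [:- b, 1:] ^ l) =
        p * ([:- a, 1:] ^ Suc k * [:- b, 1:] ^ l)"
      unfolding 1 power_Suc by (simp only: mult_ac)
    show ?thesis using *[unfolded eq] unfolding p_def by (rule Cons.IH)
  next
    case 2
    have eq: "[:- d, 1:] * p * ([:- a, 1:] ^ k * [:- b, 1:] ^ l) =
        p * ([:- a, 1:] ^ k * [:- b, 1:] ^ Suc l)"
      unfolding 2 power_Suc by (simp only: mult_ac)
    show ?thesis using *[unfolded eq] unfolding p_def by (rule Cons.IH)
  next
    case 3
    have p: "act (p * ([:- a, 1:] ^ k * [:- b, 1:] ^ l)) v = 0" for v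
    proof (rule ccontr)
      define w where "w = act (p * ([:- a, 1:] ^ k * [:- b, 1:] ^ l)) v"
      assume "act (p * ([:- a, 1:] ^ k * [:- b, 1:] ^ l)) v \<noteq> 0"
      then have "w \<noteq> 0" by (simp only: w_def not_False_eq_True)
      moreover have "act [:- d, 1:] w = 0"
        using * unfolding w_def act_mult[symmetric] by (simp only: mult.assoc)
      then have "u w = d *s w" unfolding act_linear_factor by simp
      ultimately have "eigval (*s) u d" unfolding eigval_def by blast
      then show False using ev 3 by blast
    qed
    then show ?thesis by (intro Cons.IH[of k l]) (simp add: p_def[symmetric])
  qed
qed

lemma triangularizable_iff_split_by:
  "triangularizable (*s) u \<and> (\<forall>c. eigval (*s) u c \<longrightarrow> c \<in> {a, b}) \<longleftrightarrow> split_by a b"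
proof
  assume "split_by a b"
  then show "triangularizable (*s) u \<and> (\<forall>c. eigval (*s) u c \<longrightarrow> c \<in> {a, b})"
    using triangularizable_if_split_by eigval_split_by by blast
next
  assume *: "triangularizable (*s) u \<and> (\<forall>c. eigval (*s) u c \<longrightarrow> c \<in> {a, b})"
  then obtain bs M where bs: "rep UNIV bs M" and M: "upper_triangular M"
    unfolding triangularizable_def represents_rep by blast
  define cs where "cs = map (\<lambda>j. M $$ (j, j)) [0..<length bs]"
  have "u (bs ! j) - cs ! j *s bs ! j \<in> span (set (take j bs))" if j: "j < length bs" for j
  proof -
    have "u (bs ! j) = lc bs (\<lambda>i. M $$ (i, j))" using bs j unfolding rep_def by blast
    also have "\<dots> = lc (take j bs) (\<lambda>i. M $$ (i, j)) + M $$ (j, j) *s bs ! j"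
    proof (rule lc_triangular[OF j])
      fix i assume "j < i" "i < length bs"
      moreover have "dim_row M = length bs" using bs unfolding rep_def by auto
      ultimately show "M $$ (i, j) = 0" using upper_triangularD[OF M] by simp
    qed
    finally have "u (bs ! j) - cs ! j *s bs ! j = lc (take j bs) (\<lambda>i. M $$ (i, j))"
      using j by (simp add: cs_def)
    then show ?thesis unfolding span_list by blast
  qed
  then have "act (\<Prod>d\<leftarrow>take (length bs) cs. [:- d, 1:]) v = 0" for v
    using flag_annihilated[of cs bs "length bs" v] bs by (simp add: cs_def rep_def)
  then have "\<forall>v. act ((\<Prod>d\<leftarrow>take (length bs) cs. [:- d, 1:]) * ([:- a, 1:] ^ 0 * [:- b, 1:] ^ 0)) v = 0"
    by simp
  then show "split_by a b" by (rule split_by_remove_factors[rotated]) (use * in blast)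
qed

lemma dsum_subset:
  assumes T: "pm.subspace T"
  shows "\<forall>S\<in>set Ss. S \<subseteq> T \<Longrightarrow> dsum W Ss \<Longrightarrow> W \<subseteq> T"
proof (induction Ss arbitrary: W)
  case Nil
  then show ?case using pm.subspace_0[OF T] by simp
next
  case (Cons S Ss)
  then obtain W' where *: "dsum W' Ss" "W = S + W'" by auto
  then have "W' \<subseteq> T" "S \<subseteq> T" using Cons by auto
  then show ?case using *(2) pm.subspace_add[OF T] by (auto elim!: set_plus_elim)
qed

text \<open>\<open>r 0\<close> is the minimal polynomial of \<open>u\<close>: it generates the
  annihilator of the first summand and is a multiple of the other annihilators. If there are no
  summands, the space is zero and \<open>r 0 = 1\<close>.\<close>

lemma invariant_factors_split_by:
  assumes inv: "invariant_factors (*s) u r"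
  shows "split_by a b \<longleftrightarrow> (\<exists>k l. r 0 dvd [:- a, 1:] ^ k * [:- b, 1:] ^ l)"
proof -
  obtain N e where dv: "\<forall>i. r (Suc i) dvd r i" and one: "\<forall>i\<ge>N. r i = 1"
    and ds: "dsum UNIV (map (\<lambda>i. pm.span {e i}) [0..<N])" and ann: "\<forall>i<N. pm.annihilator (e i) (r i)"
    using inv unfolding invariant_factors_iff by blast
  have dv0: "r i dvd r 0" for i
  proof (induction i)
    case (Suc i)
    then show ?case using dv dvd_trans by blast
  qed simp
  have "(\<forall>v. act h v = 0) \<longleftrightarrow> r 0 dvd h" for h
  proof
    assume h: "\<forall>v. act h v = 0"
    show "r 0 dvd h"
    proof (cases "N = 0")
      case True
      then show ?thesis using one by simp
    next
      case False
      then show ?thesis using ann h pm.annihilatorD[of "e 0" "r 0" h] by simp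
    qed
  next
    assume h: "r 0 dvd h"
    have "pm.span {e i} \<subseteq> kernel h" if "i < N" for i
    proof (rule pm.span_minimal[OF _ pm_subspace_kernel])
      have "r i dvd h" using dv0 h dvd_trans by blast
      then show "{e i} \<subseteq> kernel h" using ann that pm.annihilatorD[of "e i" "r i" h]
        by (simp add: kernel_def)
    qed
    then have "UNIV \<subseteq> kernel h" by (intro dsum_subset[OF pm_subspace_kernel _ ds]) auto
    then show "\<forall>v. act h v = 0" unfolding kernel_def by blast
  qed
  then show ?thesis unfolding split_by_def by blast
qed

end

section \<open>Eigenvalues in the algebraic closure\<close>

definition ev :: "'a::field alg_closure \<Rightarrow> 'a poly \<Rightarrow> 'a alg_closure" where
  "ev c h = poly (map_poly to_ac h) c"

lemma ev_pCons: "ev c (pCons a h) = to_ac a + c * ev c h"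
  by (cases "a = 0 \<and> h = 0") (auto simp: ev_def map_poly_pCons)

lemma ev_0: "ev c 0 = 0"
  by (simp add: ev_def)

lemma ev_add: "ev c (g + h) = ev c g + ev c h"
proof -
  have "map_poly to_ac (g + h) = map_poly to_ac g + map_poly to_ac h"
    by (rule poly_eqI) (simp add: coeff_map_poly)
  then show ?thesis by (simp add: ev_def)
qed

lemma ev_smult: "ev c (smult a h) = to_ac a * ev c h"
proof -
  have "map_poly to_ac (smult a h) = smult (to_ac a) (map_poly to_ac h)"
    by (rule poly_eqI) (simp add: coeff_map_poly)
  then show ?thesis by (simp add: ev_def)
qed

lemma ev_mult: "ev c (g * h) = ev c g * ev c h"
  by (induction g) (simp_all add: ev_0 ev_pCons ev_add ev_smult mult_pCons_left distrib_right mult.assoc)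

lemma ev_to_ac: "ev (to_ac a) h = to_ac (poly h a)"
  by (induction h) (simp_all add: ev_0 ev_pCons)

context fd_endo
begin

text \<open>Functionals with values in the algebraic closure describe eigenvalues there without
  constructing the scalar extension of the space. They do not refer to a basis, so the eigenvalues
  are seen to be the same for all matrices of \<open>u\<close>.\<close>

definition eigenform :: "'a alg_closure \<Rightarrow> ('b \<Rightarrow> 'a alg_closure) \<Rightarrow> bool" where
  "eigenform c f \<longleftrightarrow> (\<forall>x y. f (x + y) = f x + f y) \<and> (\<forall>a x. f (a *s x) = to_ac a * f x) \<and>
    (\<exists>x. f x \<noteq> 0) \<and> (\<forall>x. f (u x) = c * f x)"

lemma semilinear_lc:
  assumes "\<And>x y. f (x + y) = f x + f y" "\<And>a x. f (a *s x) = to_ac a * f x"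
  shows "f (lc bs c) = (\<Sum>i<length bs. to_ac (c i) * f (bs ! i))"
proof -
  have 0: "f 0 = 0" using assms(2)[of 0 0] by simp
  have "f (sum g A) = (\<Sum>i\<in>A. f (g i))" if "finite A" for g and A :: "nat set"
    using that by (induction A rule: finite_induct) (simp_all add: 0 assms(1))
  then show ?thesis unfolding lc_def by (simp add: assms(2))
qed

text \<open>Left eigenvectors of the scalar extension of a matrix of \<open>u\<close> are eigenforms of \<open>u\<close>.\<close>

lemma eigenvalue_iff_eigenform:
  assumes bs: "rep UNIV bs M"
  shows "eigenvalue (map_mat to_ac M) c \<longleftrightarrow> (\<exists>f. eigenform c f)"
proof -
  let ?n = "length bs" and ?A = "map_mat to_ac M"
  have M: "M \<in> carrier_mat ?n ?n" and free: "free bs" and sp: "span (set bs) = UNIV"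
    and cols: "\<And>j. j < ?n \<Longrightarrow> u (bs ! j) = lc bs (\<lambda>i. M $$ (i, j))"
    using bs unfolding rep_def by auto
  have A: "?A \<in> carrier_mat ?n ?n" "transpose_mat ?A \<in> carrier_mat ?n ?n" using M by auto
  \<comment> \<open>The transpose is the matrix that acts on functionals, and it has the same
    characteristic polynomial.\<close>
  have "eigenvalue ?A c \<longleftrightarrow> eigenvalue (transpose_mat ?A) c"
    unfolding eigenvalue_root_char_poly[OF A(1)] eigenvalue_root_char_poly[OF A(2)]
      char_poly_transpose_mat[OF A(1)] ..
  also have "\<dots> \<longleftrightarrow> (\<exists>w. w \<in> carrier_vec ?n \<and> w \<noteq> 0\<^sub>v ?n \<and>
      (\<forall>j<?n. (\<Sum>i<?n. to_ac (M $$ (i, j)) * vec_index w i) = c * vec_index w j))"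
  proof -
    have "transpose_mat ?A *\<^sub>v w = c \<cdot>\<^sub>v w \<longleftrightarrow>
        (\<forall>j<?n. (\<Sum>i<?n. to_ac (M $$ (i, j)) * vec_index w i) = c * vec_index w j)" if w: "w \<in> carrier_vec ?n" for w
    proof -
      have "vec_index (transpose_mat ?A *\<^sub>v w) j = (\<Sum>i<?n. to_ac (M $$ (i, j)) * vec_index w i)" if "j < ?n" for j
        using M w that by (simp add: scalar_prod_def atLeast0LessThan)
      then show ?thesis using w M by (auto simp: vec_eq_iff)
    qed
    then show ?thesis unfolding eigenvalue_def eigenvector_def using A(2) by auto
  qed
  also have "\<dots> \<longleftrightarrow> (\<exists>f. eigenform c f)"
  proof (intro iffI; elim exE conjE)
    fix w assume w: "w \<in> carrier_vec ?n" "w \<noteq> 0\<^sub>v ?n"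
      "\<forall>j<?n. (\<Sum>i<?n. to_ac (M $$ (i, j)) * vec_index w i) = c * vec_index w j"
    let ?R = "representation (set bs)"
    define f where "f x = (\<Sum>i<?n. to_ac (?R x (bs ! i)) * vec_index w i)" for x
    have ind: "independent (set bs)" and dist: "distinct bs" using free unfolding free_def by auto
    have add: "f (x + y) = f x + f y" for x y
    proof -
      have "?R (x + y) = (\<lambda>b. ?R x b + ?R y b)" using representation_add[OF ind, of y x] sp by simp
      then show ?thesis unfolding f_def by (simp add: sum.distrib distrib_right)
    qed
    have scale: "f (a *s x) = to_ac a * f x" for a x
      unfolding f_def using representation_scale[OF ind, of x a] sp
      by (simp add: sum_distrib_left mult.assoc)
    have fb: "f (bs ! j) = vec_index w j" if j: "j < ?n" for j
    proof -
      have "?R (bs ! j) (bs ! i) = (if i = j then 1 else 0)" if "i < ?n" for i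
        using that j representation_basis[OF ind nth_mem[OF j]]
          nth_eq_iff_index_eq[OF dist] by auto
      then have "f (bs ! j) = (\<Sum>i<?n. if i = j then vec_index w i else 0)"
        unfolding f_def by (intro sum.cong) auto
      then show ?thesis using that by simp
    qed
    obtain j where j: "j < ?n" "vec_index w j \<noteq> 0" using w(1,2) by (auto simp: vec_eq_iff)
    have base: "f (u (bs ! j)) = c * f (bs ! j)" if "j < ?n" for j
      using w(3) that by (simp add: cols semilinear_lc[of f, OF add scale] fb)
    have "f (u x) = c * f x" for x
    proof -
      obtain d where d: "x = lc bs d" using sp span_list by blast
      have "u x = (\<Sum>i<?n. d i *s u (bs ! i))" unfolding d lc_def u_sum u_scale ..
      also have "\<dots> = lc (map u bs) d" unfolding lc_def by (intro sum.cong) simp_all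
      finally have "f (u x) = (\<Sum>i<length (map u bs). to_ac (d i) * f (map u bs ! i))"
        by (simp only: semilinear_lc[of f, OF add scale])
      also have "\<dots> = (\<Sum>i<?n. to_ac (d i) * f (u (bs ! i)))" by (intro sum.cong) simp_all
      also have "\<dots> = c * f x"
        unfolding d semilinear_lc[of f, OF add scale] sum_distrib_left
        by (intro sum.cong) (simp_all add: base)
      finally show ?thesis .
    qed
    then have "eigenform c f" unfolding eigenform_def using add scale fb[OF j(1)] j(2) by metis
    then show "\<exists>f. eigenform c f" by blast
  next
    fix f assume "eigenform c f"
    then have add: "\<And>x y. f (x + y) = f x + f y" and scale: "\<And>a x. f (a *s x) = to_ac a * f x"
      and nz: "\<exists>x. f x \<noteq> 0" and eig: "\<And>x. f (u x) = c * f x" unfolding eigenform_def by auto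
    define w where "w = vec ?n (\<lambda>i. f (bs ! i))"
    have "w \<noteq> 0\<^sub>v ?n"
    proof
      assume "w = 0\<^sub>v ?n"
      then have z: "f (bs ! i) = 0" if "i < ?n" for i
        using that by (metis w_def index_vec index_zero_vec(1))
      obtain x where x: "f x \<noteq> 0" using nz by blast
      obtain d where "x = lc bs d" using sp span_list by blast
      then show False using x z by (simp add: semilinear_lc[of f, OF add scale])
    qed
    moreover have "(\<Sum>i<?n. to_ac (M $$ (i, j)) * vec_index w i) = c * vec_index w j" if j: "j < ?n" for j
    proof -
      have "f (u (bs ! j)) = (\<Sum>i<?n. to_ac (M $$ (i, j)) * f (bs ! i))"
        unfolding cols[OF j] by (rule semilinear_lc[of f, OF add scale])
      then show ?thesis using eig j by (simp add: w_def)
    qed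
    ultimately show "\<exists>w. w \<in> carrier_vec ?n \<and> w \<noteq> 0\<^sub>v ?n \<and>
      (\<forall>j<?n. (\<Sum>i<?n. to_ac (M $$ (i, j)) * vec_index w i) = c * vec_index w j)"
      by (intro exI[of _ w]) (simp add: w_def)
  qed
  finally show ?thesis .
qed

text \<open>Project onto the summand spanned by \<open>e\<close> and send \<open>act h e\<close> to
  the value of \<open>h\<close> at \<open>c\<close>. This is well defined because \<open>r\<close>
  vanishes at \<open>c\<close>, and applying \<open>u\<close> multiplies \<open>h\<close> by the
  indeterminate, hence the value by \<open>c\<close>.\<close>

lemma eigenform_root:
  assumes ds: "dsum UNIV (pm.span {e} # Ss)" and Ss: "\<forall>S\<in>set Ss. pm.subspace S"
    and ann: "pm.annihilator e r" and root: "ev c r = 0"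
  shows "\<exists>f. eigenform c f"
proof -
  obtain W where W: "dsum W Ss" "pm.span {e} \<inter> W = {0}" "UNIV = pm.span {e} + W"
    using ds by auto
  have sW: "pm.subspace W" using pm.dsum_subspace W(1) Ss by blast
  have ex: "\<exists>h. x - act h e \<in> W" for x
  proof -
    have "x \<in> pm.span {e} + W" using W(3) by blast
    then obtain y w where "y \<in> pm.span {e}" "w \<in> W" "x = y + w" by (elim set_plus_elim)
    then obtain h where "y = act h e" unfolding pm.span_singleton by blast
    then have "x - act h e = w" using \<open>x = y + w\<close> by simp
    then show ?thesis using \<open>w \<in> W\<close> by metis
  qed
  have uniq: "ev c h = ev c g" if "x - act h e \<in> W" "x - act g e \<in> W" for x g h
  proof -
    have "(x - act g e) - (x - act h e) = act (h - g) e" by (simp add: pm.scale_left_diff_distrib)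
    then have "act (h - g) e \<in> W" using pm.subspace_diff[OF sW that(2,1)] by simp
    moreover have "act (h - g) e \<in> pm.span {e}" unfolding pm.span_singleton by blast
    ultimately have "act (h - g) e = 0" using W(2) by blast
    then obtain s where "h - g = r * s" using pm.annihilatorD[OF ann] by (auto elim: dvdE)
    then have "h = g + r * s" by (simp add: algebra_simps)
    then show ?thesis by (simp add: ev_add ev_mult root)
  qed
  \<comment> \<open>The polynomial \<open>h\<close> is determined only modulo \<open>r\<close>; by
    \<open>uniq\<close> its value at \<open>c\<close> does not depend on the choice.\<close>
  define f where "f x = ev c (SOME h. x - act h e \<in> W)" for x
  have f: "f x = ev c h" if "x - act h e \<in> W" for x h
    unfolding f_def using uniq[OF someI_ex[OF ex] that] .
  have "f (x + y) = f x + f y" for x y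
  proof -
    obtain g h where gh: "x - act g e \<in> W" "y - act h e \<in> W" using ex by metis
    have "(x + y) - act (g + h) e = (x - act g e) + (y - act h e)"
      by (simp add: pm.scale_left_distrib)
    then have "(x + y) - act (g + h) e \<in> W" using pm.subspace_add[OF sW gh] by metis
    then show ?thesis using f gh ev_add by metis
  qed
  moreover have "f (a *s x) = to_ac a * f x" for a x
  proof -
    obtain g where g: "x - act g e \<in> W" using ex by blast
    have "a *s x - act (smult a g) e = act [:a:] (x - act g e)"
      by (simp add: act_smult act_const scale_right_diff_distrib)
    then have "a *s x - act (smult a g) e \<in> W" using pm.subspace_scale[OF sW g] by metis
    then show ?thesis using f g ev_smult by metis
  qed
  moreover have "f (u x) = c * f x" for x
  proof -
    obtain g where g: "x - act g e \<in> W" using ex by blast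
    have "act [:0, 1:] (x - act g e) = u (x - act g e)" by (simp only: act_pCons act_zero scale_zero_left) simp
    also have "\<dots> = u x - act (pCons 0 g) e" by (simp only: u_diff act_pCons act_u scale_zero_left) simp
    finally have "u x - act (pCons 0 g) e \<in> W" using pm.subspace_scale[OF sW g] by metis
    then have "f (u x) = ev c (pCons 0 g)" by (rule f)
    then show ?thesis using f[OF g] by (simp add: ev_pCons)
  qed
  moreover have "f e = 1"
  proof -
    have "e - act 1 e \<in> W" using pm.subspace_0[OF sW] by (simp add: act_one)
    then have "f e = ev c 1" by (rule f)
    then show ?thesis by (simp add: one_pCons ev_pCons ev_0)
  qed
  ultimately have "eigenform c f" unfolding eigenform_def by (metis zero_neq_one)
  then show ?thesis by blast
qed

lemma eigenform_linear_power:
  assumes "eigenform c f"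
  shows "f (act ([:- a, 1:] ^ k) v) = (c - to_ac a) ^ k * f v"
proof -
  have add: "f (x + y) = f x + f y" and sc: "f (d *s x) = to_ac d * f x"
    and eig: "f (u x) = c * f x" for x y d using assms unfolding eigenform_def by auto
  have lin: "f (act [:- a, 1:] x) = (c - to_ac a) * f x" for x
  proof -
    have "act [:- a, 1:] x = u x + (- a) *s x" by (simp add: act_linear_factor)
    then show ?thesis by (simp only: add sc eig) (simp add: algebra_simps)
  qed
  show ?thesis
  proof (induction k)
    case (Suc k)
    have eq: "act ([:- a, 1:] ^ Suc k) v = act [:- a, 1:] (act ([:- a, 1:] ^ k) v)"
      by (simp only: power_Suc act_mult)
    show ?case unfolding eq lin Suc by (simp add: mult.assoc)
  qed (simp add: act_one)
qed

text \<open>Forwards: strip \<open>r 0\<close> of its factors at \<open>a\<close> and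
  \<open>b\<close>. A root of the rest in the algebraic closure would be an eigenvalue by
  \<open>eigenform_root\<close>, so the rest is constant. Backwards: an eigenform turns the product
  of powers that kills \<open>u\<close> into a scalar equation for \<open>c\<close>.\<close>

lemma ac_eigval_iff_split_by:
  "(\<forall>c. ac_eigval (*s) u c \<longrightarrow> c \<in> {to_ac a, to_ac b}) \<longleftrightarrow> split_by a b"
proof (intro iffI allI impI)
  fix c assume s: "split_by a b" and "ac_eigval (*s) u c"
  then obtain f where f: "eigenform c f"
    using eigenvalue_iff_eigenform unfolding ac_eigval_def represents_rep by blast
  obtain k l where kl: "\<forall>v. act ([:- a, 1:] ^ k * [:- b, 1:] ^ l) v = 0"
    using s unfolding split_by_def by blast
  obtain v where v: "f v \<noteq> 0" using f unfolding eigenform_def by blast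
  have "f 0 = 0" using f unfolding eigenform_def by (metis add_cancel_right_right)
  then have "f (act ([:- a, 1:] ^ k * [:- b, 1:] ^ l) v) = 0" using kl by simp
  then have "(c - to_ac a) ^ k * ((c - to_ac b) ^ l * f v) = 0"
    unfolding act_mult eigenform_linear_power[OF f] .
  then show "c \<in> {to_ac a, to_ac b}" using v by auto
next
  assume ac: "\<forall>c. ac_eigval (*s) u c \<longrightarrow> c \<in> {to_ac a, to_ac b}"
  obtain r where inv: "invariant_factors (*s) u r" using invariant_factors_exist by blast
  obtain N e where m: "\<forall>i. lead_coeff (r i) = 1" and one: "\<forall>i\<ge>N. r i = 1"
    and ds: "dsum UNIV (map (\<lambda>i. pm.span {e i}) [0..<N])" and ann: "\<forall>i<N. pm.annihilator (e i) (r i)"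
    using inv unfolding invariant_factors_iff by blast
  have "r 0 \<noteq> 0" using m by (metis leading_coeff_0_iff zero_neq_one)
  then obtain q where q: "r 0 = [:- a, 1:] ^ order a (r 0) * q" "poly q a \<noteq> 0"
    using order_factorization by blast
  then have "q \<noteq> 0" by auto
  then obtain s where s: "q = [:- b, 1:] ^ order b q * s" "poly s b \<noteq> 0"
    using order_factorization by blast
  define k l where "k = order a (r 0)" and "l = order b q"
  have r0: "r 0 = [:- a, 1:] ^ k * ([:- b, 1:] ^ l * s)"
    using q(1) s(1) unfolding k_def l_def by metis
  have sa: "poly s a \<noteq> 0"
  proof
    assume "poly s a = 0"
    then have "poly ([:- b, 1:] ^ l * s) a = 0" by simp
    then show False using q(2) s(1) unfolding l_def by metis
  qed
  have "degree s = 0"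
  proof (rule ccontr)
    assume "degree s \<noteq> 0"
    then have "degree (map_poly to_ac s) > 0" by (simp add: degree_map_poly)
    then obtain c where "poly (map_poly to_ac s) c = 0" using alg_closed_imp_poly_has_root by blast
    then have c: "ev c s = 0" unfolding ev_def .
    have "degree (r 0) \<noteq> 0"
    proof
      assume "degree (r 0) = 0"
      moreover have "s dvd r 0" unfolding r0 by simp
      ultimately show False
        using \<open>r 0 \<noteq> 0\<close> \<open>degree s \<noteq> 0\<close> dvd_imp_degree_le[of s "r 0"] by simp
    qed
    then have N: "N > 0" using one by (cases N) auto
    let ?Ss = "map (\<lambda>i. pm.span {e i}) [1..<N]"
    have ds0: "dsum UNIV (pm.span {e 0} # ?Ss)" using ds N by (simp add: upt_conv_Cons)
    have sub: "\<forall>S\<in>set ?Ss. pm.subspace S" by auto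
    have ev0: "ev c (r 0) = 0" using c by (simp add: r0 ev_mult)
    have "pm.annihilator (e 0) (r 0)" using ann N by blast
    from eigenform_root[OF ds0 sub this ev0] obtain f where f: "eigenform c f" by blast
    obtain bs M where "rep UNIV bs M"
      using inv unfolding invariant_factors_def represents_rep by blast
    then have "ac_eigval (*s) u c"
      using eigenvalue_iff_eigenform f unfolding ac_eigval_def represents_rep by blast
    then have "c = to_ac a \<or> c = to_ac b" using ac by blast
    then show False using c sa s(2) by (auto simp: ev_to_ac)
  qed
  then have "s dvd 1" using s(2) by (auto elim!: degree_eq_zeroE simp: is_unit_poly_iff)
  then have "[:- b, 1:] ^ l * s dvd [:- b, 1:] ^ l * 1" by (rule mult_dvd_mono[OF dvd_refl])
  then have "[:- a, 1:] ^ k * ([:- b, 1:] ^ l * s) dvd [:- a, 1:] ^ k * ([:- b, 1:] ^ l * 1)"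
    by (rule mult_dvd_mono[OF dvd_refl])
  then have "r 0 dvd [:- a, 1:] ^ k * [:- b, 1:] ^ l" unfolding r0 by simp
  then show "split_by a b" using invariant_factors_split_by[OF inv] by blast
qed

end

section \<open>Rank, nullity and Jordan numbers\<close>

context vector_space
begin

lemma linear_maps:
  assumes "Vector_Spaces.linear scale scale f"
  shows "f (x + y) = f x + f y" "f (scale c x) = scale c (f x)" "f (x - y) = f x - f y"
    "f (- x) = - f x" "f 0 = 0"
proof -
  interpret Vector_Spaces.linear scale scale f by (rule assms)
  show "f (x + y) = f x + f y" "f (scale c x) = scale c (f x)" "f (x - y) = f x - f y"
    "f (- x) = - f x" "f 0 = 0"
    by (rule add scale diff neg zero)+
qed

lemma linear_mapI:
  assumes "\<And>x y. f (x + y) = f x + f y" "\<And>c x. f (scale c x) = scale c (f x)"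
  shows "Vector_Spaces.linear scale scale f"
  unfolding Vector_Spaces.linear_iff using assms vector_space_axioms by blast

lemma linear_image_subspace:
  assumes "Vector_Spaces.linear scale scale f" "subspace S" shows "subspace (f ` S)"
proof -
  interpret Vector_Spaces.linear scale scale f by (rule assms(1))
  show ?thesis by (rule subspace_image[OF assms(2)])
qed

lemma linear_kernel_subspace:
  assumes "Vector_Spaces.linear scale scale f" shows "subspace {x. f x = 0}"
  by (rule subspaceI) (simp_all add: linear_maps[OF assms])

end

context fd_endo
begin

declare pm.scale_scale [simp del]

lemma rank_nullity:
  assumes f: "Vector_Spaces.linear (*s) (*s) f" and S: "subspace S"
  shows "dim S = dim (f ` S) + dim (S \<inter> {x. f x = 0})"
proof -
  have K: "subspace (S \<inter> {x. f x = 0})"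
    by (rule subspace_inter[OF S linear_kernel_subspace[OF f]])
  obtain bs where bs: "free bs" "span (set bs) = S \<inter> {x. f x = 0}"
    using subspace_free_basis[OF K] by blast
  have "span (set bs) \<subseteq> S" unfolding bs(2) by blast
  then obtain cs where cs: "free (bs @ cs)" "span (set (bs @ cs)) = S"
    using free_extend[OF S bs(1)] by blast
  have f_lc: "f (lc cs c) = lc (map f cs) c" for c
  proof -
    interpret Vector_Spaces.linear "(*s)" "(*s)" f by (rule f)
    show ?thesis unfolding lc_def sum scale by (intro sum.cong) simp_all
  qed
  have "span (set cs) \<subseteq> S" unfolding cs(2)[symmetric] by (rule span_mono) simp
  have inj: "lc cs c = 0" if "f (lc cs c) = 0" for c
  proof -
    have "lc cs c \<in> span (set cs)" unfolding span_list by blast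
    moreover have "lc cs c \<in> span (set bs)"
      unfolding bs(2) using that \<open>span (set cs) \<subseteq> S\<close> calculation by blast
    ultimately have "lc cs c \<in> span (set bs) \<inter> span (set cs)" by blast
    then show ?thesis using cs(1) unfolding free_append by blast
  qed
  have "free (map f cs)"
  proof -
    have "free cs" using cs(1) unfolding free_append by blast
    then show ?thesis unfolding free_iff length_map f_lc[symmetric] using inj by blast
  qed
  moreover have "f ` S = span (set (map f cs))"
  proof (intro equalityI subsetI)
    fix y assume "y \<in> f ` S"
    then obtain x where x: "x \<in> S" "y = f x" by blast
    then have "x \<in> span (set bs) + span (set cs)"
      using cs(2) unfolding set_append span_append_set by blast
    then obtain b c where bc: "b \<in> span (set bs)" "c \<in> span (set cs)" "x = b + c"
      by (elim set_plus_elim)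
    have "f b = 0" using bc(1) unfolding bs(2) by blast
    then have "y = f c" using x bc by (simp add: linear_maps[OF f])
    moreover obtain d where "c = lc cs d" using bc(2) unfolding span_list by blast
    ultimately have "y = lc (map f cs) d" by (simp only: f_lc)
    then show "y \<in> span (set (map f cs))" unfolding span_list by blast
  next
    fix y assume "y \<in> span (set (map f cs))"
    then obtain d where "y = f (lc cs d)" unfolding span_list f_lc by blast
    moreover have "lc cs d \<in> span (set cs)" unfolding span_list by blast
    ultimately show "y \<in> f ` S" using \<open>span (set cs) \<subseteq> S\<close> by blast
  qed
  ultimately have "dim (f ` S) = length cs" using dim_free[of "map f cs"] by simp
  moreover have "dim S = length bs + length cs" using dim_free[OF cs(1)] unfolding cs(2) length_append .
  moreover have "dim (S \<inter> {x. f x = 0}) = length bs" using dim_free[OF bs(1)] bs(2) by simp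
  ultimately show ?thesis by simp
qed

lemma linear_act: "Vector_Spaces.linear (*s) (*s) (act h)"
  by (rule linear_mapI) (rule act_add_right act_scale_right)+

text \<open>Rank-nullity for the power \<open>k - 1\<close> of \<open>u - c\<close> on the kernel of
  the power \<open>k\<close>. A difference of two dimensions becomes the dimension of one subspace,
  which can be transported by isomorphisms.\<close>

lemma jordan_number_image:
  assumes k: "k \<ge> 1"
  shows "jordan_number (*s) u c k = dim {y. u y = c *s y \<and> y \<in> range (act ([:- c, 1:] ^ (k - 1)))}"
proof -
  let ?f = "act ([:- c, 1:] ^ (k - 1))" and ?S = "kernel ([:- c, 1:] ^ k)"
  have k': "act ([:- c, 1:] ^ k) v = act [:- c, 1:] (?f v)" for v
    using k by (metis Suc_diff_1 act_mult less_eq_Suc_le One_nat_def power_Suc)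
  have "?S \<inter> {x. ?f x = 0} = kernel ([:- c, 1:] ^ (k - 1))"
    unfolding kernel_def by (auto simp: k' pm.scale_zero_right)
  moreover have "?f ` ?S = {y. u y = c *s y \<and> y \<in> range ?f}"
    unfolding kernel_def k' by (auto simp: act_linear_factor)
  moreover have "dim ?S = dim (?f ` ?S) + dim (?S \<inter> {x. ?f x = 0})"
    by (rule rank_nullity[OF linear_act pm_subspace_imp[OF pm_subspace_kernel]])
  ultimately show ?thesis
    unfolding jordan_number_def ker_pow_dim_def funpow_linear_factor kernel_def by simp
qed

end

section \<open>Quotients of a diagonalizable map by a unipotent map of index two\<close>

text \<open>\<open>A_A\<close> says that \<open>(A - a) (A - b) = 0\<close>; as \<open>a\<close> and
  \<open>b\<close> differ, \<open>A\<close> is diagonalizable and the space is the sum of its two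
  eigenspaces.\<close>

locale split_pair = fd_endo +
  fixes A N :: "'b \<Rightarrow> 'b" and a b :: 'a
  assumes linear_A: "Vector_Spaces.linear (*s) (*s) A" and linear_N: "Vector_Spaces.linear (*s) (*s) N"
    and A_A: "A (A x) = (a + b) *s A x - (a * b) *s x" and N_N: "N (N x) = 0"
    and u_eq: "u x = A (x - N x)" and ab: "a \<noteq> b" "a \<noteq> 0" "b \<noteq> 0"
begin

lemmas A_simps = linear_maps[OF linear_A]
lemmas N_simps = linear_maps[OF linear_N]

definition w :: "'b \<Rightarrow> 'b" where
  "w x = (a + b) *s N x - A (N x) - N (A x)"

lemmas vs_simps = scale_right_distrib scale_left_distrib scale_right_diff_distrib
  scale_left_diff_distrib

lemma linear_w: "Vector_Spaces.linear (*s) (*s) w"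
  by (rule linear_mapI) (simp_all add: w_def A_simps N_simps vs_simps algebra_simps)

lemmas w_simps = linear_maps[OF linear_w]

lemma N_w: "N (w x) = w (N x)"
  by (simp add: w_def A_simps N_simps N_N)

text \<open>Once \<open>A (A y)\<close> is rewritten by \<open>A_A\<close>, both sides become
  \<open>a b N x - A N A x\<close>.\<close>

lemma A_w: "A (w x) = w (A x)"
proof -
  define t d where "t = a + b" and "d = a * b"
  have AA: "A (A y) = t *s A y - d *s y" for y by (simp add: A_A t_def d_def)
  show ?thesis unfolding w_def t_def[symmetric] by (simp add: A_simps N_simps AA)
qed

lemma u_w: "u (w x) = w (u x)"
  by (simp add: u_eq A_w N_w w_simps A_simps)

lemma u_w_eq: "u (w x) = act ([:- a, 1:] * [:- b, 1:]) x"
proof -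
  define t d where "t = a + b" and "d = a * b"
  have AA: "A (A y) = t *s A y - d *s y" for y by (simp add: A_A t_def d_def)
  have "act ([:- a, 1:] * [:- b, 1:]) x = u (u x) - t *s u x + d *s x"
    by (simp only: act_mult act_linear_factor u_diff u_scale t_def d_def)
      (simp add: vs_simps algebra_simps)
  then show ?thesis
    unfolding w_def t_def[symmetric] by (simp add: u_eq A_simps N_simps AA N_N vs_simps algebra_simps)
qed

lemma w_pow_linear: "Vector_Spaces.linear (*s) (*s) (w ^^ m)"
proof (rule linear_mapI)
  show "(w ^^ m) (x + y) = (w ^^ m) x + (w ^^ m) y" for x y
    by (induction m) (simp_all add: w_simps)
  show "(w ^^ m) (c *s x) = c *s (w ^^ m) x" for c x
    by (induction m) (simp_all add: w_simps)
qed

lemmas w_pow_simps = linear_maps[OF w_pow_linear]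

lemma w_pow_commute:
  assumes "\<And>x. f (w x) = w (f x)" shows "f ((w ^^ m) x) = (w ^^ m) (f x)"
  by (induction m) (simp_all add: assms)

lemma act_pow_w: "act ([:- a, 1:] ^ m) (act ([:- b, 1:] ^ m) x) = (u ^^ m) ((w ^^ m) x)"
proof -
  have "act (([:- a, 1:] * [:- b, 1:]) ^ m) x = (u ^^ m) ((w ^^ m) x)"
  proof (induction m)
    case (Suc m)
    have "act (([:- a, 1:] * [:- b, 1:]) ^ Suc m) x = u (w ((u ^^ m) ((w ^^ m) x)))"
      unfolding power_Suc act_mult[of "[:- a, 1:] * [:- b, 1:]"] Suc u_w_eq ..
    also have "w ((u ^^ m) ((w ^^ m) x)) = (u ^^ m) (w ((w ^^ m) x))"
    proof -
      have "w ((u ^^ i) y) = (u ^^ i) (w y)" for i y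
        by (induction i) (simp_all add: u_w[symmetric])
      then show ?thesis .
    qed
    finally show ?case by simp
  qed (simp add: act_one)
  then show ?thesis by (simp only: power_mult_distrib act_mult)
qed

lemma funpow_eigenvector: "u y = c *s y \<Longrightarrow> (u ^^ m) y = c ^ m *s y"
  by (induction m) (simp_all add: u_scale mult.commute)

text \<open>\<open>(u - a)^m (u - b)^m = u^m w^m\<close>, and on the eigenvector \<open>y\<close>
  both \<open>u - b\<close> and \<open>u\<close> act as nonzero scalars, \<open>a - b\<close> and
  \<open>a\<close>. Dividing by these scalars converts a preimage of one kind into one of the
  other.\<close>

lemma range_w_pow:
  assumes y: "u y = a *s y"
  shows "y \<in> range (act ([:- a, 1:] ^ m)) \<longleftrightarrow> y \<in> range (w ^^ m)"
proof
  assume "y \<in> range (act ([:- a, 1:] ^ m))"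
  then obtain x where x: "y = act ([:- a, 1:] ^ m) x" by blast
  have "(a - b) ^ m *s y = act ([:- b, 1:] ^ m) y"
    using act_eigenvector[OF y, of "[:- b, 1:] ^ m"] by (simp add: poly_power)
  also have "\<dots> = (u ^^ m) ((w ^^ m) x)"
    unfolding x act_pow_w[symmetric] by (simp only: act_mult[symmetric] mult.commute)
  also have "\<dots> = (w ^^ m) ((u ^^ m) x)"
    by (rule w_pow_commute) (induction m, simp_all add: u_w)
  finally have "y = (w ^^ m) (inverse ((a - b) ^ m) *s (u ^^ m) x)"
    using ab by (simp add: w_pow_simps) (metis inverse_eq_divide scale_one scale_scale
        left_inverse power_not_zero right_minus_eq)
  then show "y \<in> range (w ^^ m)" by blast
next
  assume "y \<in> range (w ^^ m)"
  then obtain x where x: "y = (w ^^ m) x" by blast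
  have "a ^ m *s y = act ([:- a, 1:] ^ m) (act ([:- b, 1:] ^ m) x)"
    unfolding act_pow_w x[symmetric] funpow_eigenvector[OF y] ..
  then have "y = act ([:- a, 1:] ^ m) (inverse (a ^ m) *s act ([:- b, 1:] ^ m) x)"
    using ab unfolding act_scale_right by (metis scale_one scale_scale left_inverse power_not_zero)
  then show "y \<in> range (act ([:- a, 1:] ^ m))" by blast
qed

definition V where "V = {x. A x = a *s x}"

lemma u_inj: "u x = 0 \<Longrightarrow> x = 0"
proof -
  assume u: "u x = 0"
  have A0: "y = 0" if "A y = 0" for y
    using A_A[of y] that A_simps(5) ab by simp
  have "A (x - N x) = 0" using u by (simp only: u_eq)
  then have "x - N x = 0" by (rule A0)
  then have "x = N x" by simp
  then have "N x = 0" using N_N by metis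
  then show "x = 0" using \<open>x = N x\<close> by simp
qed

text \<open>For an eigenvector \<open>x\<close> of \<open>u\<close> at \<open>a\<close>,
  \<open>w x = 0\<close> and \<open>N x\<close> satisfies the eigenvector equation of
  \<open>A\<close> at \<open>b\<close>. A suitable multiple of \<open>N x\<close> therefore corrects
  \<open>x\<close> to a vector in \<open>V\<close>. The correction \<open>f\<close> has inverse
  \<open>g\<close>, and both commute with \<open>w\<close>, so images of powers of \<open>w\<close>
  correspond.\<close>

lemma jordan_number_eq:
  assumes k: "k \<ge> 1"
  shows "jordan_number (*s) u a k = dim (V \<inter> {x. w x = 0} \<inter> range (w ^^ (k - 1)))"
proof -
  let ?J = "{y. u y = a *s y \<and> y \<in> range (w ^^ (k - 1))}"
  let ?J' = "V \<inter> {x. w x = 0} \<inter> range (w ^^ (k - 1))"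
  \<comment> \<open>The solution of \<open>(1 - c) b = - c a\<close>, which is what
    \<open>A (f x) = a f x\<close> amounts to once \<open>A (N x) = b N x\<close> is known.\<close>
  define c where "c = b / (b - a)"
  have c: "(1 - c) * b = - (c * a)" using ab by (simp add: c_def field_simps)
  define f where "f x = x - c *s N x" for x
  define g where "g x = x + c *s N x" for x
  have f: "Vector_Spaces.linear (*s) (*s) f"
    by (rule linear_mapI) (simp_all add: f_def N_simps vs_simps algebra_simps)
  have fg: "f (g x) = x" and gf: "g (f x) = x" for x
    by (simp_all add: f_def g_def N_simps N_N)
  have fJ: "f x \<in> ?J'" if x: "x \<in> ?J" for x
  proof -
    have ux: "u x = a *s x" using x by blast
    have "u (w x) = act [:- b, 1:] (act [:- a, 1:] x)"
      unfolding u_w_eq by (simp only: act_mult[symmetric] mult.commute)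
    also have "act [:- a, 1:] x = 0" unfolding act_linear_factor ux by simp
    finally have w0: "w x = 0" using u_inj by (simp only: pm.scale_zero_right)
    \<comment> \<open>As \<open>N N = 0\<close>, the only term of \<open>N (w x)\<close> that
      survives is \<open>- N (A (N x))\<close>.\<close>
    have "N (w x) = 0" unfolding w0 by (rule N_simps(5))
    then have NAN: "N (A (N x)) = 0" by (simp add: w_def N_simps N_N)
    have Ax: "A x = a *s x + A (N x)" using ux by (simp add: u_eq A_simps algebra_simps)
    have "N (A x) = a *s N x" unfolding Ax N_simps NAN by simp
    then have AN: "A (N x) = b *s N x" using w0 by (simp add: w_def vs_simps algebra_simps)
    have "A (f x) = a *s x + ((1 - c) * b) *s N x"
      unfolding f_def A_simps Ax AN by (simp add: vs_simps algebra_simps)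
    also have "\<dots> = a *s f x" unfolding c f_def by (simp add: vs_simps mult.commute)
    finally have "f x \<in> V" unfolding V_def by blast
    moreover have "w (f x) = 0"
      unfolding f_def w_simps N_w[symmetric] w0 N_simps by simp
    moreover have "f x \<in> range (w ^^ (k - 1))"
    proof -
      obtain z where z: "x = (w ^^ (k - 1)) z" using x by blast
      have "f x = (w ^^ (k - 1)) (f z)"
        unfolding z by (rule w_pow_commute) (simp add: f_def w_simps N_w)
      then show ?thesis by blast
    qed
    ultimately show ?thesis by blast
  qed
  have gJ: "g x \<in> ?J" if x: "x \<in> ?J'" for x
  proof -
    have Ax: "A x = a *s x" and w0: "w x = 0" using x unfolding V_def by blast+
    have AN: "A (N x) = b *s N x" using w0 by (simp add: w_def Ax N_simps vs_simps algebra_simps)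
    have "u (g x) = a *s x - ((1 - c) * b) *s N x"
      unfolding g_def u_eq by (simp add: A_simps N_simps N_N Ax AN vs_simps algebra_simps)
    also have "\<dots> = a *s g x" unfolding c g_def by (simp add: vs_simps mult.commute)
    finally have "u (g x) = a *s g x" .
    moreover have "g x \<in> range (w ^^ (k - 1))"
    proof -
      obtain z where z: "x = (w ^^ (k - 1)) z" using x by blast
      have "g x = (w ^^ (k - 1)) (g z)"
        unfolding z by (rule w_pow_commute) (simp add: g_def w_simps N_w)
      then show ?thesis by blast
    qed
    ultimately show ?thesis by blast
  qed
  have J: "subspace ?J"
  proof -
    have "subspace {y. u y - a *s y = 0}"
      by (rule linear_kernel_subspace, rule linear_mapI)
        (simp_all add: u_add u_scale vs_simps algebra_simps)
    then have "subspace ({y. u y - a *s y = 0} \<inter> range (w ^^ (k - 1)))"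
      by (rule subspace_inter) (rule linear_image_subspace[OF w_pow_linear subspace_UNIV])
    moreover have "?J = {y. u y - a *s y = 0} \<inter> range (w ^^ (k - 1))" by auto
    ultimately show ?thesis by simp
  qed
  have "f ` ?J = ?J'"
  proof (intro equalityI subsetI)
    fix y assume "y \<in> ?J'"
    then have "g y \<in> ?J" by (rule gJ)
    then have "f (g y) \<in> f ` ?J" by (rule imageI)
    then show "y \<in> f ` ?J" unfolding fg .
  next
    fix y assume "y \<in> f ` ?J"
    then obtain x where "x \<in> ?J" "y = f x" by (elim imageE)
    then show "y \<in> ?J'" using fJ[of x] by (simp only:)
  qed
  moreover have "?J \<inter> {x. f x = 0} = {0}"
  proof -
    have "x = 0" if "f x = 0" for x using gf[of x] that by (simp add: g_def N_simps)
    then show ?thesis using subspace_0[OF J] linear_maps(5)[OF f] by blast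
  qed
  moreover have "dim {0} = 0" by simp
  ultimately have "dim ?J = dim ?J'" using rank_nullity[OF f J] by simp
  moreover have "{y. u y = a *s y \<and> y \<in> range (act ([:- a, 1:] ^ (k - 1)))} = ?J"
    using range_w_pow by blast
  ultimately show ?thesis using jordan_number_image[OF k, of a] by simp
qed

lemma subspace_V: "subspace V"
proof -
  have "subspace {y. A y - a *s y = 0}"
    by (rule linear_kernel_subspace, rule linear_mapI)
      (simp_all add: A_simps vs_simps algebra_simps)
  then show ?thesis unfolding V_def by simp
qed

text \<open>\<open>A - b\<close> is \<open>a - b\<close> times the projection onto \<open>V\<close>
  along the other eigenspace.\<close>

lemma project_V: "A x - b *s x \<in> V"
  unfolding V_def by (simp add: A_simps A_A vs_simps algebra_simps)

text \<open>\<open>w\<close> commutes with \<open>A\<close> and hence with the projection onto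
  \<open>V\<close>, so a preimage under a power of \<open>w\<close> can be projected into
  \<open>V\<close>.\<close>

lemma V_range: "V \<inter> range (w ^^ m) = (w ^^ m) ` V"
proof (intro equalityI subsetI)
  fix x assume "x \<in> V \<inter> range (w ^^ m)"
  then obtain z where z: "x = (w ^^ m) z" and x: "A x = a *s x" unfolding V_def by blast
  have "(a - b) *s x = A x - b *s x" unfolding x by (simp add: vs_simps)
  also have "\<dots> = (w ^^ m) (A z - b *s z)"
    unfolding z w_pow_simps using w_pow_commute[of A m z] A_w by simp
  finally have "x = (w ^^ m) (inverse (a - b) *s (A z - b *s z))"
    unfolding w_pow_simps(2) using ab
    by (metis left_inverse right_minus_eq scale_one scale_scale)
  moreover have "inverse (a - b) *s (A z - b *s z) \<in> V"
    using subspace_scale[OF subspace_V project_V] .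
  ultimately show "x \<in> (w ^^ m) ` V" by blast
next
  fix x assume "x \<in> (w ^^ m) ` V"
  then obtain z where z: "x = (w ^^ m) z" "A z = a *s z" unfolding V_def by blast
  have "A x = (w ^^ m) (A z)" unfolding z(1) using w_pow_commute[of A m z] A_w by simp
  then have "x \<in> V" unfolding V_def using z by (simp add: w_pow_simps)
  then show "x \<in> V \<inter> range (w ^^ m)" using z by blast
qed

end

text \<open>The hypotheses are symmetric in \<open>a\<close> and \<open>b\<close>, so each result on
  the eigenspace at \<open>a\<close> also yields one on the eigenspace at \<open>b\<close>.\<close>

lemma (in split_pair) swap: "split_pair (*s) Basis u A N b a"
proof unfold_locales
  fix x
  show "A (A x) = (b + a) *s A x - (b * a) *s x"
    by (simp only: A_A add.commute[of b a] mult.commute[of b a])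
qed (simp_all add: A_simps N_simps N_N u_eq ab ab(1)[symmetric])

text \<open>On \<open>V\<close>, \<open>w^2\<close> factors through the other eigenspace, so
  \<open>w^(m + 2)\<close> maps \<open>V\<close> into the image under \<open>\<psi>\<close> of
  \<open>Z\<close>, the \<open>w^m\<close>-image of that eigenspace. The kernel of \<open>w\<close>
  on a homomorphic image of \<open>Z\<close> is no larger than on \<open>Z\<close>, since in finite
  dimension it has the size of the cokernel.\<close>

theorem (in split_pair) jordan_number_le:
  assumes k: "k \<ge> 1"
  shows "jordan_number (*s) u a (k + 2) \<le> jordan_number (*s) u b k"
proof -
  interpret sym: split_pair "(*s)" Basis u A N b a by (rule swap)
  have w_sym: "sym.w = w" by (intro ext) (simp add: w_def sym.w_def add.commute)
  define m where "m = k - 1"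
  \<comment> \<open>Up to the factor \<open>a - b\<close>, \<open>\<psi>\<close> is \<open>N\<close>
    followed by the projection onto \<open>V\<close>; on \<open>V\<close> it agrees with
    \<open>- w\<close>.\<close>
  define \<psi> where "\<psi> y = A (N y) - b *s N y" for y
  have \<psi>: "Vector_Spaces.linear (*s) (*s) \<psi>"
    by (rule linear_mapI) (simp_all add: \<psi>_def A_simps N_simps vs_simps algebra_simps)
  have \<psi>w: "\<psi> (w x) = w (\<psi> x)" for x by (simp add: \<psi>_def N_w A_w w_simps)
  have w_\<psi>: "w x = - \<psi> x" if "x \<in> V" for x
    using that unfolding V_def by (simp add: w_def \<psi>_def N_simps vs_simps algebra_simps)
  have ww: "w (w x) \<in> \<psi> ` sym.V" if x: "x \<in> V" for x
  proof -
    \<comment> \<open>\<open>\<psi> x\<close> and \<open>y\<close> are, up to scalars, the two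
      components of \<open>N x\<close> along the eigenspaces of \<open>A\<close>. As
      \<open>\<psi>\<close> kills \<open>N x\<close>, it takes the same value on both, and
      \<open>y\<close> lies in the other eigenspace.\<close>
    define y where "y = A (N x) - a *s N x"
    have wx: "w x \<in> V" using x unfolding V_def by (simp add: A_w w_simps)
    have "\<psi> x - y = (a - b) *s N x" by (simp add: \<psi>_def y_def vs_simps)
    then have "\<psi> (\<psi> x) - \<psi> y = (a - b) *s \<psi> (N x)"
      using linear_maps(2,3)[OF \<psi>] by metis
    also have "\<psi> (N x) = 0" by (simp add: \<psi>_def N_N A_simps)
    finally have "\<psi> (\<psi> x) = \<psi> y" by simp
    moreover have "w (w x) = \<psi> (\<psi> x)"
      unfolding w_\<psi>[OF wx] unfolding w_\<psi>[OF x] using linear_maps(4)[OF \<psi>] by simp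
    ultimately have "w (w x) = \<psi> y" by simp
    moreover have "y \<in> sym.V" unfolding y_def by (rule sym.project_V)
    ultimately show ?thesis by blast
  qed
  let ?K = "{x. w x = 0}"
  define Z where "Z = (w ^^ m) ` sym.V"
  have Z: "subspace Z" unfolding Z_def by (rule linear_image_subspace[OF w_pow_linear sym.subspace_V])
  have wZ: "w ` Z \<subseteq> Z"
  proof
    fix y assume "y \<in> w ` Z"
    then obtain x where x: "x \<in> sym.V" "y = w ((w ^^ m) x)" unfolding Z_def by blast
    have "w x \<in> sym.V" using x(1) unfolding sym.V_def by (simp add: A_w w_simps)
    moreover have "y = (w ^^ m) (w x)" unfolding x(2) by (simp add: funpow_swap1)
    ultimately show "y \<in> Z" unfolding Z_def by blast
  qed
  have sub: "V \<inter> ?K \<inter> range (w ^^ (m + 2)) \<subseteq> \<psi> ` Z \<inter> ?K"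
  proof
    fix x assume x: "x \<in> V \<inter> ?K \<inter> range (w ^^ (m + 2))"
    then have "x \<in> (w ^^ (m + 2)) ` V" using V_range by blast
    then obtain z where z: "z \<in> V" "x = (w ^^ (m + 2)) z" by blast
    then have "x = (w ^^ m) (w (w z))" by (simp add: funpow_swap1)
    moreover obtain y where y: "y \<in> sym.V" "w (w z) = \<psi> y" using ww[OF z(1)] by blast
    ultimately have "x = \<psi> ((w ^^ m) y)" using w_pow_commute[of \<psi> m y] \<psi>w by simp
    then show "x \<in> \<psi> ` Z \<inter> ?K" unfolding Z_def using x y(1) by blast
  qed
  have \<psi>Z: "subspace (\<psi> ` Z)" by (rule linear_image_subspace[OF \<psi> Z])
  have w_\<psi>_Z: "w ` \<psi> ` Z = \<psi> ` w ` Z" unfolding image_image \<psi>w ..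
  let ?L = "{x. \<psi> x = 0}"
  have sL: "subspace ?L" by (rule linear_kernel_subspace[OF \<psi>])
  have swZ: "subspace (w ` Z)" by (rule linear_image_subspace[OF linear_w Z])
  have "jordan_number (*s) u a (k + 2) = dim (V \<inter> ?K \<inter> range (w ^^ (m + 2)))"
    using jordan_number_eq[of "k + 2"] k by (simp add: m_def)
  also have "\<dots> \<le> dim (\<psi> ` Z \<inter> ?K)" by (rule dim_subset[OF sub])
  \<comment> \<open>Rank-nullity for \<open>w\<close> on a stable subspace: the dimension of the
    kernel is that of the space minus that of its image.\<close>
  also have "\<dots> = dim (\<psi> ` Z) - dim (\<psi> ` w ` Z)"
    using rank_nullity[OF linear_w \<psi>Z] unfolding w_\<psi>_Z by simp
  also have "\<dots> \<le> dim Z - dim (w ` Z)"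
  proof -
    \<comment> \<open>Since \<open>w\<close> maps \<open>Z\<close> into itself,
      \<open>\<psi>\<close> loses at most as many dimensions on the image of \<open>Z\<close> under
      \<open>w\<close> as on \<open>Z\<close>, so the codimension cannot grow.\<close>
    have "dim (w ` Z \<inter> ?L) \<le> dim (Z \<inter> ?L)" using wZ by (intro dim_subset) blast
    then show ?thesis using rank_nullity[OF \<psi> Z] rank_nullity[OF \<psi> swZ] by simp
  qed
  also have "\<dots> = dim (Z \<inter> ?K)" using rank_nullity[OF linear_w Z] by simp
  also have "Z \<inter> ?K = sym.V \<inter> ?K \<inter> range (w ^^ m)"
    using sym.V_range[of m] unfolding w_sym Z_def by blast
  also have "dim \<dots> = jordan_number (*s) u b k"
    using sym.jordan_number_eq[OF k] unfolding w_sym m_def by simp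
  finally show ?thesis .
qed

section \<open>Cyclic modules as quotients\<close>

lemma linear_powers_dvd_iff:
  fixes a b :: "'a::field"
  assumes "a \<noteq> b"
  shows "[:- a, 1:] ^ m * [:- b, 1:] ^ n dvd h \<longleftrightarrow> [:- a, 1:] ^ m dvd h \<and> [:- b, 1:] ^ n dvd h"
proof
  assume "[:- a, 1:] ^ m * [:- b, 1:] ^ n dvd h"
  then show "[:- a, 1:] ^ m dvd h \<and> [:- b, 1:] ^ n dvd h"
    by (blast intro: dvd_mult_left dvd_mult_right)
next
  assume *: "[:- a, 1:] ^ m dvd h \<and> [:- b, 1:] ^ n dvd h"
  then obtain k where k: "h = [:- b, 1:] ^ n * k" by (blast elim: dvdE)
  have "poly ([:- a, 1:] ^ m) b \<noteq> 0" using assms by simp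
  then have "[:- a, 1:] ^ m dvd k" by (rule dvd_linear_power_mult_cancel) (use * k in simp)
  then show "[:- a, 1:] ^ m * [:- b, 1:] ^ n dvd h"
    unfolding k by (simp add: mult.commute mult_dvd_mono)
qed

context fd_endo
begin

lemma free_linear_extend:
  assumes "free bs"
  shows "\<exists>f. Vector_Spaces.linear (*s) (*s) f \<and> (\<forall>j<length bs. f (bs ! j) = g j)"
proof -
  interpret pair: vector_space_pair "(*s)" "(*s)" by unfold_locales
  have ind: "independent (set bs)" and inj: "inj_on ((!) bs) {..<length bs}"
    using assms unfolding free_def by (auto intro: inj_on_nth)
  obtain f where f: "Vector_Spaces.linear (*s) (*s) f"
    "\<forall>b\<in>set bs. f b = g (the_inv_into {..<length bs} ((!) bs) b)"
    using pair.linear_independent_extend[OF ind, of "\<lambda>b. g (the_inv_into {..<length bs} ((!) bs) b)"]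
    by blast
  have "f (bs ! j) = g j" if "j < length bs" for j
    using f(2) that the_inv_into_f_f[OF inj, of j] by simp
  then show ?thesis using f(1) by blast
qed

lemma linear_eq_zero_on_span:
  assumes f: "Vector_Spaces.linear (*s) (*s) f" and "\<And>j. j < length bs \<Longrightarrow> f (bs ! j) = 0"
    and x: "x \<in> span (set bs)"
  shows "f x = 0"
proof -
  have "set bs \<subseteq> {x. f x = 0}" using assms(2) by (auto simp: in_set_conv_nth)
  then have "span (set bs) \<subseteq> {x. f x = 0}" by (rule span_minimal) (rule linear_kernel_subspace[OF f])
  then show ?thesis using x by blast
qed

lemma projection_exists:
  assumes S: "subspace S" and T: "subspace T" and ST: "S \<inter> T = {0}"
  shows "\<exists>f. Vector_Spaces.linear (*s) (*s) f \<and> (\<forall>x\<in>S. f x = x) \<and> (\<forall>x\<in>T. f x = 0)"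
proof -
  obtain bs cs where bs: "free bs" "span (set bs) = S" and cs: "free cs" "span (set cs) = T"
    using subspace_free_basis[OF S] subspace_free_basis[OF T] by blast
  have "free (bs @ cs)" using bs cs ST free_append by blast
  then obtain f where f: "Vector_Spaces.linear (*s) (*s) f"
    and fj: "\<forall>j<length (bs @ cs). f ((bs @ cs) ! j) = (if j < length bs then bs ! j else 0)"
    using free_linear_extend[of "bs @ cs" "\<lambda>j. if j < length bs then bs ! j else 0"] by blast
  have fb: "f (bs ! j) = bs ! j" if "j < length bs" for j
    using spec[OF fj, of j] that by (simp add: nth_append)
  have fc: "f (cs ! j) = 0" if "j < length cs" for j
    using spec[OF fj, of "length bs + j"] that by (simp add: nth_append)
  have "Vector_Spaces.linear (*s) (*s) (\<lambda>x. f x - x)"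
    by (rule linear_mapI) (simp_all add: linear_maps[OF f] scale_right_diff_distrib)
  then have "f x - x = 0" if "x \<in> S" for x
    using linear_eq_zero_on_span[of "\<lambda>x. f x - x" bs x] fb bs(2) that by simp
  moreover have "f x = 0" if "x \<in> T" for x
    using linear_eq_zero_on_span[OF f, of cs x] fc cs(2) that by simp
  ultimately show ?thesis using f by auto
qed

text \<open>\<open>A\<close> and \<open>B\<close> are linear on the whole space but constrained only
  on \<open>W\<close>, because a subspace is a set and not a type. \<open>B\<close> is unipotent
  with \<open>(B - 1)^2 = 0\<close>, and \<open>u\<close> is expressed as \<open>A\<close> times the
  inverse of \<open>B\<close> without mentioning the inverse.\<close>

definition quotient_on :: "'a \<Rightarrow> 'a \<Rightarrow> 'b set \<Rightarrow> bool" where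
  "quotient_on a b W \<longleftrightarrow> (\<exists>A B. Vector_Spaces.linear (*s) (*s) A \<and> Vector_Spaces.linear (*s) (*s) B \<and>
    (\<forall>x\<in>W. A x \<in> W \<and> B x \<in> W \<and> A (A x) = (a + b) *s A x - (a * b) *s x \<and>
      B (B x) = B x + B x - x \<and> u (B x) = A x))"

lemma quotient_on_commute: "quotient_on a b W \<Longrightarrow> quotient_on b a W"
  unfolding quotient_on_def by (simp only: add.commute[of b a] mult.commute[of b a])

lemma quotient_on_plus:
  assumes S: "subspace S" "quotient_on a b S" and T: "subspace T" "quotient_on a b T"
    and ST: "S \<inter> T = {0}"
  shows "quotient_on a b (S + T)"
proof -
  obtain f where f: "Vector_Spaces.linear (*s) (*s) f" "\<And>x. x \<in> S \<Longrightarrow> f x = x" "\<And>x. x \<in> T \<Longrightarrow> f x = 0"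
    using projection_exists[OF S(1) T(1) ST] by blast
  obtain A1 B1 where 1: "Vector_Spaces.linear (*s) (*s) A1" "Vector_Spaces.linear (*s) (*s) B1"
    and S1: "\<And>x. x \<in> S \<Longrightarrow> A1 x \<in> S \<and> B1 x \<in> S \<and> A1 (A1 x) = (a + b) *s A1 x - (a * b) *s x \<and>
      B1 (B1 x) = B1 x + B1 x - x \<and> u (B1 x) = A1 x" using S(2) unfolding quotient_on_def by blast
  obtain A2 B2 where 2: "Vector_Spaces.linear (*s) (*s) A2" "Vector_Spaces.linear (*s) (*s) B2"
    and T2: "\<And>x. x \<in> T \<Longrightarrow> A2 x \<in> T \<and> B2 x \<in> T \<and> A2 (A2 x) = (a + b) *s A2 x - (a * b) *s x \<and>
      B2 (B2 x) = B2 x + B2 x - x \<and> u (B2 x) = A2 x" using T(2) unfolding quotient_on_def by blast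
  \<comment> \<open>\<open>f\<close> is the projection onto \<open>S\<close> that kills
    \<open>T\<close>, so \<open>f x\<close> and \<open>x - f x\<close> are the components of a
    vector \<open>x\<close> of \<open>S + T\<close>.\<close>
  define glue where "glue g h x = g (f x) + h (x - f x)" for g h :: "'b \<Rightarrow> 'b" and x
  have lin: "Vector_Spaces.linear (*s) (*s) (glue g h)"
    if g: "Vector_Spaces.linear (*s) (*s) g" and h: "Vector_Spaces.linear (*s) (*s) h" for g h
    by (rule linear_mapI)
      (simp_all add: glue_def linear_maps[OF f(1)] linear_maps[OF g] linear_maps[OF h]
        scale_right_distrib scale_right_diff_distrib)
  have glue: "glue g h (s + t) = g s + h t" if "s \<in> S" "t \<in> T" for g h s t
    using f that by (simp add: glue_def linear_maps[OF f(1)])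
  have "glue A1 A2 x \<in> S + T \<and> glue B1 B2 x \<in> S + T \<and>
      glue A1 A2 (glue A1 A2 x) = (a + b) *s glue A1 A2 x - (a * b) *s x \<and>
      glue B1 B2 (glue B1 B2 x) = glue B1 B2 x + glue B1 B2 x - x \<and>
      u (glue B1 B2 x) = glue A1 A2 x" if x: "x \<in> S + T" for x
  proof -
    obtain s t where st: "s \<in> S" "t \<in> T" "x = s + t" using x by (elim set_plus_elim)
    have 1: "A1 s \<in> S" "B1 s \<in> S" and 2: "A2 t \<in> T" "B2 t \<in> T" using S1 T2 st by blast+
    have "glue A1 A2 (A1 s + A2 t) = A1 (A1 s) + A2 (A2 t)"
      "glue B1 B2 (B1 s + B2 t) = B1 (B1 s) + B2 (B2 t)" by (rule glue[OF 1(1) 2(1)], rule glue[OF 1(2) 2(2)])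
    moreover have "A1 (A1 s) = (a + b) *s A1 s - (a * b) *s s" "A2 (A2 t) = (a + b) *s A2 t - (a * b) *s t"
      "B1 (B1 s) = B1 s + B1 s - s" "B2 (B2 t) = B2 t + B2 t - t" "u (B1 s) = A1 s" "u (B2 t) = A2 t"
      using S1 T2 st by blast+
    ultimately show ?thesis
      unfolding st(3) glue[OF st(1,2)]
      using set_plus_intro[OF 1(1) 2(1)] set_plus_intro[OF 1(2) 2(2)]
      by (simp add: u_add scale_right_distrib)
  qed
  then show ?thesis unfolding quotient_on_def using lin[OF 1(1) 2(1)] lin[OF 1(2) 2(2)] by blast
qed

lemma quotient_on_dsum:
  "dsum W Ss \<Longrightarrow> \<forall>S\<in>set Ss. subspace S \<and> quotient_on a b S \<Longrightarrow> quotient_on a b W"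
proof (induction Ss arbitrary: W)
  case Nil
  have "Vector_Spaces.linear (*s) (*s) (\<lambda>x. 0)" by (rule linear_mapI) simp_all
  then show ?case using Nil unfolding quotient_on_def
    by (intro exI[of _ "\<lambda>x. 0"] exI[of _ "\<lambda>x. 0"]) (simp add: u_zero)
next
  case (Cons S Ss)
  then obtain W' where W': "dsum W' Ss" "S \<inter> W' = {0}" "W = S + W'" by auto
  have "subspace W'" by (rule dsum_subspaceI[OF _ W'(1)]) (use Cons.prems in simp)
  moreover have "quotient_on a b W'" by (rule Cons.IH[OF W'(1)]) (use Cons.prems in simp)
  ultimately show ?case unfolding W'(3) using quotient_on_plus W'(2) Cons.prems by simp
qed

text \<open>The basis below makes \<open>u\<close> a product of two block diagonal maps with blocks of size at most
  two: the blocks of the first factor join \<open>f j\<close> to \<open>f (Suc j)\<close> where \<open>E j\<close> holds,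
  those of the second one where it fails.\<close>

lemma staircase_exists:
  assumes ann: "pm.annihilator e (\<Prod>i<m. [:- d i, 1:])" and nz: "\<And>i. i < m \<Longrightarrow> d i \<noteq> 0"
  shows "\<exists>f. f 0 = e \<and> f m = 0 \<and> (\<forall>j. E j \<longrightarrow> f (Suc j) = u (f j) - d j *s f j) \<and>
    (\<forall>j. \<not> E j \<longrightarrow> u (f (Suc j)) = d j *s f j - u (f j)) \<and> (\<forall>j. f j \<in> pm.span {e})"
proof -
  define r where "r = (\<Prod>i<m. [:- d i, 1:])"
  have r0: "poly r 0 \<noteq> 0" using nz by (simp add: r_def poly_prod)
  obtain c s where r: "r = pCons c s" by (cases r)
  have c: "c \<noteq> 0" using r0 by (simp add: r)
  \<comment> \<open>\<open>g\<close> inverts \<open>u\<close> on the cyclic module: \<open>r\<close>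
    is \<open>c\<close> plus the indeterminate times \<open>s\<close>, so the indeterminate times
    \<open>g\<close> is 1 modulo \<open>r\<close>.\<close>
  define g where "g = smult (- inverse c) s"
  have "[:0, 1:] * g = 1 - smult (inverse c) r"
    using c by (simp add: g_def r one_pCons mult_pCons_left)
  then have inv: "u (act g x) = x" if "x \<in> pm.span {e}" for x
  proof -
    obtain h where x: "x = act h e" using \<open>x \<in> pm.span {e}\<close> unfolding pm.span_singleton by blast
    have "act r x = act h (act r e)" unfolding x by (simp only: act_mult[symmetric] mult.commute)
    also have "act r e = 0" using pm.annihilatorD[OF ann, of r] unfolding r_def by simp
    finally have rx: "act r x = 0" by (simp only: pm.scale_zero_right)
    have "u (act g x) = act ([:0, 1:] * g) x"
      unfolding act_mult by (simp only: act_pCons act_zero scale_zero_left) simp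
    also have "\<dots> = x"
      unfolding \<open>[:0, 1:] * g = 1 - smult (inverse c) r\<close>
      by (simp only: pm.scale_left_diff_distrib act_one act_smult rx scale_zero_right diff_zero)
    finally show ?thesis .
  qed
  \<comment> \<open>Each step applies \<open>u - d j\<close>, followed by \<open>- u^(-1)\<close>
    where \<open>E j\<close> fails. After \<open>m\<close> steps all factors of the annihilator have
    been applied, which makes \<open>f m\<close> vanish.\<close>
  define f where "f = rec_nat e (\<lambda>j x. if E j then act [:- d j, 1:] x else - act (g * [:- d j, 1:]) x)"
  have f0: "f 0 = e" and fS: "f (Suc j) =
      (if E j then act [:- d j, 1:] (f j) else - act (g * [:- d j, 1:]) (f j))" for j
    by (simp_all add: f_def)
  have f_act: "\<exists>h. f j = act (h * (\<Prod>i<j. [:- d i, 1:])) e" for j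
  proof (induction j)
    case 0
    show ?case by (rule exI[of _ 1]) (simp add: f0 act_one)
  next
    case (Suc j)
    then obtain h where h: "f j = act (h * (\<Prod>i<j. [:- d i, 1:])) e" by blast
    show ?case
    proof (cases "E j")
      case True
      have "f (Suc j) = act ([:- d j, 1:] * (h * (\<Prod>i<j. [:- d i, 1:]))) e"
        unfolding act_mult[of "[:- d j, 1:]"] using True by (simp add: fS h)
      then show ?thesis by (intro exI[of _ h]) (simp add: mult_ac)
    next
      case False
      have "f (Suc j) = act (- (g * [:- d j, 1:])) (f j)"
        using False by (simp add: fS pm.scale_minus_left)
      also have "\<dots> = act ((- (g * [:- d j, 1:])) * (h * (\<Prod>i<j. [:- d i, 1:]))) e"
        unfolding h act_mult ..
      also have "(- (g * [:- d j, 1:])) * (h * (\<Prod>i<j. [:- d i, 1:])) =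
          (- g * h) * (\<Prod>i<Suc j. [:- d i, 1:])" by (simp add: mult_ac)
      finally show ?thesis by blast
    qed
  qed
  have f_span: "f j \<in> pm.span {e}" for j
    using f_act[of j] unfolding pm.span_singleton by blast
  have "f m = 0"
  proof -
    obtain h where "f m = act (h * r) e" using f_act[of m] unfolding r_def by blast
    then show ?thesis using pm.annihilatorD[OF ann, of "h * r"] unfolding r_def by simp
  qed
  moreover have "u (f (Suc j)) = d j *s f j - u (f j)" if "\<not> E j" for j
  proof -
    have "act [:- d j, 1:] (f j) \<in> pm.span {e}" by (rule pm.span_scale[OF f_span])
    then have "u (act g (act [:- d j, 1:] (f j))) = act [:- d j, 1:] (f j)" by (rule inv)
    moreover have "u (f (Suc j)) = - u (act g (act [:- d j, 1:] (f j)))"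
      using that by (simp add: fS act_mult linear_maps[OF linear_u])
    ultimately show ?thesis by (simp add: act_linear_factor)
  qed
  ultimately show ?thesis using f0 f_span fS by (intro exI[of _ f]) (simp add: act_linear_factor)
qed

lemma free_if_spanning:
  assumes "dim (span (set bs)) = length bs" shows "free bs"
proof -
  have le: "dim (span (set bs)) \<le> card (set bs)" by (rule dim_le_card) simp_all
  then have "card (set bs) = length bs" using assms card_length[of bs] by simp
  then have "distinct bs" by (rule card_distinct)
  moreover have "independent (set bs)"
    by (rule card_le_dim_spanning[of "set bs" "span (set bs)"])
      (use assms card_length[of bs] span_superset in simp_all)
  ultimately show ?thesis unfolding free_def ..
qed

text \<open>As \<open>E\<close> alternates, the pairs joined by \<open>A\<close> are disjoint, and
  so are those joined by \<open>B\<close>. A triangular block with diagonal \<open>a\<close>,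
  \<open>b\<close> is killed by \<open>(t - a) (t - b)\<close> whatever its off-diagonal entry is;
  \<open>pairs\<close> ensures this diagonal. A pair cut off by \<open>f m = 0\<close> leaves a
  block of size one.\<close>

lemma quotient_on_staircase:
  assumes ann: "pm.annihilator e (\<Prod>i<m. [:- d i, 1:])" and a: "a \<noteq> 0" and b: "b \<noteq> 0"
    and d: "\<And>i. i < m \<Longrightarrow> d i = a \<or> d i = b"
    and E: "\<And>j. E (Suc j) \<longleftrightarrow> \<not> E j"
    and pairs: "\<And>j. E j \<Longrightarrow> Suc j < m \<Longrightarrow> d j = a \<and> d (Suc j) = b"
  shows "quotient_on a b (pm.span {e})"
proof -
  have nz: "d i \<noteq> 0" if "i < m" for i using d[OF that] a b by auto
  obtain f where f0: "f 0 = e" and fm: "f m = 0"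
    and fE: "\<And>j. E j \<Longrightarrow> f (Suc j) = u (f j) - d j *s f j"
    and fN: "\<And>j. \<not> E j \<Longrightarrow> u (f (Suc j)) = d j *s f j - u (f j)"
    and fspan: "\<And>j. f j \<in> pm.span {e}"
    using staircase_exists[OF ann nz, of E] by blast
  define bs where "bs = map f [0..<m]"
  have len: "length bs = m" and nth: "\<And>j. j < m \<Longrightarrow> bs ! j = f j" by (simp_all add: bs_def)
  let ?W = "span (set bs)"
  have f_in: "f j \<in> ?W" if "j \<le> m" for j
  proof (cases "j = m")
    case True
    then show ?thesis using fm span_zero by simp
  next
    case False
    then show ?thesis using that by (intro span_base) (simp add: bs_def)
  qed
  have uE: "u (f j) \<in> ?W" if "E j" "j < m" for j
  proof -
    have "u (f j) = f (Suc j) + d j *s f j" using fE[OF that(1)] by simp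
    then show ?thesis using f_in that by (simp add: span_add span_scale)
  qed
  \<comment> \<open>Where \<open>E j\<close> fails, \<open>u (f j)\<close> is known only through
    \<open>u (f (Suc j))\<close>. But then \<open>E (Suc j)\<close> holds, or
    \<open>f (Suc j)\<close> is \<open>f m = 0\<close>, so the regress stops after one step.\<close>
  have u_f: "u (f j) \<in> ?W" if j: "j < m" for j
  proof (cases "E j")
    case False
    have "u (f (Suc j)) \<in> ?W"
    proof (cases "Suc j = m")
      case True
      then show ?thesis using fm u_zero span_zero by simp
    next
      case False
      then show ?thesis using uE[of "Suc j"] E \<open>\<not> E j\<close> j by simp
    qed
    moreover have "u (f j) = d j *s f j - u (f (Suc j))" using fN[OF False] by simp
    ultimately show ?thesis using f_in[of j] j by (simp add: span_diff span_scale)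
  qed (rule uE[OF _ j])
  have u_W: "u x \<in> ?W" if x: "x \<in> ?W" for x
  proof -
    have "subspace {x. u x \<in> ?W}"
      by (rule subspaceI) (simp_all add: u_zero u_add u_scale span_zero span_add span_scale)
    moreover have "set bs \<subseteq> {x. u x \<in> ?W}" using u_f by (auto simp: bs_def)
    ultimately have "?W \<subseteq> {x. u x \<in> ?W}" by (intro span_minimal)
    then show ?thesis using x by blast
  qed
  have act_W: "act h x \<in> ?W" if "x \<in> ?W" for h x
    using that
  proof (induction h arbitrary: x)
    case (pCons c h)
    then show ?case using u_W by (simp add: act_pCons span_add span_scale)
  qed (simp add: act_zero span_zero)
  have W: "?W = pm.span {e}"
  proof
    show "?W \<subseteq> pm.span {e}"
      by (rule span_minimal) (use fspan in \<open>auto simp: bs_def intro: pm_subspace_imp\<close>)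
    have "e \<in> ?W" using f_in[of 0] f0 by simp
    then show "pm.span {e} \<subseteq> ?W" unfolding pm.span_singleton using act_W by blast
  qed
  \<comment> \<open>The cyclic module has dimension \<open>m\<close>, and it is spanned by the
    \<open>m\<close> vectors of the staircase; so these are independent.\<close>
  have "lead_coeff (\<Prod>i<m. [:- d i, 1:]) = 1"
    unfolding lead_coeff_prod by simp
  moreover have "degree (\<Prod>i<m. [:- d i, 1:]) = m"
    by (subst degree_prod_eq_sum_degree) simp_all
  ultimately have "dim ?W = m" using dim_cyclic[OF _ ann] unfolding W by simp
  then have free: "free bs" by (intro free_if_spanning) (simp only: len)
  obtain A where A: "Vector_Spaces.linear (*s) (*s) A"
    and "\<forall>j<length bs. A (bs ! j) = (if E j then d j *s f j + f (Suc j) else d j *s f j)"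
    using free_linear_extend[OF free, of "\<lambda>j. if E j then d j *s f j + f (Suc j) else d j *s f j"]
    by blast
  then have Af: "\<And>j. j < m \<Longrightarrow> A (f j) = (if E j then d j *s f j + f (Suc j) else d j *s f j)"
    by (simp add: len nth)
  obtain B where B: "Vector_Spaces.linear (*s) (*s) B"
    and "\<forall>j<length bs. B (bs ! j) = (if E j then f j else f j + f (Suc j))"
    using free_linear_extend[OF free, of "\<lambda>j. if E j then f j else f j + f (Suc j)"] by blast
  then have Bf: "\<And>j. j < m \<Longrightarrow> B (f j) = (if E j then f j else f j + f (Suc j))"
    by (simp add: len nth)
  note A_simps = linear_maps[OF A] and B_simps = linear_maps[OF B]
  have sub: "F x \<in> ?W" if F: "Vector_Spaces.linear (*s) (*s) F" and "\<And>j. j < m \<Longrightarrow> F (f j) \<in> ?W"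
    and x: "x \<in> ?W" for F x
  proof -
    have "subspace {x. F x \<in> ?W}"
      by (rule subspaceI) (simp_all add: linear_maps[OF F] span_zero span_add span_scale)
    moreover have "set bs \<subseteq> {x. F x \<in> ?W}" using that(2) by (auto simp: bs_def)
    ultimately have "?W \<subseteq> {x. F x \<in> ?W}" by (intro span_minimal)
    then show ?thesis using x by blast
  qed
  have dd: "d j * d j = (a + b) * d j - a * b" if "j < m" for j
    using d[OF that] by (auto simp: algebra_simps)
  have AA: "A (A (f j)) = (a + b) *s A (f j) - (a * b) *s f j" if j: "j < m" for j
  proof (cases "E j")
    case False
    then have "A (A (f j)) = (d j * d j) *s f j" using j by (simp add: Af A_simps)
    then show ?thesis using False j by (simp add: Af dd scale_left_diff_distrib)
  next
    case True
    have A1: "A (f j) = d j *s f j + f (Suc j)" using True j by (simp add: Af)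
    have "A (A (f j)) = (d j * d j) *s f j + (d j *s f (Suc j) + A (f (Suc j)))"
      unfolding A1 A_simps A1 by (simp add: scale_right_distrib)
    \<comment> \<open>Inside the staircase the two diagonal entries add up to \<open>a + b\<close>;
      at its end both sides vanish because \<open>f m = 0\<close>.\<close>
    also have "d j *s f (Suc j) + A (f (Suc j)) = (a + b) *s f (Suc j)"
    proof (cases "Suc j = m")
      case True
      then show ?thesis using fm A_simps(5) by simp
    next
      case False
      then have "A (f (Suc j)) = b *s f (Suc j)" "d j = a" using pairs[OF True] j E True by (simp_all add: Af)
      then show ?thesis by (simp add: scale_left_distrib)
    qed
    finally show ?thesis unfolding A1 by (simp add: dd j scale_left_diff_distrib scale_right_distrib)
  qed
  have BB: "B (B (f j)) = B (f j) + B (f j) - f j" if j: "j < m" for j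
  proof (cases "E j")
    case False
    have "B (f (Suc j)) = f (Suc j)"
    proof (cases "Suc j = m")
      case True
      then show ?thesis using fm B_simps(5) by simp
    next
      case F: False
      then show ?thesis using False j E by (simp add: Bf)
    qed
    then show ?thesis using False j by (simp add: Bf B_simps)
  qed (use j in \<open>simp add: Bf\<close>)
  have uB: "u (B (f j)) = A (f j)" if j: "j < m" for j
    using fE[of j] fN[of j] j by (cases "E j") (simp_all add: Af Bf u_add)
  have "A x \<in> ?W" "B x \<in> ?W" if "x \<in> ?W" for x
  proof -
    show "A x \<in> ?W" by (rule sub[OF A _ that]) (simp add: Af f_in span_add span_scale)
    show "B x \<in> ?W" by (rule sub[OF B _ that]) (simp add: Bf f_in span_add)
  qed
  moreover have "A (A x) = (a + b) *s A x - (a * b) *s x" if x: "x \<in> ?W" for x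
  proof -
    have "A (A x) - ((a + b) *s A x - (a * b) *s x) = 0"
      by (rule linear_eq_zero_on_span[OF _ _ x], rule linear_mapI)
        (simp_all add: len nth AA A_simps scale_right_distrib scale_right_diff_distrib algebra_simps)
    then show ?thesis by simp
  qed
  moreover have "B (B x) = B x + B x - x" if x: "x \<in> ?W" for x
  proof -
    have "B (B x) - (B x + B x - x) = 0"
      by (rule linear_eq_zero_on_span[OF _ _ x], rule linear_mapI)
        (simp_all add: len nth BB B_simps scale_right_distrib scale_right_diff_distrib)
    then show ?thesis by simp
  qed
  moreover have "u (B x) = A x" if x: "x \<in> ?W" for x
  proof -
    have "u (B x) - A x = 0"
      by (rule linear_eq_zero_on_span[OF _ _ x], rule linear_mapI)
        (simp_all add: len nth uB A_simps B_simps u_add u_scale scale_right_diff_distrib)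
    then show ?thesis by simp
  qed
  ultimately show ?thesis unfolding quotient_on_def W[symmetric] using A B
    by (intro exI[of _ A] exI[of _ B] conjI ballI) assumption+
qed

text \<open>The linear factors are ordered so that the pairs joined by \<open>A\<close> read
  \<open>a\<close>, \<open>b\<close>. A surplus \<open>a\<close> can stand alone before the first
  pair and another one after the last pair; this accommodates \<open>k\<close> up to 2.\<close>

lemma quotient_on_cyclic:
  assumes ann: "pm.annihilator e ([:- a, 1:] ^ (n + k) * [:- b, 1:] ^ n)"
    and a: "a \<noteq> 0" and b: "b \<noteq> 0" and k: "k \<in> {0, 1, 2}"
  shows "quotient_on a b (pm.span {e})"
proof (cases "k = 0")
  case True
  \<comment> \<open>The order \<open>a b a b ...\<close>, with pairs starting at the even
    positions.\<close>
  define d where "d i = (if even i then a else b)" for i :: nat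
  have "(\<Prod>i<2 * n. [:- d i, 1:]) = [:- a, 1:] ^ n * [:- b, 1:] ^ n"
    by (induction n) (simp_all add: d_def mult_ac)
  then have "pm.annihilator e (\<Prod>i<2 * n. [:- d i, 1:])" using ann True by simp
  then show ?thesis
    by (rule quotient_on_staircase[OF _ a b, where E = even]) (auto simp: d_def)
next
  case False
  \<comment> \<open>The order \<open>a\<close>, \<open>a b\<close>, \<open>a b\<close>, ..., with
    pairs starting at the odd positions; for \<open>k = 2\<close> the last position,
    \<open>2 * n + 1\<close>, is odd and again carries \<open>a\<close>.\<close>
  define d where "d i = (if i = 0 \<or> odd i then a else b)" for i :: nat
  have 1: "(\<Prod>i<Suc (2 * n). [:- d i, 1:]) = [:- a, 1:] ^ (n + 1) * [:- b, 1:] ^ n"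
    by (induction n) (simp_all add: d_def mult_ac)
  have "(\<Prod>i<2 * n + k. [:- d i, 1:]) = [:- a, 1:] ^ (n + k) * [:- b, 1:] ^ n"
  proof (cases "k = 1")
    case True
    then show ?thesis using 1 by simp
  next
    case F: False
    then have k2: "k = 2" using False k by simp
    have "(\<Prod>i<2 * n + k. [:- d i, 1:]) = (\<Prod>i<Suc (2 * n). [:- d i, 1:]) * [:- a, 1:]"
      by (simp add: k2 d_def)
    also have "\<dots> = [:- a, 1:] ^ (n + k) * [:- b, 1:] ^ n"
      unfolding 1 k2 by (simp add: mult_ac power2_eq_square)
    finally show ?thesis .
  qed
  then have "pm.annihilator e (\<Prod>i<2 * n + k. [:- d i, 1:])" using ann by simp
  then show ?thesis
    by (rule quotient_on_staircase[OF _ a b, where E = odd]) (auto simp: d_def)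
qed

text \<open>The Chinese remainder theorem. That \<open>e1 + e2\<close> generates the sum follows by
  comparing dimensions, both equal to \<open>m + n\<close>.\<close>

lemma cyclic_plus:
  assumes ab: "a \<noteq> b" and e1: "pm.annihilator e1 ([:- a, 1:] ^ m)" and e2: "pm.annihilator e2 ([:- b, 1:] ^ n)"
    and int: "pm.span {e1} \<inter> pm.span {e2} = {0}"
  shows "pm.annihilator (e1 + e2) ([:- a, 1:] ^ m * [:- b, 1:] ^ n)"
    and "pm.span {e1} + pm.span {e2} = pm.span {e1 + e2}"
proof -
  have "act h (e1 + e2) = 0 \<longleftrightarrow> act h e1 = 0 \<and> act h e2 = 0" for h
  proof
    assume "act h (e1 + e2) = 0"
    then have "act h e1 = act (- h) e2"
      by (simp add: act_add_right pm.scale_minus_left add_eq_0_iff2)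
    then have "act h e1 \<in> pm.span {e1} \<inter> pm.span {e2}" unfolding pm.span_singleton by blast
    then have "act h e1 = 0" unfolding int by (rule singletonD)
    then show "act h e1 = 0 \<and> act h e2 = 0" using \<open>act h (e1 + e2) = 0\<close> by (simp add: act_add_right)
  qed (simp add: act_add_right)
  then show ann: "pm.annihilator (e1 + e2) ([:- a, 1:] ^ m * [:- b, 1:] ^ n)"
    unfolding pm.annihilator_def linear_powers_dvd_iff[OF ab]
    using pm.annihilatorD[OF e1] pm.annihilatorD[OF e2] by simp
  have s: "subspace (pm.span {x})" for x by (rule pm_subspace_imp) simp
  have lead: "lead_coeff ([:- c, 1:] ^ i) = 1" for c :: 'a and i by (simp add: lead_coeff_power)
  have "pm.span {e1 + e2} \<subseteq> pm.span {e1} + pm.span {e2}"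
    unfolding pm.span_singleton by (auto simp: act_add_right intro!: set_plus_intro)
  moreover have "dim (pm.span {e1} + pm.span {e2}) = m + n"
    using dim_set_plus[OF s s int] dim_cyclic[OF lead e1] dim_cyclic[OF lead e2]
    by (simp add: degree_linear_power)
  moreover have "dim (pm.span {e1 + e2}) = m + n"
  proof -
    have "lead_coeff ([:- a, 1:] ^ m * [:- b, 1:] ^ n) = 1" by (simp add: lead_coeff_mult lead_coeff_power)
    then show ?thesis using dim_cyclic[OF _ ann] by (simp add: degree_mult_eq degree_linear_power)
  qed
  ultimately show "pm.span {e1} + pm.span {e2} = pm.span {e1 + e2}"
    using subspace_dim_equal[OF s subspace_set_plus[OF s s], of "e1 + e2" e1 e2] by simp
qed

lemma cyclic_split:
  assumes ab: "a \<noteq> b" and e: "pm.annihilator e ([:- a, 1:] ^ m * [:- b, 1:] ^ n)"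
  shows "\<exists>e1 e2. pm.annihilator e1 ([:- a, 1:] ^ m) \<and> pm.annihilator e2 ([:- b, 1:] ^ n) \<and>
    pm.span {e1} \<inter> pm.span {e2} = {0} \<and> pm.span {e} = pm.span {e1} + pm.span {e2}"
proof -
  define p q where "p = [:- a, 1:] ^ m" and "q = [:- b, 1:] ^ n"
  have pq: "p \<noteq> 0" "q \<noteq> 0" by (simp_all add: p_def q_def)
  have ann: "act h e = 0 \<longleftrightarrow> p * q dvd h" for h
    using pm.annihilatorD[OF e] unfolding p_def q_def .
  have dvd: "p * q dvd h \<longleftrightarrow> p dvd h \<and> q dvd h" for h
    using linear_powers_dvd_iff[OF ab] unfolding p_def q_def .
  \<comment> \<open>Multiplying \<open>e\<close> by the complementary factor gives a generator of
    each primary component.\<close>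
  define e1 e2 where "e1 = act q e" and "e2 = act p e"
  have 1: "pm.annihilator e1 p"
    unfolding pm.annihilator_def e1_def act_mult[symmetric] ann using pq by simp
  have 2: "pm.annihilator e2 q"
    unfolding pm.annihilator_def e2_def act_mult[symmetric] ann using pq by (simp add: mult.commute[of p])
  have int: "pm.span {e1} \<inter> pm.span {e2} = {0}"
  proof -
    have "x = 0" if x1: "x \<in> pm.span {e1}" and x2: "x \<in> pm.span {e2}" for x
    proof -
      obtain g h where g: "x = act (g * q) e" and h: "x = act (h * p) e"
        using x1 x2 unfolding pm.span_singleton e1_def e2_def act_mult by blast
      have "act (g * q - h * p) e = 0" using g h by (simp add: pm.scale_left_diff_distrib)
      then have "p dvd g * q - h * p" unfolding ann dvd by blast
      \<comment> \<open>\<open>g * q\<close> is then divisible by both \<open>p\<close> and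
        \<open>q\<close>, hence by their product, and kills \<open>e\<close>.\<close>
      then have "p dvd g * q" by (metis dvd_diff_right_iff dvd_triv_right dvd_diffD diff_add_cancel dvd_add)
      then show "x = 0" unfolding g ann dvd by simp
    qed
    then show ?thesis using pm.span_zero by blast
  qed
  have s: "subspace (pm.span {x})" for x by (rule pm_subspace_imp) simp
  have lead: "lead_coeff p = 1" "lead_coeff q = 1" "lead_coeff (p * q) = 1"
    by (simp_all add: p_def q_def lead_coeff_power lead_coeff_mult)
  have "pm.span {e1} + pm.span {e2} \<subseteq> pm.span {e}"
  proof
    fix x assume "x \<in> pm.span {e1} + pm.span {e2}"
    then obtain y z where yz: "y \<in> pm.span {e1}" "z \<in> pm.span {e2}" "x = y + z" by (elim set_plus_elim)
    then obtain g h where "y = act g (act q e)" "z = act h (act p e)"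
      unfolding pm.span_singleton e1_def e2_def by blast
    then have "x = act (g * q + h * p) e" using yz(3) by (simp add: act_mult act_add_left)
    then show "x \<in> pm.span {e}" unfolding pm.span_singleton by blast
  qed
  moreover have "dim (pm.span {e1} + pm.span {e2}) = dim (pm.span {e})"
    using dim_set_plus[OF s s int] dim_cyclic[OF lead(1) 1] dim_cyclic[OF lead(2) 2]
      dim_cyclic[OF lead(3) e[folded p_def q_def]] pq by (simp add: degree_mult_eq)
  ultimately have "pm.span {e1} + pm.span {e2} = pm.span {e}"
    using subspace_dim_equal[OF subspace_set_plus[OF s s] s] by simp
  then show ?thesis using 1 2 int unfolding p_def q_def by blast
qed

end

section \<open>Monic quadratics and products of powers of two linear factors\<close>

lemma monic_dvd_eq:
  fixes p q :: "'a::field poly"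
  assumes "lead_coeff p = 1" "lead_coeff q = 1" "q dvd p" "degree p = degree q"
  shows "p = q"
proof -
  obtain s where s: "p = q * s" using assms(3) by (elim dvdE)
  have nz: "q \<noteq> 0" "s \<noteq> 0" using assms(1) s by auto
  then have "degree s = 0" using assms(4) s degree_mult_eq[of q s] by simp
  then obtain c where c: "s = [:c:]" by (rule degree_eq_zeroE)
  have "lead_coeff p = lead_coeff q * lead_coeff s" unfolding s by (rule lead_coeff_mult)
  then have "c = 1" using assms(1,2) c by simp
  then show ?thesis using s c by simp
qed

lemma monic_quadratic_simple_roots:
  fixes p :: "'a::field poly"
  assumes "lead_coeff p = 1" "degree p = 2" "x1 \<noteq> x2" "order x1 p = 1" "order x2 p = 1"
  shows "p = [:- x1, 1:] * [:- x2, 1:]"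
proof -
  have "[:- x1, 1:] ^ 1 dvd p" "[:- x2, 1:] ^ 1 dvd p"
    using order_1[of x1 p] order_1[of x2 p] unfolding assms(4,5) .
  then have "[:- x1, 1:] ^ 1 * [:- x2, 1:] ^ 1 dvd p"
    unfolding linear_powers_dvd_iff[OF assms(3)] by (rule conjI)
  then have dvd: "[:- x1, 1:] * [:- x2, 1:] dvd p" by (simp only: power_one_right)
  have "lead_coeff ([:- x1, 1:] * [:- x2, 1:]) = 1" unfolding lead_coeff_mult by simp
  moreover have "degree p = degree ([:- x1, 1:] * [:- x2, 1:])"
    unfolding assms(2) by (subst degree_mult_eq) simp_all
  ultimately show ?thesis using monic_dvd_eq[OF assms(1) _ dvd] by blast
qed

lemma monic_quadratic_double_root:
  fixes q :: "'a::field poly"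
  assumes "lead_coeff q = 1" "degree q = 2" "order y q = 2"
  shows "q = [:- y, 1:] * [:- y, 1:]"
proof -
  have "[:- y, 1:] ^ 2 dvd q" using order_1[of y q] unfolding assms(3) .
  then have dvd: "[:- y, 1:] * [:- y, 1:] dvd q" by (simp only: power2_eq_square)
  have "lead_coeff ([:- y, 1:] * [:- y, 1:]) = 1" unfolding lead_coeff_mult by simp
  moreover have "degree q = degree ([:- y, 1:] * [:- y, 1:])"
    unfolding assms(2) by (subst degree_mult_eq) simp_all
  ultimately show ?thesis using monic_dvd_eq[OF assms(1) _ dvd] by blast
qed

lemma split_poly_linear_powers: "split_poly ([:- a, 1:] ^ m * [:- b, 1:] ^ n :: 'a::field poly)"
proof -
  have "lead_coeff ([:- a, 1:] ^ m * [:- b, 1:] ^ n) = 1"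
    unfolding lead_coeff_mult lead_coeff_power by simp
  moreover have "(\<Prod>x\<leftarrow>replicate m a @ replicate n b. [:- x, 1:]) = [:- a, 1:] ^ m * [:- b, 1:] ^ n"
    by simp
  ultimately show ?thesis unfolding split_poly_def by (metis smult_1_left)
qed

lemma linear_powers_if_split:
  fixes r :: "'a::field poly"
  assumes "split_poly r" "lead_coeff r = 1" "\<And>c. poly r c = 0 \<Longrightarrow> c \<in> {a, b}"
  shows "\<exists>m n. r = [:- a, 1:] ^ m * [:- b, 1:] ^ n"
proof -
  obtain xs where r: "r = (\<Prod>x\<leftarrow>xs. [:- x, 1:])"
    using assms(1,2) unfolding split_poly_def by (metis smult_1_left)
  have "x \<in> {a, b}" if "x \<in> set xs" for x
  proof (rule assms(3))
    have "poly (\<Prod>x\<leftarrow>ys. [:- x, 1:]) x = 0" if "x \<in> set ys" for ys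
      using that by (induction ys) auto
    then show "poly r x = 0" unfolding r using that .
  qed
  then have "\<exists>m n. (\<Prod>x\<leftarrow>xs. [:- x, 1:]) = [:- a, 1:] ^ m * [:- b, 1:] ^ n"
  proof (induction xs)
    case Nil
    have "(\<Prod>x\<leftarrow>[]. [:- x, 1:]) = [:- a, 1:] ^ 0 * [:- b, 1:] ^ 0" by simp
    then show ?case by blast
  next
    case (Cons x xs)
    have "\<exists>m n. (\<Prod>x\<leftarrow>xs. [:- x, 1:]) = [:- a, 1:] ^ m * [:- b, 1:] ^ n"
      by (rule Cons.IH) (use Cons.prems in simp)
    then obtain m n where mn: "(\<Prod>x\<leftarrow>xs. [:- x, 1:]) = [:- a, 1:] ^ m * [:- b, 1:] ^ n"
      by blast
    have "x = a \<or> x = b" using Cons.prems[of x] by simp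
    then show ?case
    proof
      assume "x = a"
      then have "(\<Prod>x\<leftarrow>x # xs. [:- x, 1:]) = [:- a, 1:] ^ Suc m * [:- b, 1:] ^ n"
        by (simp add: mn mult_ac)
      then show ?thesis by blast
    next
      assume "x = b"
      then have "(\<Prod>x\<leftarrow>x # xs. [:- x, 1:]) = [:- a, 1:] ^ m * [:- b, 1:] ^ Suc n"
        by (simp add: mn mult_ac)
      then show ?thesis by blast
    qed
  qed
  then show ?thesis unfolding r .
qed

lemma dsum_pair:
  fixes S T :: "'b::ab_group_add set"
  assumes "0 \<in> T"
  shows "dsum W [S, T] \<longleftrightarrow> S \<inter> T = {0} \<and> W = S + T"
proof
  assume "dsum W [S, T]"
  then obtain W' W'' where "W'' = {0}" "W' = T + W''" "S \<inter> W' = {0}" "W = S + W'"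
    unfolding dsum.simps by blast
  moreover have "T + {0} = T" by (rule plus_singleton_zero)
  ultimately show "S \<inter> T = {0} \<and> W = S + T" by metis
next
  assume *: "S \<inter> T = {0} \<and> W = S + T"
  have "T \<inter> {0} = {0}" using assms by blast
  moreover have "T = T + {0}" by (rule plus_singleton_zero[symmetric])
  ultimately have "dsum T [T]" unfolding dsum.simps by blast
  then show "dsum W [S, T]" using * dsum.simps(2)[of W S "[T]"] by blast
qed

section \<open>Invariant factors against pairs of companion blocks\<close>

context fd_endo
begin

lemma repr_companion_pair:
  assumes ab: "a \<noteq> b"
  shows "repr W (diag_block_mat [companion_mat ([:- a, 1:] ^ m), companion_mat ([:- b, 1:] ^ n)]) \<longleftrightarrow>
    (\<exists>e. W = pm.span {e} \<and> pm.annihilator e ([:- a, 1:] ^ m * [:- b, 1:] ^ n))"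
    (is "repr W (diag_block_mat [?A, ?B]) \<longleftrightarrow> ?R")
proof -
  have lead: "lead_coeff ([:- c, 1:] ^ i) = 1" for c :: 'a and i by (simp add: lead_coeff_power)
  have "repr W (diag_block_mat [?A, ?B]) \<longleftrightarrow> (\<exists>Ws. dsum W Ws \<and> list_all2 repr Ws [?A, ?B])"
    by (rule repr_diag_block) (simp add: companion_mat_def)
  also have "\<dots> \<longleftrightarrow> (\<exists>S T. dsum W [S, T] \<and> repr S ?A \<and> repr T ?B)"
  proof
    assume "\<exists>Ws. dsum W Ws \<and> list_all2 repr Ws [?A, ?B]"
    then show "\<exists>S T. dsum W [S, T] \<and> repr S ?A \<and> repr T ?B"
      unfolding list_all2_Cons2 list_all2_Nil2 by blast
  next
    assume "\<exists>S T. dsum W [S, T] \<and> repr S ?A \<and> repr T ?B"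
    then show "\<exists>Ws. dsum W Ws \<and> list_all2 repr Ws [?A, ?B]"
      unfolding list_all2_Cons2 list_all2_Nil2 by blast
  qed
  also have "\<dots> \<longleftrightarrow> (\<exists>e1 e2. pm.annihilator e1 ([:- a, 1:] ^ m) \<and> pm.annihilator e2 ([:- b, 1:] ^ n) \<and>
      pm.span {e1} \<inter> pm.span {e2} = {0} \<and> W = pm.span {e1} + pm.span {e2})"
    unfolding repr_companion[OF lead]
    using dsum_pair[OF pm.span_zero] by metis
  also have "\<dots> \<longleftrightarrow> ?R"
  proof
    assume "\<exists>e1 e2. pm.annihilator e1 ([:- a, 1:] ^ m) \<and> pm.annihilator e2 ([:- b, 1:] ^ n) \<and>
      pm.span {e1} \<inter> pm.span {e2} = {0} \<and> W = pm.span {e1} + pm.span {e2}"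
    then obtain e1 e2 where *: "pm.annihilator e1 ([:- a, 1:] ^ m)" "pm.annihilator e2 ([:- b, 1:] ^ n)"
      "pm.span {e1} \<inter> pm.span {e2} = {0}" "W = pm.span {e1} + pm.span {e2}" by blast
    show ?R using cyclic_plus[OF ab *(1-3)] *(4) by blast
  next
    assume ?R
    then obtain e where e: "W = pm.span {e}" "pm.annihilator e ([:- a, 1:] ^ m * [:- b, 1:] ^ n)"
      by blast
    show "\<exists>e1 e2. pm.annihilator e1 ([:- a, 1:] ^ m) \<and> pm.annihilator e2 ([:- b, 1:] ^ n) \<and>
      pm.span {e1} \<inter> pm.span {e2} = {0} \<and> W = pm.span {e1} + pm.span {e2}"
      unfolding e(1) by (rule cyclic_split[OF ab e(2)])
  qed
  finally show ?thesis .
qed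

text \<open>Divisibility makes the orders non-increasing in the index. If
  \<open>order a (r i)\<close> were too large, at least \<open>i + 1\<close> factors would be
  counted at \<open>a\<close> for \<open>k + 2\<close>, while at most \<open>i\<close> are counted
  at \<open>b\<close> for \<open>k\<close>.\<close>

lemma order_le_if_jordan_number_le:
  assumes inv: "invariant_factors (*s) u r"
    and le: "\<And>k. k \<ge> 1 \<Longrightarrow> jordan_number (*s) u a (k + 2) \<le> jordan_number (*s) u b k"
  shows "order a (r i) \<le> order b (r i) + 2"
proof (rule ccontr)
  assume lt: "\<not> order a (r i) \<le> order b (r i) + 2"
  obtain N e where m: "\<forall>i. lead_coeff (r i) = 1" and dv: "\<forall>i. r (Suc i) dvd r i"
    and one: "\<forall>i\<ge>N. r i = 1" and ds: "dsum UNIV (map (\<lambda>i. pm.span {e i}) [0..<N])"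
    and ann: "\<forall>i<N. pm.annihilator (e i) (r i)"
    using inv unfolding invariant_factors_iff by blast
  have am: "pm.annihilator (e i) (r i) \<and> lead_coeff (r i) = 1" if "i < N" for i
    using ann m that by blast
  have nz: "r i \<noteq> 0" for i
  proof
    assume "r i = 0"
    then show False using spec[OF m, of i] by simp
  qed
  have mono: "order c (r j) \<le> order c (r i)" if "i \<le> j" for c i j
  proof -
    have "r j dvd r i" using that
    proof (induction j rule: dec_induct)
      case (step n)
      then show ?case using dv dvd_trans by blast
    qed simp
    then show ?thesis using nz by (intro dvd_imp_order_le)
  qed
  \<comment> \<open>The least \<open>k\<close> for which \<open>r i\<close>, and hence every later
    factor, is no longer counted at \<open>b\<close>.\<close>
  define k where "k = order b (r i) + 1"
  have k: "k \<ge> 1" by (simp add: k_def)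
  have iN: "i < N"
  proof (rule ccontr)
    assume "\<not> i < N"
    then have "r i = 1" using one by simp
    moreover have "order a (1 :: 'a poly) = 0" by (rule order_0I) simp
    ultimately show False using lt by simp
  qed
  have "{..i} \<subseteq> {j. j < N \<and> k + 2 \<le> order a (r j)}"
  proof
    fix j assume "j \<in> {..i}"
    then show "j \<in> {j. j < N \<and> k + 2 \<le> order a (r j)}"
      using mono[of j i a] lt iN by (simp add: k_def)
  qed
  then have "card {..i} \<le> card {j. j < N \<and> k + 2 \<le> order a (r j)}" by (intro card_mono) simp_all
  moreover have "{j. j < N \<and> k \<le> order b (r j)} \<subseteq> {..<i}"
  proof
    fix j assume "j \<in> {j. j < N \<and> k \<le> order b (r j)}"
    then show "j \<in> {..<i}" using mono[of i j b] by (cases "i \<le> j") (simp_all add: k_def)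
  qed
  then have "card {j. j < N \<and> k \<le> order b (r j)} \<le> card {..<i}" by (intro card_mono) simp_all
  moreover have "jordan_number (*s) u a (k + 2) = card {j. j < N \<and> k + 2 \<le> order a (r j)}"
    by (rule jordan_number_cyclic_dsum[OF ds]) (use am in simp_all)
  moreover have "jordan_number (*s) u b k = card {j. j < N \<and> k \<le> order b (r j)}"
    by (rule jordan_number_cyclic_dsum[OF ds]) (use am k in simp_all)
  ultimately show False using le[OF k] by simp
qed

text \<open>A diagonal block of the fourth condition with \<open>z = a\<close>, where \<delta>
  divided by \<open>z\<close> is \<open>b\<close>; the choice \<open>z = b\<close> interchanges the
  arguments.\<close>

definition paired_block :: "'a \<Rightarrow> 'a \<Rightarrow> 'a mat \<Rightarrow> bool" where
  "paired_block a b M \<longleftrightarrow> (\<exists>n k. k \<in> {0, 1, 2} \<and>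
    M = diag_block_mat [companion_mat ([:- a, 1:] ^ (n + k)), companion_mat ([:- b, 1:] ^ n)])"

lemma paired_block_square: "paired_block a b M \<Longrightarrow> dim_row M = dim_col M"
  unfolding paired_block_def by (auto simp: companion_mat_def Let_def)

text \<open>One block for each invariant factor: its cyclic summand splits into two primary parts,
  and the root of larger multiplicity is put first.\<close>

lemma paired_blocks_exist:
  assumes inv: "invariant_factors (*s) u r" and ab: "a \<noteq> b"
    and r: "\<And>i. \<exists>m n. r i = [:- a, 1:] ^ m * [:- b, 1:] ^ n \<and> m \<le> n + 2 \<and> n \<le> m + 2"
  shows "\<exists>bs Ms. represents (*s) bs (diag_block_mat Ms) u \<and>
    (\<forall>M\<in>set Ms. paired_block a b M \<or> paired_block b a M)"
proof -
  obtain N e where ds: "dsum UNIV (map (\<lambda>i. pm.span {e i}) [0..<N])"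
    and ann: "\<forall>i<N. pm.annihilator (e i) (r i)"
    using inv unfolding invariant_factors_iff by blast
  have "\<forall>i\<in>{..<N}. \<exists>M. repr (pm.span {e i}) M \<and> (paired_block a b M \<or> paired_block b a M)"
  proof
    fix i assume "i \<in> {..<N}"
    then have a: "pm.annihilator (e i) (r i)" using ann by simp
    obtain m n where mn: "r i = [:- a, 1:] ^ m * [:- b, 1:] ^ n" "m \<le> n + 2" "n \<le> m + 2"
      using r by blast
    show "\<exists>M. repr (pm.span {e i}) M \<and> (paired_block a b M \<or> paired_block b a M)"
    proof (cases "n \<le> m")
      case True
      let ?M = "diag_block_mat [companion_mat ([:- a, 1:] ^ (n + (m - n))), companion_mat ([:- b, 1:] ^ n)]"
      have "pm.annihilator (e i) ([:- a, 1:] ^ (n + (m - n)) * [:- b, 1:] ^ n)"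
        using a True unfolding mn(1) by simp
      then have "repr (pm.span {e i}) ?M" unfolding repr_companion_pair[OF ab] by blast
      moreover have "m - n \<in> {0, 1, 2}" using mn(2) by auto
      then have "paired_block a b ?M" unfolding paired_block_def by blast
      ultimately show ?thesis by blast
    next
      case False
      let ?M = "diag_block_mat [companion_mat ([:- b, 1:] ^ (m + (n - m))), companion_mat ([:- a, 1:] ^ m)]"
      have "pm.annihilator (e i) ([:- b, 1:] ^ (m + (n - m)) * [:- a, 1:] ^ m)"
        using a False unfolding mn(1) by (simp add: mult.commute)
      then have "repr (pm.span {e i}) ?M" unfolding repr_companion_pair[OF ab[symmetric]] by blast
      moreover have "n - m \<in> {0, 1, 2}" using mn(3) by auto
      then have "paired_block b a ?M" unfolding paired_block_def by blast
      ultimately show ?thesis by blast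
    qed
  qed
  from bchoice[OF this] obtain M where
    M: "\<forall>i\<in>{..<N}. repr (pm.span {e i}) (M i) \<and> (paired_block a b (M i) \<or> paired_block b a (M i))"
    by blast
  let ?Ms = "map M [0..<N]"
  have blocks: "\<forall>M\<in>set ?Ms. paired_block a b M \<or> paired_block b a M" using M by auto
  then have sq: "\<forall>M\<in>set ?Ms. dim_row M = dim_col M" using paired_block_square by blast
  have "list_all2 repr (map (\<lambda>i. pm.span {e i}) [0..<N]) ?Ms"
    unfolding list_all2_conv_all_nth using M by simp
  then have "repr UNIV (diag_block_mat ?Ms)" unfolding repr_diag_block[OF sq] using ds by blast
  then show ?thesis using blocks unfolding repr_def represents_rep by blast
qed

lemma kernel_dsum_linear_powers:
  assumes "dsum W Ws" "\<forall>S\<in>set Ws. \<exists>k l. S \<subseteq> kernel ([:- a, 1:] ^ k * [:- b, 1:] ^ l)"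
  shows "\<exists>k l. W \<subseteq> kernel ([:- a, 1:] ^ k * [:- b, 1:] ^ l)"
  using assms
proof (induction Ws arbitrary: W)
  case Nil
  then show ?case using pm.subspace_0[OF pm_subspace_kernel] by auto
next
  case (Cons S Ws)
  let ?p = "\<lambda>k l. [:- a, 1:] ^ k * [:- b, 1:] ^ l"
  obtain W' where W': "dsum W' Ws" "W = S + W'" using Cons.prems(1) by auto
  obtain k l where kl: "S \<subseteq> kernel (?p k l)" using Cons.prems(2) by auto
  obtain k' l' where kl': "W' \<subseteq> kernel (?p k' l')" using Cons.IH[OF W'(1)] Cons.prems(2) by auto
  have dvd: "?p k l dvd ?p (k + k') (l + l')" "?p k' l' dvd ?p (k + k') (l + l')"
    by (intro mult_dvd_mono le_imp_power_dvd; simp)+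
  have mono: "kernel g \<subseteq> kernel h" if "g dvd h" for g h
    using pm.scale_dvd_zero[OF _ that] unfolding kernel_def by blast
  have "W \<subseteq> kernel (?p (k + k') (l + l'))"
  proof
    fix x assume "x \<in> W"
    then obtain s t where "s \<in> S" "t \<in> W'" "x = s + t" unfolding W'(2) by (elim set_plus_elim)
    then show "x \<in> kernel (?p (k + k') (l + l'))"
      using kl kl' mono[OF dvd(1)] mono[OF dvd(2)] pm.subspace_add[OF pm_subspace_kernel] by blast
  qed
  then show ?case by blast
qed

lemma paired_blocks_quotient:
  assumes rep: "represents (*s) bs (diag_block_mat Ms) u"
    and Ms: "\<forall>M\<in>set Ms. paired_block a b M \<or> paired_block b a M"
    and ab: "a \<noteq> b" "a \<noteq> 0" "b \<noteq> 0"
  shows "quotient_on a b UNIV \<and> split_by a b"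
proof -
  have sq: "\<forall>M\<in>set Ms. dim_row M = dim_col M" using Ms paired_block_square by blast
  have "repr UNIV (diag_block_mat Ms)" using rep unfolding represents_rep repr_def by blast
  then obtain Ws where ds: "dsum UNIV Ws" and la: "list_all2 repr Ws Ms"
    unfolding repr_diag_block[OF sq] by blast
  have W: "subspace W \<and> quotient_on a b W \<and> (\<exists>k l. W \<subseteq> kernel ([:- a, 1:] ^ k * [:- b, 1:] ^ l))"
    if W_in: "W \<in> set Ws" for W
  proof -
    obtain i where i: "i < length Ws" "W = Ws ! i" using W_in in_set_conv_nth[of W Ws] by auto
    then have rW: "repr W (Ms ! i)" using list_all2_nthD[OF la] by simp
    have "paired_block a b (Ms ! i) \<or> paired_block b a (Ms ! i)"
      using Ms i list_all2_lengthD[OF la] by simp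
    then obtain e n k where k: "k \<in> {0, 1, 2}" and W: "W = pm.span {e}"
      and e: "pm.annihilator e ([:- a, 1:] ^ (n + k) * [:- b, 1:] ^ n) \<or>
        pm.annihilator e ([:- b, 1:] ^ (n + k) * [:- a, 1:] ^ n)"
    proof
      assume "paired_block a b (Ms ! i)"
      then obtain n k where nk: "k \<in> {0, 1, 2}" "Ms ! i =
          diag_block_mat [companion_mat ([:- a, 1:] ^ (n + k)), companion_mat ([:- b, 1:] ^ n)]"
        unfolding paired_block_def by blast
      show thesis using rW nk(1) that unfolding nk(2) repr_companion_pair[OF ab(1)] by blast
    next
      assume "paired_block b a (Ms ! i)"
      then obtain n k where nk: "k \<in> {0, 1, 2}" "Ms ! i =
          diag_block_mat [companion_mat ([:- b, 1:] ^ (n + k)), companion_mat ([:- a, 1:] ^ n)]"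
        unfolding paired_block_def by blast
      show thesis using rW nk(1) that unfolding nk(2) repr_companion_pair[OF ab(1)[symmetric]] by blast
    qed
    have "subspace W" unfolding W by (rule pm_subspace_imp) simp
    moreover have "quotient_on a b W"
      using e quotient_on_cyclic[OF _ ab(2,3) k] quotient_on_cyclic[OF _ ab(3,2) k] quotient_on_commute
      unfolding W by blast
    moreover have "\<exists>k l. W \<subseteq> kernel ([:- a, 1:] ^ k * [:- b, 1:] ^ l)"
    proof -
      have sub: "W \<subseteq> kernel p" if "pm.annihilator e p" for p
        unfolding W
        by (rule pm.span_minimal[OF _ pm_subspace_kernel])
          (use pm.annihilatorD[OF that, of p] in \<open>simp add: kernel_def\<close>)
      show ?thesis using e
      proof
        assume "pm.annihilator e ([:- b, 1:] ^ (n + k) * [:- a, 1:] ^ n)"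
        then have "W \<subseteq> kernel ([:- a, 1:] ^ n * [:- b, 1:] ^ (n + k))"
          using sub by (simp only: mult.commute)
        then show ?thesis by blast
      qed (use sub in blast)
    qed
    ultimately show ?thesis by blast
  qed
  have "quotient_on a b UNIV" by (rule quotient_on_dsum[OF ds]) (use W in blast)
  moreover have "\<exists>k l. UNIV \<subseteq> kernel ([:- a, 1:] ^ k * [:- b, 1:] ^ l)"
    by (rule kernel_dsum_linear_powers[OF ds]) (use W in blast)
  then have "split_by a b" unfolding split_by_def kernel_def by blast
  ultimately show ?thesis ..
qed

section \<open>Normalization of (p,q)-quotients\<close>

lemma poly_endo_quadratic:
  "poly_endo (*s) ([:- c, 1:] * [:- d, 1:]) f v = f (f v) - (c + d) *s f v + (c * d) *s v"
proof -
  have eq: "[:- c, 1:] * [:- d, 1:] = [:c * d, - (c + d), 1:]"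
    by (simp add: mult_pCons_left)
  show ?thesis unfolding poly_endo_def eq by (simp add: numeral_2_eq_2 scale_left_distrib scale_left_diff_distrib)
qed

text \<open>The equation reads \<open>f (c - f) = d\<close>, so \<open>c - f\<close> divided by
  \<open>d\<close> is the inverse.\<close>

lemma quadratic_bij:
  assumes f: "Vector_Spaces.linear (*s) (*s) f" and "\<And>v. f (f v) = c *s f v - d *s v" "d \<noteq> 0"
  shows "bij f"
proof (rule bijI)
  show "inj f"
  proof (rule injI)
    fix x y assume xy: "f x = f y"
    have "d *s v = c *s f v - f (f v)" for v using assms(2)[of v] by simp
    then have "d *s x = d *s y" using xy by metis
    then show "x = y" using assms(3) by simp
  qed
  have "f (inverse d *s (c *s y - f y)) = y" for y
    using assms(3) by (simp add: linear_maps[OF f] assms(2))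
  then show "surj f" by (rule surjI)
qed

text \<open>Dividing both automorphisms by \<open>y\<close> changes the roots of \<open>p\<close> to
  the two ratios and the double root of \<open>q\<close> to 1, without affecting their
  quotient.\<close>

lemma pq_quotient_iff_quotient_on:
  assumes p: "p = [:- x1, 1:] * [:- x2, 1:]" and q: "q = [:- y, 1:] * [:- y, 1:]"
    and x: "x1 \<noteq> 0" "x2 \<noteq> 0" and y: "y \<noteq> 0"
  shows "pq_quotient (*s) p q u \<longleftrightarrow> quotient_on (x1 * inverse y) (x2 * inverse y) UNIV"
proof
  let ?a = "x1 * inverse y" and ?b = "x2 * inverse y"
  assume "pq_quotient (*s) p q u"
  then obtain f g where f: "Vector_Spaces.linear (*s) (*s) f" and g: "Vector_Spaces.linear (*s) (*s) g"
    and "bij g" and pf: "\<And>v. poly_endo (*s) p f v = 0" and qg: "\<And>v. poly_endo (*s) q g v = 0"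
    and u: "u = f \<circ> inv_into UNIV g"
    unfolding pq_quotient_def automorphism_def endomorphism_def by blast
  have ff: "f (f v) = (x1 + x2) *s f v - (x1 * x2) *s v" for v
    using pf[of v] unfolding p poly_endo_quadratic by (simp add: algebra_simps)
  have gg: "g (g v) = (y + y) *s g v - (y * y) *s v" for v
    using qg[of v] unfolding q poly_endo_quadratic by (simp add: algebra_simps)
  have ug: "u (g v) = f v" for v using \<open>bij g\<close> unfolding u by (simp add: bij_is_inj)
  define A B where "A v = inverse y *s f v" and "B v = inverse y *s g v" for v
  have "Vector_Spaces.linear (*s) (*s) A" "Vector_Spaces.linear (*s) (*s) B"
    by (rule linear_mapI; simp add: A_def B_def linear_maps[OF f] linear_maps[OF g] scale_right_distrib mult.commute)+
  moreover have "A (A v) = (?a + ?b) *s A v - (?a * ?b) *s v" for v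
    by (simp add: A_def linear_maps[OF f] ff scale_right_diff_distrib algebra_simps)
  moreover have "B (B v) = B v + B v - v" for v
  proof -
    have BB: "B (B v) = (inverse y * inverse y * (y + y)) *s g v - (inverse y * inverse y * (y * y)) *s v"
      by (simp only: B_def linear_maps(2)[OF g] gg scale_scale scale_right_diff_distrib mult.assoc)
    have c: "inverse y * inverse y * (y + y) = inverse y + inverse y"
      "inverse y * inverse y * (y * y) = 1" using y by (simp_all add: field_simps)
    show ?thesis unfolding BB c by (simp only: B_def scale_left_distrib scale_one)
  qed
  moreover have "u (B v) = A v" for v by (simp add: A_def B_def u_scale ug)
  ultimately show "quotient_on ?a ?b UNIV" unfolding quotient_on_def by blast
next
  let ?a = "x1 * inverse y" and ?b = "x2 * inverse y"
  assume "quotient_on ?a ?b UNIV"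
  then obtain A B where A: "Vector_Spaces.linear (*s) (*s) A" and B: "Vector_Spaces.linear (*s) (*s) B"
    and AA: "\<And>v. A (A v) = (?a + ?b) *s A v - (?a * ?b) *s v" and BB: "\<And>v. B (B v) = B v + B v - v"
    and uB: "\<And>v. u (B v) = A v" unfolding quotient_on_def by blast
  define f g where "f v = y *s A v" and "g v = y *s B v" for v
  have f: "Vector_Spaces.linear (*s) (*s) f" and g: "Vector_Spaces.linear (*s) (*s) g"
    by (rule linear_mapI; simp add: f_def g_def linear_maps[OF A] linear_maps[OF B] scale_right_distrib mult.commute)+
  have c1: "y * (y * (?a + ?b)) = (x1 + x2) * y" and c2: "y * (y * (?a * ?b)) = x1 * x2"
    using y by (simp_all add: field_simps)
  have ff: "f (f v) = (x1 + x2) *s f v - (x1 * x2) *s v" for v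
  proof -
    have "f (f v) = (y * (y * (?a + ?b))) *s A v - (y * (y * (?a * ?b))) *s v"
      unfolding f_def linear_maps(2)[OF A] AA by (simp only: scale_right_diff_distrib scale_scale mult.assoc)
    then show ?thesis unfolding c1 c2 f_def by simp
  qed
  have gg: "g (g v) = (y + y) *s g v - (y * y) *s v" for v
    by (simp only: g_def linear_maps(2)[OF B] BB scale_scale scale_left_distrib distrib_right
        scale_right_distrib scale_right_diff_distrib)
  have bij: "bij f" "bij g" using quadratic_bij[OF f ff] quadratic_bij[OF g gg] x y by simp_all
  have "u = f \<circ> inv_into UNIV g"
  proof
    fix v
    have "u (g z) = f z" for z by (simp add: f_def g_def u_scale uB)
    then have "u (g (inv_into UNIV g v)) = f (inv_into UNIV g v)" .
    then show "u v = (f \<circ> inv_into UNIV g) v" using bij(2) by (simp add: bij_is_surj surj_f_inv_f)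
  qed
  moreover have "poly_endo (*s) p f v = 0" "poly_endo (*s) q g v = 0" for v
    unfolding p q poly_endo_quadratic by (simp_all add: ff gg)
  ultimately show "pq_quotient (*s) p q u"
    unfolding pq_quotient_def automorphism_def endomorphism_def using f g bij by blast
qed

lemma jordan_number_le_if_quotient_on:
  assumes q: "quotient_on a b UNIV" and ab: "a \<noteq> b" "a \<noteq> 0" "b \<noteq> 0" and k: "k \<ge> 1"
  shows "jordan_number (*s) u a (k + 2) \<le> jordan_number (*s) u b k"
proof -
  obtain A B where A: "Vector_Spaces.linear (*s) (*s) A" and B: "Vector_Spaces.linear (*s) (*s) B"
    and AA: "\<And>v. A (A v) = (a + b) *s A v - (a * b) *s v" and BB: "\<And>v. B (B v) = B v + B v - v"
    and uB: "\<And>v. u (B v) = A v" using q unfolding quotient_on_def by blast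
  define N where "N x = B x - x" for x
  have N: "Vector_Spaces.linear (*s) (*s) N"
    by (rule linear_mapI) (simp_all add: N_def linear_maps[OF B] scale_right_diff_distrib)
  have NN: "N (N x) = 0" for x by (simp add: N_def linear_maps[OF B] BB)
  have u: "u x = A (x - N x)" for x
  proof -
    have "B (x - N x) = x" by (simp add: N_def linear_maps[OF B] BB)
    then show ?thesis using uB[of "x - N x"] by simp
  qed
  interpret split_pair "(*s)" Basis u A N a b
    by (intro split_pair.intro split_pair_axioms.intro fd_endo_axioms A N AA NN u ab)
  show ?thesis by (rule jordan_number_le[OF k])
qed

end

section \<open>Equivalence of the four conditions\<close>

theorem theorem4p12:
  fixes sc :: "'a::field \<Rightarrow> 'b::ab_group_add \<Rightarrow> 'b"
    and Basis :: "'b set"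
    and p q :: "'a poly"
    and x1 x2 y \<delta> :: 'a
    and u :: "'b \<Rightarrow> 'b"
  assumes "finite_dimensional_vector_space sc Basis"
    and "endomorphism sc u"
    and "lead_coeff p = 1" and "degree p = 2" and "split_poly p"
    and "lead_coeff q = 1" and "degree q = 2" and "split_poly q"
    and "poly p 0 * poly q 0 \<noteq> 0"
    and "\<delta> = poly p 0 * inverse (poly q 0)"
    and "x1 \<noteq> x2" and "Polynomial.order x1 p = 1" and "Polynomial.order x2 p = 1"
    and "Polynomial.order y q = 2"
  shows
    "let
       cond_i = pq_quotient sc p q u \<and> q_exceptional sc p q u;
       cond_ii =
         triangularizable sc u \<and>
         (\<forall>c. eigval sc u c \<longrightarrow> c \<in> {x1 * inverse y, x2 * inverse y}) \<and>
         intertwined 2 (jordan_number sc u (x1 * inverse y)) (jordan_number sc u (x2 * inverse y));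
       cond_iii =
         (\<forall>r i. invariant_factors sc u r \<longrightarrow>
            split_poly (r i) \<and>
            (\<forall>c. poly (r i) c = 0 \<longrightarrow> c \<in> {x1 * inverse y, x2 * inverse y}) \<and>
            \<bar>int (Polynomial.order (x1 * inverse y) (r i)) -
             int (Polynomial.order (x2 * inverse y) (r i))\<bar> \<le> 2);
       cond_iv =
         (\<exists>bs Ms. represents sc bs (diag_block_mat Ms) u \<and>
            (\<forall>M\<in>set Ms. \<exists>n \<epsilon> z. \<epsilon> \<in> {0, 1, 2} \<and> to_ac z \<in> root_quotients p q \<and>
               M = diag_block_mat
                     [companion_mat ([:- z, 1:] ^ (n + \<epsilon>)),
                      companion_mat ([:- (\<delta> * inverse z), 1:] ^ n)]))
     in (cond_i \<longleftrightarrow> cond_ii) \<and> (cond_ii \<longleftrightarrow> cond_iii) \<and> (cond_iii \<longleftrightarrow> cond_iv)"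
proof -
  interpret fd_endo sc Basis u
    using assms(1,2) by (simp add: fd_endo_def fd_endo_axioms_def endomorphism_def)
  define a b where "a = x1 * inverse y" and "b = x2 * inverse y"
  have p: "p = [:- x1, 1:] * [:- x2, 1:]"
    using assms(3,4,11-13) by (rule monic_quadratic_simple_roots)
  have q: "q = [:- y, 1:] * [:- y, 1:]"
    using assms(6,7,14) by (rule monic_quadratic_double_root)
  have p0: "poly p 0 = x1 * x2" and q0: "poly q 0 = y * y" by (simp_all add: p q)
  have nz: "x1 \<noteq> 0" "x2 \<noteq> 0" "y \<noteq> 0" using assms(9) unfolding p0 q0 by auto
  have ab: "a \<noteq> b" "a \<noteq> 0" "b \<noteq> 0" using nz assms(11) by (simp_all add: a_def b_def)
  \<comment> \<open>\<delta> is \<open>x1 * x2\<close> divided by the square of \<open>y\<close>,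
    that is, the product of \<open>a\<close> and \<open>b\<close>.\<close>
  have \<delta>: "\<delta> * inverse a = b" "\<delta> * inverse b = a"
    using nz unfolding assms(10) p0 q0 a_def b_def by (simp_all add: field_simps)
  have Root_p: "Root p = {to_ac x1, to_ac x2}"
    unfolding Root_def ev_def[symmetric] p ev_mult by (auto simp: ev_pCons ev_0)
  have Root_q: "Root q = {to_ac y}"
    unfolding Root_def ev_def[symmetric] q ev_mult by (auto simp: ev_pCons ev_0)
  have rq: "root_quotients p q = {to_ac a, to_ac b}"
    unfolding root_quotients_def Root_p Root_q a_def b_def by auto
  have exc: "q_exceptional sc p q u \<longleftrightarrow> split_by a b"
    unfolding q_exceptional_def rq by (rule ac_eigval_iff_split_by)
  have quot: "pq_quotient sc p q u \<longleftrightarrow> quotient_on a b UNIV"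
    unfolding a_def b_def by (rule pq_quotient_iff_quotient_on[OF p q nz])
  define I where "I \<longleftrightarrow> pq_quotient sc p q u \<and> q_exceptional sc p q u"
  define II where "II \<longleftrightarrow> triangularizable sc u \<and>
    (\<forall>c. eigval sc u c \<longrightarrow> c \<in> {a, b}) \<and> intertwined 2 (jordan_number sc u a) (jordan_number sc u b)"
  define III where "III \<longleftrightarrow> (\<forall>r i. invariant_factors sc u r \<longrightarrow> split_poly (r i) \<and>
    (\<forall>c. poly (r i) c = 0 \<longrightarrow> c \<in> {a, b}) \<and>
    \<bar>int (Polynomial.order a (r i)) - int (Polynomial.order b (r i))\<bar> \<le> 2)"
  define IV where "IV \<longleftrightarrow> (\<exists>bs Ms. represents sc bs (diag_block_mat Ms) u \<and>
    (\<forall>M\<in>set Ms. \<exists>n \<epsilon> z. \<epsilon> \<in> {0, 1, 2} \<and> to_ac z \<in> root_quotients p q \<and>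
      M = diag_block_mat [companion_mat ([:- z, 1:] ^ (n + \<epsilon>)),
        companion_mat ([:- (\<delta> * inverse z), 1:] ^ n)]))"
  have block: "(\<exists>n \<epsilon> z. \<epsilon> \<in> {0, 1, 2} \<and> to_ac z \<in> root_quotients p q \<and>
      M = diag_block_mat [companion_mat ([:- z, 1:] ^ (n + \<epsilon>)),
        companion_mat ([:- (\<delta> * inverse z), 1:] ^ n)]) \<longleftrightarrow>
    paired_block a b M \<or> paired_block b a M" (is "?L \<longleftrightarrow> ?R") for M
  proof
    assume ?L
    then obtain n \<epsilon> z where M: "\<epsilon> \<in> {0, 1, 2}" "to_ac z \<in> root_quotients p q"
      "M = diag_block_mat [companion_mat ([:- z, 1:] ^ (n + \<epsilon>)),
        companion_mat ([:- (\<delta> * inverse z), 1:] ^ n)]" by blast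
    have "z = a \<or> z = b" using M(2) unfolding rq by simp
    then show ?R
    proof
      assume z: "z = a"
      show ?R using M(1,3) unfolding z \<delta> paired_block_def by blast
    next
      assume z: "z = b"
      show ?R using M(1,3) unfolding z \<delta> paired_block_def by blast
    qed
  next
    have z: "to_ac a \<in> root_quotients p q" "to_ac b \<in> root_quotients p q" unfolding rq by simp_all
    assume ?R
    then show ?L
    proof
      assume "paired_block a b M"
      then obtain n k where M: "k \<in> {0, 1, 2}" "M =
          diag_block_mat [companion_mat ([:- a, 1:] ^ (n + k)), companion_mat ([:- b, 1:] ^ n)]"
        unfolding paired_block_def by blast
      then show ?L using z(1) by (intro exI[of _ n] exI[of _ k] exI[of _ a]) (simp only: \<delta> simp_thms)
    next
      assume "paired_block b a M"
      then obtain n k where M: "k \<in> {0, 1, 2}" "M =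
          diag_block_mat [companion_mat ([:- b, 1:] ^ (n + k)), companion_mat ([:- a, 1:] ^ n)]"
        unfolding paired_block_def by blast
      then show ?L using z(2) by (intro exI[of _ n] exI[of _ k] exI[of _ b]) (simp only: \<delta> simp_thms)
    qed
  qed
  have IV: "IV \<longleftrightarrow> (\<exists>bs Ms. represents sc bs (diag_block_mat Ms) u \<and>
      (\<forall>M\<in>set Ms. paired_block a b M \<or> paired_block b a M))"
    unfolding IV_def block ..
  have II: "II \<longleftrightarrow> split_by a b \<and> intertwined 2 (jordan_number sc u a) (jordan_number sc u b)"
    unfolding II_def triangularizable_iff_split_by[symmetric] by blast
  \<comment> \<open>The equivalences are obtained from one cycle: I to II to III to IV and back to
    I.\<close>
  have "I \<Longrightarrow> II"
  proof -
    assume I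
    then have s: "split_by a b" and ab_quot: "quotient_on a b UNIV" unfolding I_def exc quot by blast+
    have "intertwined 2 (jordan_number sc u a) (jordan_number sc u b)"
      unfolding intertwined_def
      using jordan_number_le_if_quotient_on[OF ab_quot ab]
        jordan_number_le_if_quotient_on[OF quotient_on_commute[OF ab_quot] ab(1)[symmetric] ab(3,2)]
      by blast
    then show II unfolding II using s by blast
  qed
  moreover have "II \<Longrightarrow> III"
    unfolding III_def
  proof (intro allI impI)
    fix r i assume II and inv: "invariant_factors sc u r"
    then have s: "split_by a b" and le: "intertwined 2 (jordan_number sc u a) (jordan_number sc u b)"
      unfolding II by blast+
    obtain k l where kl: "r 0 dvd [:- a, 1:] ^ k * [:- b, 1:] ^ l"
      using s unfolding invariant_factors_split_by[OF inv] by blast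
    have lead: "lead_coeff (r i) = 1" and dv: "\<And>i. r (Suc i) dvd r i"
      using inv unfolding invariant_factors_iff by blast+
    have "r i dvd r 0"
    proof (induction i)
      case (Suc i)
      show ?case by (rule dvd_trans[OF dv Suc])
    qed simp
    then obtain m n where r: "r i = [:- a, 1:] ^ m * [:- b, 1:] ^ n"
      using monic_dvd_linear_powers[OF lead dvd_trans[OF _ kl]] by blast
    have "order a (r i) \<le> order b (r i) + 2"
      by (rule order_le_if_jordan_number_le[OF inv]) (use le in \<open>simp add: intertwined_def\<close>)
    moreover have "order b (r i) \<le> order a (r i) + 2"
      by (rule order_le_if_jordan_number_le[OF inv]) (use le in \<open>simp add: intertwined_def\<close>)
    ultimately have "\<bar>int (order a (r i)) - int (order b (r i))\<bar> \<le> 2" by linarith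
    moreover have "split_poly (r i)" unfolding r by (rule split_poly_linear_powers)
    moreover have "\<forall>c. poly (r i) c = 0 \<longrightarrow> c \<in> {a, b}" unfolding r by auto
    ultimately show "split_poly (r i) \<and> (\<forall>c. poly (r i) c = 0 \<longrightarrow> c \<in> {a, b}) \<and>
      \<bar>int (order a (r i)) - int (order b (r i))\<bar> \<le> 2" by blast
  qed
  moreover have "III \<Longrightarrow> IV"
  proof -
    assume III
    \<comment> \<open>III is universally quantified over sequences of invariant factors, so one has
      to be produced before it says anything.\<close>
    obtain r where inv: "invariant_factors sc u r" using invariant_factors_exist by blast
    have "\<exists>m n. r i = [:- a, 1:] ^ m * [:- b, 1:] ^ n \<and> m \<le> n + 2 \<and> n \<le> m + 2" for i
    proof -
      have lead: "lead_coeff (r i) = 1" using inv unfolding invariant_factors_iff by blast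
      have sp: "split_poly (r i)" and roots: "\<And>c. poly (r i) c = 0 \<Longrightarrow> c \<in> {a, b}"
        and ord: "\<bar>int (order a (r i)) - int (order b (r i))\<bar> \<le> 2"
        using \<open>III\<close> inv unfolding III_def by blast+
      obtain m n where r: "r i = [:- a, 1:] ^ m * [:- b, 1:] ^ n"
        using linear_powers_if_split[OF sp lead roots] by blast
      have "m \<le> n + 2" "n \<le> m + 2"
        using ord unfolding r order_linear_powers[OF ab(1)] by linarith+
      then show ?thesis using r by blast
    qed
    then show IV unfolding IV by (rule paired_blocks_exist[OF inv ab(1)])
  qed
  moreover have "IV \<Longrightarrow> I"
    unfolding IV I_def exc quot using paired_blocks_quotient[OF _ _ ab] by blast
  ultimately have "(I \<longleftrightarrow> II) \<and> (II \<longleftrightarrow> III) \<and> (III \<longleftrightarrow> IV)" by blast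
  then show ?thesis
    unfolding Let_def I_def II_def III_def IV_def a_def b_def .
qed

end
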